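(* Let $K$ be a field, $S=K[X_1,\dots,X_n]$ the standard graded polynomial ring, $c\geq 1$ an integer, $T=\operatorname{Sym}(S_c)$, and for $0\le k\le c-1$ let $V_S(c,k)=\bigoplus_{i\in\mathbb N}S_{k+ic}$, viewed as a graded $T$-module. Then for all integers $i\geq 0$ and $k=0,\dots,c-1$ we have $$t_i^T(V_S(c,k))<1+i+\frac{i-k}{c}.$$ If moreover $K$ has characteristic $0$ or characteristic $>c+1$, and $i\geq c$, then $$t_i^T(V_S(c,k))<1+i+\frac{i-k-1}{c}.$$
   Context: $T=\operatorname{Sym}(S_c)=K[Y_u : u \text{ a monomial of } S \text{ of degree } c]$ is the standard graded polynomial ring (each $Y_u$ has degree $1$). $S^{(c)}=\bigoplus_{i}S_{ic}$ is the $c$-th Veronese subring, with $S_{ic}$ in degree $i$; $T$ surjects onto $S^{(c)}$ via $Y_u\mapsto u$, and $V_S(c,k)$ is an $S^{(c)}$-module, hence a $T$-module, graded by $V_S(c,k)_i=S_{k+ic}$. For a finitely generated graded $T$-module $M$, $\beta^T_{i,j}(M)=\dim_K\operatorname{Tor}_i^T(M,K)_j$ and $t_i^T(M)=\max\{j\in\mathbb Z:\beta^T_{i,j}(M)\ne 0\}$ if $\operatorname{Tor}_i^T(M,K)\neq 0$, and $t_i^T(M)=-\infty$ otherwise. *)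

theory Defs
  imports
    Complex_Main
    "HOL-Library.Poly_Mapping"
    "HOL-Library.Extended_Real"
    "HOL-Library.Extended_Nat"
begin

abbreviation keys :: "('a \<Rightarrow>\<^sub>0 'b::zero) \<Rightarrow> 'a set" where "keys \<equiv> Poly_Mapping.keys"
abbreviation lookup :: "('a \<Rightarrow>\<^sub>0 'b::zero) \<Rightarrow> 'a \<Rightarrow> 'b" where "lookup \<equiv> Poly_Mapping.lookup"

section \<open>Polynomial rings in a set of indeterminates\<close>

type_synonym ('v, 'k) mpoly = "('v \<Rightarrow>\<^sub>0 nat) \<Rightarrow>\<^sub>0 'k"

definition mdeg :: "('v \<Rightarrow>\<^sub>0 nat) \<Rightarrow> nat" where
  "mdeg m = (\<Sum>v\<in>keys m. lookup m v)"

text \<open>\<open>polys V\<close> is the polynomial ring in the indeterminates \<open>V\<close> (a subring of the type of all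
  polynomials) and \<open>homog V e\<close> its component of degree \<open>e\<close> for the standard grading.\<close>

definition polys :: "'v set \<Rightarrow> ('v, 'k::zero) mpoly set" where
  "polys V = {p. \<forall>m\<in>keys p. keys m \<subseteq> V}"

definition homog :: "'v set \<Rightarrow> int \<Rightarrow> ('v, 'k::zero) mpoly set" where
  "homog V e = {p \<in> polys V. \<forall>m\<in>keys p. int (mdeg m) = e}"

definition poly_subst :: "('v \<Rightarrow> ('w, 'k) mpoly) \<Rightarrow> ('v, 'k::comm_ring_1) mpoly \<Rightarrow> ('w, 'k) mpoly" where
  "poly_subst f p =
     (\<Sum>m\<in>keys p. Poly_Mapping.single 0 (lookup p m) * (\<Prod>v\<in>keys m. f v ^ lookup m v))"


section \<open>Graded modules and graded free modules\<close>

definition graded_carrier :: "(int \<Rightarrow> 'm set) \<Rightarrow> 'm::comm_monoid_add set" where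
  "graded_carrier M = {\<Sum>j\<in>J. x j | J x. finite J \<and> (\<forall>j\<in>J. x j \<in> M j)}"

text \<open>Graded modules over \<open>polys V\<close>, given by their homogeneous components \<open>M j\<close>. The underlying
  module is the (by \<open>indep\<close> direct) sum \<open>graded_carrier M\<close> of the components.\<close>

locale graded_module =
  fixes V :: "'v set"
    and act :: "('v, 'k::field) mpoly \<Rightarrow> 'm \<Rightarrow> 'm::ab_group_add"
    and M :: "int \<Rightarrow> 'm set"
  assumes comp_zero: "0 \<in> M j"
    and comp_add: "x \<in> M j \<Longrightarrow> y \<in> M j \<Longrightarrow> x + y \<in> M j"
    and comp_uminus: "x \<in> M j \<Longrightarrow> - x \<in> M j"
    and indep: "finite J \<Longrightarrow> (\<And>j. j \<in> J \<Longrightarrow> z j \<in> M j) \<Longrightarrow> (\<Sum>j\<in>J. z j) = 0 \<Longrightarrow> j \<in> J \<Longrightarrow> z j = 0"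
    and act_comp: "p \<in> homog V e \<Longrightarrow> x \<in> M j \<Longrightarrow> act p x \<in> M (e + j)"
    and act_add_left: "p \<in> polys V \<Longrightarrow> q \<in> polys V \<Longrightarrow> x \<in> graded_carrier M \<Longrightarrow>
          act (p + q) x = act p x + act q x"
    and act_add_right: "p \<in> polys V \<Longrightarrow> x \<in> graded_carrier M \<Longrightarrow> y \<in> graded_carrier M \<Longrightarrow>
          act p (x + y) = act p x + act p y"
    and act_mult: "p \<in> polys V \<Longrightarrow> q \<in> polys V \<Longrightarrow> x \<in> graded_carrier M \<Longrightarrow>
          act (p * q) x = act p (act q x)"
    and act_one: "x \<in> graded_carrier M \<Longrightarrow> act 1 x = x"

definition pscale :: "'a::semiring_0 \<Rightarrow> ('b \<Rightarrow>\<^sub>0 'a) \<Rightarrow> ('b \<Rightarrow>\<^sub>0 'a)" where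
  "pscale a f = Poly_Mapping.map ((*) a) f"

text \<open>The free module over \<open>polys V\<close> with basis \<open>B\<close>, and its component of degree \<open>j\<close> when each
  basis element \<open>b\<close> is given the degree \<open>d b\<close>.\<close>

definition free_carrier :: "'v set \<Rightarrow> 'b set \<Rightarrow> ('b \<Rightarrow>\<^sub>0 ('v, 'k::zero) mpoly) set" where
  "free_carrier V B = {f. keys f \<subseteq> B \<and> (\<forall>b. lookup f b \<in> polys V)}"

definition free_comp :: "'v set \<Rightarrow> 'b set \<Rightarrow> ('b \<Rightarrow> int) \<Rightarrow> int \<Rightarrow> ('b \<Rightarrow>\<^sub>0 ('v, 'k::zero) mpoly) set" where
  "free_comp V B d j = {f. keys f \<subseteq> B \<and> (\<forall>b. lookup f b \<in> homog V (j - d b))}"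

text \<open>The linear map on a free module that sends each basis element \<open>b\<close> to \<open>g b\<close>; scalars act on
  the target by \<open>act\<close>.\<close>

definition lin :: "('a::zero \<Rightarrow> 'm \<Rightarrow> 'm) \<Rightarrow> ('b \<Rightarrow> 'm) \<Rightarrow> ('b \<Rightarrow>\<^sub>0 'a) \<Rightarrow> 'm::comm_monoid_add" where
  "lin act g f = (\<Sum>b\<in>keys f. act (lookup f b) (g b))"


section \<open>Graded free resolutions, Tor and graded Betti numbers\<close>

text \<open>A complex \<open>\<dots> \<rightarrow> F\<^sub>2 \<rightarrow> F\<^sub>1 \<rightarrow> F\<^sub>0 \<rightarrow> M\<close> of free modules \<open>F\<^sub>i\<close> with basis \<open>basis F i\<close>. The
  differential \<open>F\<^sub>i \<rightarrow> F\<^sub>i\<^sub>-\<^sub>1\<close> (\<open>i \<ge> 1\<close>) and the augmentation \<open>F\<^sub>0 \<rightarrow> M\<close> are given by the images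
  \<open>diff F i b\<close> and \<open>aug F b\<close> of the basis elements; \<open>diff F 0\<close> is irrelevant.\<close>

record (overloaded) ('b, 'v, 'k, 'm) free_complex =
  basis :: "nat \<Rightarrow> 'b set"
  bdeg :: "nat \<Rightarrow> 'b \<Rightarrow> int"
  aug :: "'b \<Rightarrow> 'm"
  diff :: "nat \<Rightarrow> 'b \<Rightarrow> ('b \<Rightarrow>\<^sub>0 (('v \<Rightarrow>\<^sub>0 nat) \<Rightarrow>\<^sub>0 'k))"

definition graded_free_resolution ::
  "'v set \<Rightarrow> (('v, 'k::field) mpoly \<Rightarrow> 'm \<Rightarrow> 'm) \<Rightarrow> (int \<Rightarrow> 'm::ab_group_add set)
    \<Rightarrow> ('b, 'v, 'k, 'm) free_complex \<Rightarrow> bool" where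
  "graded_free_resolution V act M F \<longleftrightarrow>
     (\<forall>b\<in>basis F 0. aug F b \<in> M (bdeg F 0 b)) \<and>
     (\<forall>i. \<forall>b\<in>basis F (Suc i).
        diff F (Suc i) b \<in> free_comp V (basis F i) (bdeg F i) (bdeg F (Suc i) b)) \<and>
     lin act (aug F) ` free_carrier V (basis F 0) = graded_carrier M \<and>
     lin pscale (diff F 1) ` free_carrier V (basis F 1) =
       {f \<in> free_carrier V (basis F 0). lin act (aug F) f = 0} \<and>
     (\<forall>i. lin pscale (diff F (i + 2)) ` free_carrier V (basis F (i + 2)) =
       {f \<in> free_carrier V (basis F (i + 1)). lin pscale (diff F (i + 1)) f = 0})"

text \<open>With \<open>K = T/T\<^sub>+\<close>, where \<open>T = polys V\<close>, the space \<open>F\<^sub>i \<otimes>\<^sub>T K\<close> is the \<open>K\<close>-vector space with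
  basis \<open>basis F i\<close>, and the differential of \<open>F \<otimes>\<^sub>T K\<close> is obtained by replacing the matrix entries
  of the differential of \<open>F\<close> by their constant coefficients. \<open>Tor\<^sub>i(M, K)\<^sub>j\<close> is the quotient
  of \<open>tor_cycles F i j\<close> by \<open>tor_boundaries F i j\<close>.\<close>

definition diff_tensor ::
  "('b, 'v, 'k::field, 'm) free_complex \<Rightarrow> nat \<Rightarrow> ('b \<Rightarrow>\<^sub>0 'k) \<Rightarrow> ('b \<Rightarrow>\<^sub>0 'k)" where
  "diff_tensor F i = lin pscale (\<lambda>b. Poly_Mapping.map (\<lambda>p. lookup p 0) (diff F i b))"

definition tensor_comp ::
  "('b, 'v, 'k::field, 'm) free_complex \<Rightarrow> nat \<Rightarrow> int \<Rightarrow> ('b \<Rightarrow>\<^sub>0 'k) set" where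
  "tensor_comp F i j = {f. keys f \<subseteq> {b \<in> basis F i. bdeg F i b = j}}"

definition tor_cycles ::
  "('b, 'v, 'k::field, 'm) free_complex \<Rightarrow> nat \<Rightarrow> int \<Rightarrow> ('b \<Rightarrow>\<^sub>0 'k) set" where
  "tor_cycles F i j = {f \<in> tensor_comp F i j. i = 0 \<or> diff_tensor F i f = 0}"

definition tor_boundaries ::
  "('b, 'v, 'k::field, 'm) free_complex \<Rightarrow> nat \<Rightarrow> int \<Rightarrow> ('b \<Rightarrow>\<^sub>0 'k) set" where
  "tor_boundaries F i j = diff_tensor F (Suc i) ` tensor_comp F (Suc i) j"

lemma lookup_pscale [simp]: "lookup (pscale a f) b = a * lookup f b"
  unfolding pscale_def by transfer (simp add: when_def)

interpretation pscale_module: module "pscale :: 'a::comm_ring_1 \<Rightarrow> ('b \<Rightarrow>\<^sub>0 'a) \<Rightarrow> _"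
  by unfold_locales (auto intro!: poly_mapping_eqI simp: lookup_add algebra_simps)

interpretation pscale_vector_space: vector_space "pscale :: 'k::field \<Rightarrow> ('b \<Rightarrow>\<^sub>0 'k) \<Rightarrow> _"
  by unfold_locales (auto intro!: poly_mapping_eqI simp: lookup_add algebra_simps)

text \<open>The dimension of \<open>Z / W\<close> for subspaces \<open>W \<subseteq> Z\<close>, i.e. the least size of a subset of \<open>Z\<close> that
  generates \<open>Z\<close> modulo \<open>W\<close>; it is \<open>\<infinity>\<close> if there is no such finite subset.\<close>

definition dim_quotient :: "('b \<Rightarrow>\<^sub>0 'k::field) set \<Rightarrow> ('b \<Rightarrow>\<^sub>0 'k) set \<Rightarrow> enat" where
  "dim_quotient Z W =
     Inf {enat (card C) | C. finite C \<and> C \<subseteq> Z \<and> Z \<subseteq> pscale_module.span (C \<union> W)}"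

text \<open>Labels for basis elements. The type is large enough for every graded module with elements
  in \<open>'m\<close>, over polynomials of type \<open>'a\<close>, to have a graded free resolution whose
  basis elements are such labels, see \<open>graded_free_resolution_exists\<close> below: take all homogeneous
  elements as generators in each step. The graded Betti numbers do not depend on the resolution
  that is chosen below.\<close>

datatype ('m, 'a) label = Gen int 'm | Syz int "(('m, 'a) label \<times> 'a) list"

definition resolution ::
  "'v set \<Rightarrow> (('v, 'k::field) mpoly \<Rightarrow> 'm \<Rightarrow> 'm) \<Rightarrow> (int \<Rightarrow> 'm::ab_group_add set)
    \<Rightarrow> (('m, ('v, 'k) mpoly) label, 'v, 'k, 'm) free_complex" where
  "resolution V act M = (SOME F. graded_free_resolution V act M F)"

definition betti ::
  "'v set \<Rightarrow> (('v, 'k::field) mpoly \<Rightarrow> 'm \<Rightarrow> 'm) \<Rightarrow> (int \<Rightarrow> 'm::ab_group_add set)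
    \<Rightarrow> nat \<Rightarrow> int \<Rightarrow> enat" where
  "betti V act M i j =
     dim_quotient (tor_cycles (resolution V act M) i j) (tor_boundaries (resolution V act M) i j)"

text \<open>The largest degree \<open>j\<close> with non-zero Betti number. The supremum is taken in the
  extended reals, so it is \<open>-\<infinity>\<close> if all Betti numbers vanish.\<close>

definition t_inv ::
  "'v set \<Rightarrow> (('v, 'k::field) mpoly \<Rightarrow> 'm \<Rightarrow> 'm) \<Rightarrow> (int \<Rightarrow> 'm::ab_group_add set)
    \<Rightarrow> nat \<Rightarrow> ereal" where
  "t_inv V act M i = Sup {ereal (of_int j) | j. betti V act M i j \<noteq> 0}"


section \<open>Veronese modules\<close>

text \<open>\<open>S = polys {1..n}\<close>, and \<open>T = polys (monomials n c)\<close>: the indeterminates of \<open>T\<close> are the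
  monomials (exponent vectors) of degree \<open>c\<close> of \<open>S\<close>.\<close>

definition monomials :: "nat \<Rightarrow> nat \<Rightarrow> (nat \<Rightarrow>\<^sub>0 nat) set" where
  "monomials n c = {u. keys u \<subseteq> {1..n} \<and> mdeg u = c}"

definition veronese_map :: "(nat \<Rightarrow>\<^sub>0 nat, 'k::field) mpoly \<Rightarrow> (nat, 'k) mpoly" where
  "veronese_map = poly_subst (\<lambda>u. Poly_Mapping.single u 1)"

definition veronese_act ::
  "(nat \<Rightarrow>\<^sub>0 nat, 'k::field) mpoly \<Rightarrow> (nat, 'k) mpoly \<Rightarrow> (nat, 'k) mpoly" where
  "veronese_act p s = veronese_map p * s"

definition veronese :: "nat \<Rightarrow> nat \<Rightarrow> nat \<Rightarrow> int \<Rightarrow> (nat, 'k::field) mpoly set" where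
  "veronese n c k i = (if i < 0 then {0} else homog {1..n} (int k + i * int c))"


section \<open>Existence of graded free resolutions\<close>

lemma keys_add_nat: "keys (m + m' :: 'v \<Rightarrow>\<^sub>0 nat) = keys m \<union> keys m'"
  by (auto simp: Poly_Mapping.in_keys_iff Poly_Mapping.lookup_add)

lemma mdeg_superset: "finite A \<Longrightarrow> keys m \<subseteq> A \<Longrightarrow> mdeg m = (\<Sum>v\<in>A. lookup m v)"
  unfolding mdeg_def by (rule sum.mono_neutral_left) (auto simp: Poly_Mapping.in_keys_iff)

lemma mdeg_add: "mdeg (m + m') = mdeg m + mdeg m'"
  by (simp add: mdeg_superset[of "keys m \<union> keys m'"] keys_add_nat Poly_Mapping.lookup_add sum.distrib)

lemma mdeg_zero [simp]: "mdeg 0 = 0"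
  by (simp add: mdeg_def)

lemma polys_zero [simp]: "0 \<in> polys V"
  by (simp add: polys_def)

lemma polys_one [simp]: "1 \<in> polys V"
  by (auto simp: polys_def)

lemma polys_add: "p \<in> polys V \<Longrightarrow> q \<in> polys V \<Longrightarrow> p + q \<in> polys V"
  using Poly_Mapping.keys_add[of p q] by (auto simp: polys_def)

lemma polys_sum: "(\<And>i. i \<in> I \<Longrightarrow> p i \<in> polys V) \<Longrightarrow> sum p I \<in> polys V"
  by (induction I rule: infinite_finite_induct) (auto intro: polys_add)

lemma polys_uminus: "p \<in> polys V \<Longrightarrow> - p \<in> polys V"
  for p :: "('v, 'k::ab_group_add) mpoly"
  by (auto simp: polys_def Poly_Mapping.in_keys_iff)

lemma polys_mult: "p \<in> polys V \<Longrightarrow> q \<in> polys V \<Longrightarrow> p * q \<in> polys V"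
  for p :: "('v, 'k::comm_ring_1) mpoly"
proof -
  assume pq: "p \<in> polys V" "q \<in> polys V"
  have "keys m \<subseteq> V" if "m \<in> keys (p * q)" for m
  proof -
    obtain a b where "m = a + b" "a \<in> keys p" "b \<in> keys q"
      using \<open>m \<in> keys (p * q)\<close> Poly_Mapping.keys_mult[of p q] by blast
    then show ?thesis using pq by (simp add: keys_add_nat polys_def)
  qed
  then show ?thesis by (simp add: polys_def)
qed

lemma homog_polys: "p \<in> homog V e \<Longrightarrow> p \<in> polys V"
  by (simp add: homog_def)

lemma homog_zero [simp]: "0 \<in> homog V e"
  by (simp add: homog_def)

lemma homog_one [simp]: "1 \<in> homog V 0"
  by (auto simp: homog_def)

lemma homog_add: "p \<in> homog V e \<Longrightarrow> q \<in> homog V e \<Longrightarrow> p + q \<in> homog V e"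
  using Poly_Mapping.keys_add[of p q] by (auto simp: homog_def polys_add)

lemma homog_sum: "(\<And>i. i \<in> I \<Longrightarrow> p i \<in> homog V e) \<Longrightarrow> sum p I \<in> homog V e"
  by (induction I rule: infinite_finite_induct) (auto intro: homog_add)

lemma homog_uminus: "p \<in> homog V e \<Longrightarrow> - p \<in> homog V e"
  for p :: "('v, 'k::ab_group_add) mpoly"
  by (auto simp: homog_def polys_uminus Poly_Mapping.in_keys_iff)

lemma homog_mult: "p \<in> homog V e \<Longrightarrow> q \<in> homog V e' \<Longrightarrow> p * q \<in> homog V (e + e')"
  for p :: "('v, 'k::comm_ring_1) mpoly"
proof -
  assume pq: "p \<in> homog V e" "q \<in> homog V e'"
  have "int (mdeg m) = e + e'" if "m \<in> keys (p * q)" for m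
  proof -
    obtain a b where "m = a + b" "a \<in> keys p" "b \<in> keys q"
      using \<open>m \<in> keys (p * q)\<close> Poly_Mapping.keys_mult[of p q] by blast
    then show ?thesis using pq by (simp add: homog_def mdeg_add)
  qed
  then show ?thesis using pq by (simp add: homog_def polys_mult)
qed

definition hpart :: "int \<Rightarrow> ('v, 'k::comm_monoid_add) mpoly \<Rightarrow> ('v, 'k) mpoly" where
  "hpart e p = (\<Sum>m\<in>{m \<in> keys p. int (mdeg m) = e}. Poly_Mapping.single m (lookup p m))"

lemma lookup_hpart: "lookup (hpart e p) m = (if int (mdeg m) = e then lookup p m else 0)"
proof -
  have "lookup (hpart e p) m =
      (\<Sum>m'\<in>{m \<in> keys p. int (mdeg m) = e}. if m' = m then lookup p m else 0)"
    unfolding hpart_def Poly_Mapping.lookup_sum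
    by (intro sum.cong) (auto simp: Poly_Mapping.lookup_single when_def)
  then show ?thesis
    by (auto simp: Poly_Mapping.in_keys_iff)
qed

lemma hpart_homog: "p \<in> polys V \<Longrightarrow> hpart e p \<in> homog V e"
  by (auto simp: homog_def polys_def Poly_Mapping.in_keys_iff lookup_hpart split: if_splits)

lemma hpart_zero [simp]: "hpart e 0 = 0"
  by (simp add: hpart_def)

lemma keys_pscale: "keys (pscale a f) \<subseteq> keys f"
  by (auto simp: Poly_Mapping.in_keys_iff)

lemma keys_sum_subset: "(\<And>i. i \<in> I \<Longrightarrow> keys (f i) \<subseteq> B) \<Longrightarrow> keys (sum f I) \<subseteq> B"
proof (induction I rule: infinite_finite_induct)
  case (insert i I)
  then show ?case using Poly_Mapping.keys_add[of "f i" "sum f I"] by auto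
qed auto

lemma free_carrier_zero [simp]: "0 \<in> free_carrier V B"
  by (simp add: free_carrier_def)

lemma free_carrier_add: "f \<in> free_carrier V B \<Longrightarrow> g \<in> free_carrier V B \<Longrightarrow> f + g \<in> free_carrier V B"
  using Poly_Mapping.keys_add[of f g] by (auto simp: free_carrier_def Poly_Mapping.lookup_add polys_add)

lemma free_carrier_sum: "(\<And>i. i \<in> I \<Longrightarrow> f i \<in> free_carrier V B) \<Longrightarrow> sum f I \<in> free_carrier V B"
  by (induction I rule: infinite_finite_induct) (auto intro: free_carrier_add)

lemma free_carrier_pscale: "p \<in> polys V \<Longrightarrow> f \<in> free_carrier V B \<Longrightarrow> pscale p f \<in> free_carrier V B"
  for p :: "('v, 'k::comm_ring_1) mpoly"
  using keys_pscale[of p f] by (auto simp: free_carrier_def polys_mult)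

lemma free_carrier_single: "p \<in> polys V \<Longrightarrow> b \<in> B \<Longrightarrow> Poly_Mapping.single b p \<in> free_carrier V B"
  by (auto simp: free_carrier_def Poly_Mapping.lookup_single when_def)

lemma free_comp_carrier: "f \<in> free_comp V B d j \<Longrightarrow> f \<in> free_carrier V B"
  by (auto simp: free_carrier_def free_comp_def intro: homog_polys)

lemma free_decomp:
  fixes f :: "'b \<Rightarrow>\<^sub>0 ('v, 'k::comm_ring_1) mpoly"
  assumes "f \<in> free_carrier V B"
  obtains J g where "finite J" "\<And>j. j \<in> J \<Longrightarrow> g j \<in> free_comp V B d j" "f = (\<Sum>j\<in>J. g j)"
proof
  define J where "J = (\<Union>b\<in>keys f. (\<lambda>m. int (mdeg m) + d b) ` keys (lookup f b))"
  define g where "g j = (\<Sum>b\<in>keys f. Poly_Mapping.single b (hpart (j - d b) (lookup f b)))" for j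
  have g: "lookup (g j) b = hpart (j - d b) (lookup f b)" for j b
  proof -
    have "lookup (g j) b =
        (\<Sum>b'\<in>keys f. if b' = b then hpart (j - d b) (lookup f b) else 0)"
      unfolding g_def Poly_Mapping.lookup_sum
      by (intro sum.cong) (auto simp: Poly_Mapping.lookup_single when_def)
    then show ?thesis by (auto simp: Poly_Mapping.in_keys_iff)
  qed
  show J: "finite J" by (simp add: J_def)
  show "g j \<in> free_comp V B d j" if "j \<in> J" for j
  proof -
    have "keys (g j) \<subseteq> keys f" by (auto simp: Poly_Mapping.in_keys_iff g)
    then show ?thesis using assms by (simp add: free_comp_def free_carrier_def g hpart_homog subset_trans)
  qed
  show "f = (\<Sum>j\<in>J. g j)"
  proof (rule poly_mapping_eqI)
    fix b
    show "lookup f b = lookup (\<Sum>j\<in>J. g j) b"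
    proof (intro poly_mapping_eqI)
      fix m
      have "lookup (lookup (\<Sum>j\<in>J. g j) b) m =
          (\<Sum>j\<in>J. if j = int (mdeg m) + d b then lookup (lookup f b) m else 0)"
        unfolding Poly_Mapping.lookup_sum g lookup_hpart by (intro sum.cong) auto
      also have "\<dots> = lookup (lookup f b) m"
      proof (cases "lookup (lookup f b) m = 0")
        case False
        then have "b \<in> keys f" "m \<in> keys (lookup f b)" by (auto simp: Poly_Mapping.in_keys_iff)
        then have "int (mdeg m) + d b \<in> J" unfolding J_def by blast
        then show ?thesis using J by simp
      qed (auto intro!: sum.neutral)
      finally show "lookup (lookup f b) m = lookup (lookup (\<Sum>j\<in>J. g j) b) m" ..
    qed
  qed
qed

lemma free_comp_add: "f \<in> free_comp V B d j \<Longrightarrow> g \<in> free_comp V B d j \<Longrightarrow> f + g \<in> free_comp V B d j"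
  using Poly_Mapping.keys_add[of f g] by (auto simp: free_comp_def Poly_Mapping.lookup_add homog_add)

lemma free_comp_sum: "(\<And>i. i \<in> I \<Longrightarrow> f i \<in> free_comp V B d j) \<Longrightarrow> sum f I \<in> free_comp V B d j"
  by (induction I rule: infinite_finite_induct) (simp_all add: free_comp_add, simp_all add: free_comp_def)

lemma graded_carrier_free_comp:
  "graded_carrier (free_comp V B d) =
     (free_carrier V B :: ('b \<Rightarrow>\<^sub>0 ('v, 'k::comm_ring_1) mpoly) set)"
proof (intro equalityI subsetI)
  fix f :: "'b \<Rightarrow>\<^sub>0 ('v, 'k) mpoly"
  assume "f \<in> graded_carrier (free_comp V B d)"
  then show "f \<in> free_carrier V B"
    by (auto simp: graded_carrier_def intro!: free_carrier_sum dest: free_comp_carrier)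
next
  fix f :: "'b \<Rightarrow>\<^sub>0 ('v, 'k) mpoly"
  assume "f \<in> free_carrier V B"
  then obtain J g where "finite J" "\<And>j. j \<in> J \<Longrightarrow> g j \<in> free_comp V B d j" "f = (\<Sum>j\<in>J. g j)"
    by (rule free_decomp[where d = d]) blast
  then show "f \<in> graded_carrier (free_comp V B d)"
    unfolding graded_carrier_def by blast
qed

lemma graded_module_free:
  "graded_module V (pscale :: ('v, 'k::field) mpoly \<Rightarrow> _) (free_comp V (B :: 'b set) d)"
proof
  fix f g :: "'b \<Rightarrow>\<^sub>0 ('v, 'k) mpoly" and p q :: "('v, 'k) mpoly" and j e
  show "0 \<in> free_comp V B d j" by (simp add: free_comp_def)
  show "f + g \<in> free_comp V B d j" if "f \<in> free_comp V B d j" "g \<in> free_comp V B d j"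
    using that by (rule free_comp_add)
  show "- f \<in> free_comp V B d j" if "f \<in> free_comp V B d j"
    using that by (auto simp: free_comp_def Poly_Mapping.in_keys_iff intro: homog_uminus)
  show "pscale p f \<in> free_comp V B d (e + j)" if "p \<in> homog V e" "f \<in> free_comp V B d j"
  proof -
    have "p * lookup f b \<in> homog V (e + j - d b)" for b
      using homog_mult[of p V e "lookup f b" "j - d b"] that by (simp add: free_comp_def add_diff_eq)
    then show ?thesis using that keys_pscale[of p f] by (auto simp: free_comp_def)
  qed
next
  fix J :: "int set" and z :: "int \<Rightarrow> 'b \<Rightarrow>\<^sub>0 ('v, 'k) mpoly" and j
  assume *: "finite J" "\<And>j. j \<in> J \<Longrightarrow> z j \<in> free_comp V B d j" "(\<Sum>j\<in>J. z j) = 0" "j \<in> J"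
  show "z j = 0"
  proof (rule ccontr)
    assume "z j \<noteq> 0"
    then obtain b where "lookup (z j) b \<noteq> 0" by (metis Poly_Mapping.lookup_zero poly_mapping_eqI)
    then obtain m where m: "lookup (lookup (z j) b) m \<noteq> 0" by (metis Poly_Mapping.lookup_zero poly_mapping_eqI)
    have deg: "int (mdeg m) = j' - d b" if "j' \<in> J" "lookup (lookup (z j') b) m \<noteq> 0" for j'
      using *(2)[OF that(1)] that(2) by (auto simp: free_comp_def homog_def Poly_Mapping.in_keys_iff)
    have "0 = lookup (lookup (\<Sum>j\<in>J. z j) b) m" using *(3) by simp
    also have "\<dots> = (\<Sum>j'\<in>J. lookup (lookup (z j') b) m)"
      by (simp add: Poly_Mapping.lookup_sum)
    also have "\<dots> = (\<Sum>j'\<in>J. if j' = j then lookup (lookup (z j) b) m else 0)"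
    proof (intro sum.cong refl)
      fix j' assume "j' \<in> J"
      then show "lookup (lookup (z j') b) m = (if j' = j then lookup (lookup (z j) b) m else 0)"
        using deg[of j'] deg[OF \<open>j \<in> J\<close> m] by (cases "lookup (lookup (z j') b) m = 0") auto
    qed
    also have "\<dots> = lookup (lookup (z j) b) m" using * by simp
    finally show False using m by simp
  qed
qed (auto simp: pscale_module.scale_left_distrib pscale_module.scale_right_distrib)

context graded_module
begin

lemma comp_carrier: "x \<in> M j \<Longrightarrow> x \<in> graded_carrier M"
  unfolding graded_carrier_def
  by (rule CollectI, rule exI[of _ "{j}"], rule exI[of _ "\<lambda>_. x"]) auto

lemma comp_sum: "(\<And>i. i \<in> I \<Longrightarrow> f i \<in> M j) \<Longrightarrow> sum f I \<in> M j"
  by (induction I rule: infinite_finite_induct) (auto intro: comp_add comp_zero)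

lemma carrier_zero: "0 \<in> graded_carrier M"
  using comp_carrier comp_zero by blast

lemma carrier_add:
  assumes "x \<in> graded_carrier M" "y \<in> graded_carrier M"
  shows "x + y \<in> graded_carrier M"
proof -
  obtain I f where f: "finite I" "\<forall>j\<in>I. f j \<in> M j" "x = sum f I"
    using assms(1) by (auto simp: graded_carrier_def)
  obtain J g where g: "finite J" "\<forall>j\<in>J. g j \<in> M j" "y = sum g J"
    using assms(2) by (auto simp: graded_carrier_def)
  define h where "h j = (if j \<in> I then f j else 0) + (if j \<in> J then g j else 0)" for j
  have "x + y = sum h (I \<union> J)"
    using f(1) g(1) unfolding h_def sum.distrib f(3) g(3)
    by (intro arg_cong2[of _ _ _ _ "(+)"] sum.mono_neutral_cong_left) auto
  moreover have "\<forall>j\<in>I \<union> J. h j \<in> M j"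
    using f g by (auto simp: h_def intro!: comp_add comp_zero)
  ultimately show ?thesis
    using f(1) g(1) unfolding graded_carrier_def
    by (intro CollectI exI[of _ "I \<union> J"] exI[of _ h]) simp
qed

lemma carrier_sum: "(\<And>i. i \<in> I \<Longrightarrow> f i \<in> graded_carrier M) \<Longrightarrow> sum f I \<in> graded_carrier M"
  by (induction I rule: infinite_finite_induct) (auto intro: carrier_add carrier_zero)

lemma act_zero_left: "x \<in> graded_carrier M \<Longrightarrow> act 0 x = 0"
  using act_add_left[of 0 0 x] by simp

lemma act_zero_right: "p \<in> polys V \<Longrightarrow> act p 0 = 0"
  using act_add_right[of p 0 0] carrier_zero by simp

lemma act_sum_right: "p \<in> polys V \<Longrightarrow> (\<And>i. i \<in> I \<Longrightarrow> f i \<in> graded_carrier M) \<Longrightarrow>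
    act p (sum f I) = (\<Sum>i\<in>I. act p (f i))"
proof (induction I rule: infinite_finite_induct)
  case (insert i I)
  then have "f i \<in> graded_carrier M" "sum f I \<in> graded_carrier M"
    by (auto intro: carrier_sum)
  then show ?case using insert by (simp add: act_add_right)
qed (simp_all add: act_zero_right)

lemma act_carrier:
  assumes p: "p \<in> polys V" and x: "x \<in> graded_carrier M"
  shows "act p x \<in> graded_carrier M"
proof -
  obtain J g where J: "finite J" "\<And>j. j \<in> J \<Longrightarrow> g j \<in> M j" "x = (\<Sum>j\<in>J. g j)"
    using x by (auto simp: graded_carrier_def)
  obtain I h where I: "finite I" "\<And>e. e \<in> I \<Longrightarrow> h e \<in> homog V e" "p = (\<Sum>e\<in>I. h e)"
  proof
    show "finite ((\<lambda>m. int (mdeg m)) ` keys p)" by simp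
    show "hpart e p \<in> homog V e" for e using p by (rule hpart_homog)
    show "p = (\<Sum>e\<in>(\<lambda>m. int (mdeg m)) ` keys p. hpart e p)"
      by (intro poly_mapping_eqI) (auto simp: Poly_Mapping.lookup_sum lookup_hpart Poly_Mapping.in_keys_iff)
  qed
  have "act (\<Sum>e\<in>I'. h e) x = (\<Sum>e\<in>I'. act (h e) x)" if "I' \<subseteq> I" for I'
    using finite_subset[OF that I(1)] that
  proof (induction I')
    case (insert e I')
    then have "h e \<in> polys V" "sum h I' \<in> polys V"
      using I(2) by (auto intro!: polys_sum intro: homog_polys)
    then show ?case using insert x by (simp add: act_add_left)
  qed (simp add: act_zero_left x)
  then have "act p x = (\<Sum>e\<in>I. act (h e) x)" using I by simp
  also have "\<dots> = (\<Sum>e\<in>I. \<Sum>j\<in>J. act (h e) (g j))"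
    unfolding J(3)
    by (intro sum.cong refl act_sum_right) (auto intro: homog_polys[OF I(2)] comp_carrier[OF J(2)])
  finally have eq: "act p x = (\<Sum>e\<in>I. \<Sum>j\<in>J. act (h e) (g j))" .
  show ?thesis
    unfolding eq using comp_carrier[OF act_comp[OF I(2) J(2)]] by (intro carrier_sum)
qed

context
  fixes B :: "'b set" and d :: "'b \<Rightarrow> int" and g :: "'b \<Rightarrow> 'm"
  assumes g: "\<And>b. b \<in> B \<Longrightarrow> g b \<in> M (d b)"
begin

lemma lin_superset:
  assumes "f \<in> free_carrier V B" "finite A" "keys f \<subseteq> A" "A \<subseteq> B"
  shows "lin act g f = (\<Sum>b\<in>A. act (lookup f b) (g b))"
  unfolding lin_def
proof (rule sum.mono_neutral_left)
  show "\<forall>b\<in>A - keys f. act (lookup f b) (g b) = 0"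
  proof
    fix b assume "b \<in> A - keys f"
    then have "lookup f b = 0" "g b \<in> graded_carrier M"
      using g assms(4) by (auto simp: Poly_Mapping.in_keys_iff intro: comp_carrier)
    then show "act (lookup f b) (g b) = 0" by (simp add: act_zero_left)
  qed
qed (use assms in auto)

lemma lin_add:
  assumes "f \<in> free_carrier V B" "h \<in> free_carrier V B"
  shows "lin act g (f + h) = lin act g f + lin act g h"
proof -
  define A where "A = keys f \<union> keys h"
  have A: "finite A" "A \<subseteq> B" "keys f \<subseteq> A" "keys h \<subseteq> A" "keys (f + h) \<subseteq> A"
    using assms Poly_Mapping.keys_add[of f h] by (auto simp: A_def free_carrier_def)
  have "lin act g (f + h) = (\<Sum>b\<in>A. act (lookup (f + h) b) (g b))"
    using A assms by (intro lin_superset free_carrier_add)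
  also have "\<dots> = (\<Sum>b\<in>A. act (lookup f b) (g b) + act (lookup h b) (g b))"
  proof (rule sum.cong[OF refl])
    fix b assume "b \<in> A"
    then have "g b \<in> graded_carrier M" using g A(2) by (blast intro: comp_carrier)
    then show "act (lookup (f + h) b) (g b) = act (lookup f b) (g b) + act (lookup h b) (g b)"
      using assms by (simp add: Poly_Mapping.lookup_add free_carrier_def act_add_left)
  qed
  also have "\<dots> = lin act g f + lin act g h"
    using A assms by (simp add: sum.distrib lin_superset)
  finally show ?thesis .
qed

lemma lin_zero [simp]: "lin act g 0 = 0"
  by (simp add: lin_def)

lemma lin_sum:
  "(\<And>i. i \<in> I \<Longrightarrow> f i \<in> free_carrier V B) \<Longrightarrow> lin act g (sum f I) = (\<Sum>i\<in>I. lin act g (f i))"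
proof (induction I rule: infinite_finite_induct)
  case (insert i I)
  then have "f i \<in> free_carrier V B" "sum f I \<in> free_carrier V B"
    by (auto intro: free_carrier_sum)
  then show ?case using insert by (simp add: lin_add)
qed simp_all

lemma lin_single: "b \<in> B \<Longrightarrow> p \<in> polys V \<Longrightarrow> lin act g (Poly_Mapping.single b p) = act p (g b)"
  by (subst lin_superset[of _ "{b}"]) (auto simp: free_carrier_single)

lemma lin_comp: "f \<in> free_comp V B d j \<Longrightarrow> lin act g f \<in> M j"
proof -
  assume f: "f \<in> free_comp V B d j"
  have "act (lookup f b) (g b) \<in> M j" if "b \<in> keys f" for b
    using f g[of b] that act_comp[of "lookup f b" "j - d b" "g b" "d b"]
    by (auto simp: free_comp_def)
  then show ?thesis unfolding lin_def by (rule comp_sum)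
qed

lemma lin_carrier: "f \<in> free_carrier V B \<Longrightarrow> lin act g f \<in> graded_carrier M"
  unfolding lin_def using g by (intro carrier_sum act_carrier comp_carrier) (auto simp: free_carrier_def)

lemma lin_pscale:
  assumes p: "p \<in> polys V" and f: "f \<in> free_carrier V B"
  shows "lin act g (pscale p f) = act p (lin act g f)"
proof -
  have gc: "g b \<in> graded_carrier M" if "b \<in> B" for b using g[OF that] by (rule comp_carrier)
  have "lin act g (pscale p f) = (\<Sum>b\<in>keys f. act (lookup (pscale p f) b) (g b))"
    using f by (intro lin_superset free_carrier_pscale p keys_pscale) (auto simp: free_carrier_def)
  also have "\<dots> = (\<Sum>b\<in>keys f. act p (act (lookup f b) (g b)))"
    using f p gc by (intro sum.cong refl) (auto simp: free_carrier_def intro!: act_mult)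
  also have "\<dots> = act p (lin act g f)"
    unfolding lin_def using f p gc
    by (intro act_sum_right[symmetric] act_carrier) (auto simp: free_carrier_def)
  finally show ?thesis .
qed

lemma kernel_decomp:
  assumes "f \<in> free_carrier V B" "lin act g f = 0"
  obtains J h where "finite J" "f = (\<Sum>j\<in>J. h j)"
    "\<And>j. j \<in> J \<Longrightarrow> h j \<in> free_comp V B d j" "\<And>j. j \<in> J \<Longrightarrow> lin act g (h j) = 0"
proof -
  obtain J h where J: "finite J" "\<And>j. j \<in> J \<Longrightarrow> h j \<in> free_comp V B d j" "f = (\<Sum>j\<in>J. h j)"
    by (rule free_decomp[OF assms(1), where d = d]) blast
  have "(\<Sum>j\<in>J. lin act g (h j)) = lin act g f"
    unfolding J(3) by (rule lin_sum[symmetric]) (rule free_comp_carrier[OF J(2)])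
  then have "(\<Sum>j\<in>J. lin act g (h j)) = 0"
    using assms by simp
  then have "lin act g (h j) = 0" if "j \<in> J" for j
    using indep[of J "\<lambda>j. lin act g (h j)" j, OF J(1) lin_comp[OF J(2)]] that by blast
  then show ?thesis using that J by blast
qed

end

end

fun of_terms :: "('b \<times> 'a::comm_monoid_add) list \<Rightarrow> ('b \<Rightarrow>\<^sub>0 'a)" where
  "of_terms [] = 0"
| "of_terms ((b, p) # xs) = Poly_Mapping.single b p + of_terms xs"

lemma of_terms_surj: "\<exists>xs. of_terms xs = f"
proof -
  have "\<exists>xs. of_terms xs = (\<Sum>b\<in>A. Poly_Mapping.single b (lookup f b))" if "finite A" for A
    using that
  proof (induction A)
    case empty
    show ?case by (intro exI[of _ "[]"]) simp
  next
    case (insert b A)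
    then obtain xs where "of_terms xs = (\<Sum>b\<in>A. Poly_Mapping.single b (lookup f b))" by blast
    then have "of_terms ((b, lookup f b) # xs) = (\<Sum>b\<in>insert b A. Poly_Mapping.single b (lookup f b))"
      using insert.hyps by simp
    then show ?case by blast
  qed
  from this[of "keys f"] obtain xs
    where xs: "of_terms xs = (\<Sum>b\<in>keys f. Poly_Mapping.single b (lookup f b))" by auto
  have "of_terms xs = f"
  proof (intro poly_mapping_eqI)
    fix b
    have "lookup (of_terms xs) b = (\<Sum>b'\<in>keys f. if b' = b then lookup f b else 0)"
      unfolding xs Poly_Mapping.lookup_sum
      by (intro sum.cong) (auto simp: Poly_Mapping.lookup_single when_def)
    then show "lookup (of_terms xs) b = lookup f b"
      by (auto simp: Poly_Mapping.in_keys_iff)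
  qed
  then show ?thesis by blast
qed

fun label_deg :: "('m, 'a) label \<Rightarrow> int" where
  "label_deg (Gen j x) = j"
| "label_deg (Syz j xs) = j"

fun label_gen :: "('m, 'a) label \<Rightarrow> 'm::zero" where
  "label_gen (Gen j x) = x"
| "label_gen (Syz j xs) = 0"

fun label_syz :: "('m, 'a) label \<Rightarrow> (('m, 'a) label \<Rightarrow>\<^sub>0 'a::comm_monoid_add)" where
  "label_syz (Gen j x) = 0"
| "label_syz (Syz j xs) = of_terms xs"

definition syz_labels where
  "syz_labels V B K = {Syz j xs | j xs. of_terms xs \<in> free_comp V B label_deg j \<and> of_terms xs \<in> K}"

lemma (in graded_module) syz_exact:
  fixes B :: "('a, ('v, 'k) mpoly) label set"
  assumes g: "\<And>b. b \<in> B \<Longrightarrow> g b \<in> M (label_deg b)"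
  defines "K \<equiv> {f \<in> free_carrier V B. lin act g f = 0}"
  shows "lin pscale label_syz ` free_carrier V (syz_labels V B K) = K"
proof (intro equalityI subsetI)
  fix f assume "f \<in> lin pscale label_syz ` free_carrier V (syz_labels V B K)"
  then obtain h where h: "h \<in> free_carrier V (syz_labels V B K)" "f = lin pscale label_syz h" by auto
  have *: "label_syz b \<in> free_carrier V B \<and> lin act g (label_syz b) = 0" "lookup h b \<in> polys V"
    if "b \<in> keys h" for b
  proof -
    have "b \<in> syz_labels V B K" "lookup h b \<in> polys V"
      using h(1) that by (auto simp: free_carrier_def)
    then show "label_syz b \<in> free_carrier V B \<and> lin act g (label_syz b) = 0" "lookup h b \<in> polys V"
      by (auto simp: syz_labels_def K_def)
  qed
  have 1: "pscale (lookup h b) (label_syz b) \<in> free_carrier V B" if "b \<in> keys h" for b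
    using *[OF that] by (auto intro: free_carrier_pscale)
  have 2: "lin act g (pscale (lookup h b) (label_syz b)) = 0" if "b \<in> keys h" for b
    using *[OF that] lin_pscale[of B g label_deg, OF g] by (auto simp: act_zero_right)
  have "lin act g f = 0"
    unfolding h(2) lin_def[of pscale]
    by (subst lin_sum[of B g label_deg, OF g]) (auto intro: 1 simp: 2)
  moreover have "f \<in> free_carrier V B"
    unfolding h(2) lin_def using 1 by (rule free_carrier_sum)
  ultimately show "f \<in> K" by (simp add: K_def)
next
  fix f assume "f \<in> K"
  then have f: "f \<in> free_carrier V B" "lin act g f = 0" by (auto simp: K_def)
  obtain J h where J: "finite J" "f = (\<Sum>j\<in>J. h j)"
      "\<And>j. j \<in> J \<Longrightarrow> h j \<in> free_comp V B label_deg j" "\<And>j. j \<in> J \<Longrightarrow> lin act g (h j) = 0"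
    by (rule kernel_decomp[of B g label_deg, OF g f]) blast+
  define xs where "xs j = (SOME xs. of_terms xs = h j)" for j
  have xs: "of_terms (xs j) = h j" for j
    unfolding xs_def using of_terms_surj by (rule someI_ex)
  have mem: "Syz j (xs j) \<in> syz_labels V B K" if "j \<in> J" for j
    using J(3,4)[OF that] by (auto simp: syz_labels_def K_def xs dest: free_comp_carrier)
  interpret L: graded_module V pscale "free_comp V B label_deg" by (rule graded_module_free)
  have deg: "label_syz b \<in> free_comp V B label_deg (label_deg b)" if "b \<in> syz_labels V B K" for b
    using that by (auto simp: syz_labels_def)
  note L = L.lin_sum[of "syz_labels V B K" label_syz label_deg, OF deg]
    L.lin_single[of "syz_labels V B K" label_syz label_deg, OF deg]
  define u where "u = (\<Sum>j\<in>J. Poly_Mapping.single (Syz j (xs j)) (1 :: ('v, 'k) mpoly))"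
  have u: "u \<in> free_carrier V (syz_labels V B K)"
    unfolding u_def using mem by (intro free_carrier_sum free_carrier_single) auto
  have "lin pscale label_syz u = (\<Sum>j\<in>J. h j)"
    unfolding u_def using mem by (subst L(1)) (auto simp: L(2) xs free_carrier_single)
  then show "f \<in> lin pscale label_syz ` free_carrier V (syz_labels V B K)"
    using J(2) u by (intro image_eqI[of _ _ u]) simp_all
qed

theorem (in graded_module) graded_free_resolution_exists:
  "\<exists>F :: (('m, ('v, 'k) mpoly) label, 'v, 'k, 'm) free_complex. graded_free_resolution V act M F"
proof -
  define B0 :: "('m, ('v, 'k) mpoly) label set" where "B0 = {Gen j x | j x. x \<in> M j}"
  define B1 where "B1 = syz_labels V B0 {f \<in> free_carrier V B0. lin act label_gen f = 0}"
  define B where "B = rec_nat B0 (\<lambda>i Bi. if i = 0 then B1 else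
      syz_labels V Bi {f \<in> free_carrier V Bi. lin pscale label_syz f = 0})"
  have B_simps: "B 0 = B0" "B (Suc 0) = B1"
    "B (Suc (Suc i)) = syz_labels V (B (Suc i)) {f \<in> free_carrier V (B (Suc i)). lin pscale label_syz f = 0}" for i
    by (simp_all add: B_def)
  have g0: "label_gen b \<in> M (label_deg b)" if "b \<in> B0" for b
    using that by (auto simp: B0_def)
  have gS: "label_syz b \<in> free_comp V (B i) label_deg (label_deg b)" if "b \<in> B (Suc i)" for b i
    using that by (cases i) (auto simp: B_simps B1_def syz_labels_def)
  define F where "F = \<lparr>basis = B, bdeg = \<lambda>_. label_deg, aug = label_gen, diff = \<lambda>_. label_syz\<rparr>"
  have surj: "lin act label_gen ` free_carrier V B0 = graded_carrier M"
  proof (intro equalityI subsetI)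
    fix x assume "x \<in> graded_carrier M"
    then obtain J z where J: "finite J" "\<forall>j\<in>J. z j \<in> M j" "x = (\<Sum>j\<in>J. z j)"
      by (auto simp: graded_carrier_def)
    define e :: "int \<Rightarrow> ('m, ('v, 'k) mpoly) label" where "e j = Gen j (z j)" for j
    define u where "u = (\<Sum>j\<in>J. Poly_Mapping.single (e j) (1 :: ('v, 'k) mpoly))"
    have mem: "e j \<in> B0" if "j \<in> J" for j using that J by (auto simp: B0_def e_def)
    have "lin act label_gen u = (\<Sum>j\<in>J. lin act label_gen (Poly_Mapping.single (e j) 1))"
      unfolding u_def using mem
      by (intro lin_sum[of B0 label_gen label_deg, OF g0] free_carrier_single) auto
    also have "\<dots> = (\<Sum>j\<in>J. z j)"
    proof (rule sum.cong[OF refl])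
      fix j assume j: "j \<in> J"
      have "lin act label_gen (Poly_Mapping.single (e j) 1) = act 1 (label_gen (e j))"
        using mem[OF j] by (intro lin_single[of B0 label_gen label_deg, OF g0]) auto
      then show "lin act label_gen (Poly_Mapping.single (e j) 1) = z j"
        using j J(2) comp_carrier[of "z j" j] by (simp add: act_one e_def)
    qed
    finally have "lin act label_gen u = (\<Sum>j\<in>J. z j)" .
    moreover have "u \<in> free_carrier V B0"
      unfolding u_def using mem by (intro free_carrier_sum free_carrier_single) auto
    ultimately show "x \<in> lin act label_gen ` free_carrier V B0"
      using J(3) by (intro image_eqI[of _ _ u]) simp_all
  next
    fix x assume "x \<in> lin act label_gen ` free_carrier V B0"
    then show "x \<in> graded_carrier M"
      using lin_carrier[of B0 label_gen label_deg, OF g0] by blast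
  qed
  have ex: "lin pscale label_syz ` free_carrier V (B (Suc (Suc i))) =
      {f \<in> free_carrier V (B (Suc i)). lin pscale label_syz f = 0}" for i
  proof -
    interpret L: graded_module V pscale "free_comp V (B i) label_deg" by (rule graded_module_free)
    show ?thesis unfolding B_simps(3) by (rule L.syz_exact) (rule gS)
  qed
  have "graded_free_resolution V act M F"
    unfolding graded_free_resolution_def F_def
    using g0 gS surj ex syz_exact[of B0 label_gen, OF g0]
    by (simp add: B_simps(1,2) B1_def)
  then show ?thesis by blast
qed


section \<open>The Veronese modules are graded modules\<close>

lemma poly_subst_superset:
  assumes "finite A" "keys p \<subseteq> A"
  shows "poly_subst f p =
    (\<Sum>m\<in>A. Poly_Mapping.single 0 (lookup p m) * (\<Prod>v\<in>keys m. f v ^ lookup m v))"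
  unfolding poly_subst_def using assms
  by (intro sum.mono_neutral_left) (auto simp: Poly_Mapping.in_keys_iff)

lemma poly_subst_zero [simp]: "poly_subst f 0 = 0"
  by (simp add: poly_subst_def)

lemma poly_subst_one [simp]: "poly_subst f 1 = 1"
  by (simp add: poly_subst_def)

lemma poly_subst_add: "poly_subst f (p + q) = poly_subst f p + poly_subst f q"
  using Poly_Mapping.keys_add[of p q]
  by (simp add: poly_subst_superset[of "keys p \<union> keys q"] Poly_Mapping.lookup_add
      Poly_Mapping.single_add sum.distrib algebra_simps)

lemma poly_subst_sum: "poly_subst f (sum p I) = (\<Sum>i\<in>I. poly_subst f (p i))"
  by (induction I rule: infinite_finite_induct) (auto simp: poly_subst_add)

lemma poly_subst_single:
  "poly_subst f (Poly_Mapping.single m a) = Poly_Mapping.single 0 a * (\<Prod>v\<in>keys m. f v ^ lookup m v)"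
  by (subst poly_subst_superset[of "{m}"]) auto

lemma prod_power_superset:
  "finite A \<Longrightarrow> keys m \<subseteq> A \<Longrightarrow>
    (\<Prod>v\<in>keys m. f v ^ lookup m v) = (\<Prod>v\<in>A. (f v :: 'a::comm_monoid_mult) ^ lookup m v)"
  by (rule prod.mono_neutral_left) (auto simp: Poly_Mapping.in_keys_iff)

lemma poly_sum_singles: "p = (\<Sum>m\<in>keys p. Poly_Mapping.single m (lookup p m))"
proof (intro poly_mapping_eqI)
  fix m
  have "lookup (\<Sum>m\<in>keys p. Poly_Mapping.single m (lookup p m)) m =
      (\<Sum>m'\<in>keys p. if m' = m then lookup p m else 0)"
    unfolding Poly_Mapping.lookup_sum
    by (intro sum.cong) (auto simp: Poly_Mapping.lookup_single when_def)
  then show "lookup p m = lookup (\<Sum>m\<in>keys p. Poly_Mapping.single m (lookup p m)) m"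
    by (auto simp: Poly_Mapping.in_keys_iff)
qed

lemma poly_subst_mult_single:
  fixes f :: "'v \<Rightarrow> ('w, 'k::comm_ring_1) mpoly"
  shows
  "poly_subst f (Poly_Mapping.single m a * Poly_Mapping.single m' a') =
     poly_subst f (Poly_Mapping.single m a) * poly_subst f (Poly_Mapping.single m' a')"
proof -
  define A where "A = keys m \<union> keys m'"
  define P where "P = (\<Prod>v\<in>A. f v ^ lookup m v)"
  define Q where "Q = (\<Prod>v\<in>A. f v ^ lookup m' v)"
  have A: "finite A" "keys m \<subseteq> A" "keys m' \<subseteq> A" "keys (m + m') \<subseteq> A"
    by (auto simp: A_def keys_add_nat)
  have P: "(\<Prod>v\<in>keys m. f v ^ lookup m v) = P"
    unfolding P_def by (rule prod_power_superset[OF A(1,2)])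
  have Q: "(\<Prod>v\<in>keys m'. f v ^ lookup m' v) = Q"
    unfolding Q_def by (rule prod_power_superset[OF A(1,3)])
  have PQ: "(\<Prod>v\<in>keys (m + m'). f v ^ lookup (m + m') v) = P * Q"
    unfolding prod_power_superset[OF A(1,4)] P_def Q_def
    by (simp add: Poly_Mapping.lookup_add power_add prod.distrib)
  have c: "Poly_Mapping.single 0 (a * a') = Poly_Mapping.single 0 a * (Poly_Mapping.single 0 a' :: ('w, 'k) mpoly)"
    by (simp add: Poly_Mapping.mult_single)
  show ?thesis
    unfolding Poly_Mapping.mult_single[of m a m' a'] poly_subst_single P Q PQ c by (simp only: mult_ac)
qed

lemma poly_subst_mult: "poly_subst f (p * q) = poly_subst f p * poly_subst f q"
  by (subst (1 2) poly_sum_singles[of p], subst (1 2) poly_sum_singles[of q])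
     (simp only: sum_product poly_subst_sum poly_subst_mult_single)

lemma prod_homog:
  fixes f :: "'i \<Rightarrow> ('v, 'k::comm_ring_1) mpoly"
  shows "(\<And>i. i \<in> I \<Longrightarrow> f i \<in> homog V (e i)) \<Longrightarrow> finite I \<Longrightarrow> prod f I \<in> homog V (sum e I)"
  by (rotate_tac, induction I rule: finite_induct) (auto intro: homog_mult)

lemma power_homog: "p \<in> homog V e \<Longrightarrow> p ^ r \<in> homog V (e * int r)"
  for p :: "('v, 'k::comm_ring_1) mpoly"
proof (induction r)
  case (Suc r)
  then show ?case using homog_mult[of p V e "p ^ r" "e * int r"] by (simp add: algebra_simps)
qed simp

lemma veronese_map_homog:
  fixes p :: "(nat \<Rightarrow>\<^sub>0 nat, 'k::field) mpoly"
  assumes p: "p \<in> homog (monomials n c) e"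
  shows "veronese_map p \<in> homog {1..n} (e * int c)"
  unfolding veronese_map_def poly_subst_def
proof (rule homog_sum)
  fix m assume m: "m \<in> keys p"
  have V: "u \<in> monomials n c" if "u \<in> keys m" for u
    using p m that by (auto simp: homog_def polys_def)
  have "Poly_Mapping.single u (1 :: 'k) ^ lookup m u \<in> homog {1..n} (int c * int (lookup m u))"
    if "u \<in> keys m" for u
    using V[OF that] by (intro power_homog) (auto simp: homog_def polys_def monomials_def)
  then have "(\<Prod>u\<in>keys m. Poly_Mapping.single u (1 :: 'k) ^ lookup m u)
      \<in> homog {1..n} (\<Sum>u\<in>keys m. int c * int (lookup m u))"
    by (rule prod_homog) auto
  moreover have "(\<Sum>u\<in>keys m. int c * int (lookup m u)) = e * int c"
    using p m by (auto simp: homog_def mdeg_def sum_distrib_left[symmetric] mult.commute)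
  moreover have "Poly_Mapping.single 0 (lookup p m) \<in> homog {1..n} 0"
    by (auto simp: homog_def polys_def)
  ultimately show "Poly_Mapping.single 0 (lookup p m) *
      (\<Prod>u\<in>keys m. Poly_Mapping.single u 1 ^ lookup m u) \<in> homog {1..n} (e * int c)"
    using homog_mult[of "Poly_Mapping.single 0 (lookup p m)" "{1..n}" 0] by fastforce
qed

lemma homog_neg: "e < 0 \<Longrightarrow> homog V e = {0}"
  by (auto simp: homog_def)

theorem graded_module_veronese:
  assumes "c \<ge> 1"
  shows "graded_module (monomials n c) veronese_act (veronese n c k :: int \<Rightarrow> (nat, 'k::field) mpoly set)"
proof
  fix x y :: "(nat, 'k) mpoly" and p q :: "(nat \<Rightarrow>\<^sub>0 nat, 'k) mpoly" and j e
  show "0 \<in> veronese n c k j" by (simp add: veronese_def)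
  show "x + y \<in> veronese n c k j" if "x \<in> veronese n c k j" "y \<in> veronese n c k j"
    using that by (auto simp: veronese_def homog_add split: if_splits)
  show "- x \<in> veronese n c k j" if "x \<in> veronese n c k j"
    using that by (auto simp: veronese_def homog_uminus split: if_splits)
  show "veronese_act p x \<in> veronese n c k (e + j)"
    if "p \<in> homog (monomials n c) e" "x \<in> veronese n c k j"
  proof (cases "p = 0 \<or> x = 0")
    case True
    then show ?thesis by (auto simp: veronese_act_def veronese_map_def veronese_def)
  next
    case False
    then have "e \<ge> 0" "j \<ge> 0"
      using that homog_neg[of e "monomials n c"] by (auto simp: veronese_def not_less[symmetric] split: if_splits)
    then show ?thesis
      using that homog_mult[OF veronese_map_homog[OF that(1)], of x "int k + j * int c"]
      by (auto simp: veronese_act_def veronese_def algebra_simps)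
  qed
next
  fix J :: "int set" and z :: "int \<Rightarrow> (nat, 'k) mpoly" and j
  assume *: "finite J" "\<And>j. j \<in> J \<Longrightarrow> z j \<in> veronese n c k j" "(\<Sum>j\<in>J. z j) = 0" "j \<in> J"
  show "z j = 0"
  proof (rule ccontr)
    assume "z j \<noteq> 0"
    then obtain m where m: "lookup (z j) m \<noteq> 0" by (metis Poly_Mapping.lookup_zero poly_mapping_eqI)
    have deg: "int (mdeg m) = int k + j' * int c" if "j' \<in> J" "lookup (z j') m \<noteq> 0" for j'
      using *(2)[OF that(1)] that(2)
      by (auto simp: veronese_def homog_def Poly_Mapping.in_keys_iff split: if_splits)
    have "lookup (z j') m = 0" if "j' \<in> J" "j' \<noteq> j" for j'
      using deg[OF that(1)] deg[OF *(4) m] that assms by auto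
    then have "(\<Sum>j'\<in>J. lookup (z j') m) = (\<Sum>j'\<in>J. if j' = j then lookup (z j) m else 0)"
      by (intro sum.cong) auto
    moreover have "(\<Sum>j'\<in>J. lookup (z j') m) = 0"
      using *(3) by (metis Poly_Mapping.lookup_sum Poly_Mapping.lookup_zero)
    ultimately show False using m * by simp
  qed
qed (auto simp: veronese_act_def veronese_map_def poly_subst_add poly_subst_mult algebra_simps)

end

theory Submission
  imports Defs "HOL-Library.Function_Algebras" "HOL-Combinatorics.Permutations"
begin

text \<open>\<open>Tor\<^sub>i\<close> of \<open>V\<^sub>S(c, k)\<close> is the part in degrees congruent to \<open>k\<close> modulo \<open>c\<close> of the Koszul
  homology \<open>H\<^sub>i\<close> of the monomials of degree \<open>c\<close> with coefficients in \<open>S\<close>; only the vanishing half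
  of this comparison is needed, and it is a diagram chase between a free resolution and the Koszul
  complex of \<open>T\<close>. By another diagram chase and induction on \<open>i\<close>, the module \<open>Z\<^sub>i\<close> of Koszul cycles
  has regularity at most \<open>i (c + 1)\<close>. As the ideal of the monomials annihilates \<open>H\<^sub>i\<close>, the latter
  vanishes in degrees at least \<open>i (c + 1) + c\<close>, which is the first bound.

  The same chase shows that in degree \<open>i (c + 1)\<close>, modulo what is generated in lower degree, \<open>Z\<^sub>i\<close>
  is spanned by products of \<open>i\<close> linear syzygies \<open>x [b y] - y [b x]\<close> with \<open>b\<close> of degree \<open>c - 1\<close>.
  For \<open>b\<^sub>0\<close> of degree \<open>c - 1\<close>, the product of \<open>b\<^sub>0\<close> with \<open>c\<close> such syzygies given by \<open>b\<^sub>1, \<dots>, b\<^sub>c\<close>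
  is, modulo boundaries, alternating in \<open>b\<^sub>0, \<dots>, b\<^sub>c\<close>, whereas its antisymmetrisation is a
  boundary. So \<open>(c + 1)!\<close> times it is a boundary, and for \<open>i \<ge> c\<close> one more degree of \<open>H\<^sub>i\<close> vanishes
  if \<open>(c + 1)!\<close> is invertible.\<close>

text \<open>Write \<open>Z_t\<close>, \<open>B_t\<close>, \<open>H_t\<close> and \<open>K_t\<close>
  for Koszul cycles, boundaries, homology and chains over S. The constant c + 1 comes from the
  sequences 0 -> B_t -> Z_t -> H_t -> 0 and 0 -> Z_(t+1) -> K_(t+1) -> B_t -> 0: since
  \<open>H_t\<close> vanishes from c degrees above the bound for \<open>Z_t\<close> on, passing to
  \<open>B_t\<close> costs c, and passing to the kernel costs one more. The antisymmetrisation in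
  the second half is a boundary for this reason. Each linear syzygy, once expanded, contributes a
  variable outside the brackets; c of them form a monomial of degree c, which kills homology, and
  fewer would not, whence i >= c. What this monomial multiplies is the antisymmetrisation of b_0
  [b_1 y_1] ... [b_c y_c], a cycle because every term of the boundary of b_0 [b_1 y_1] ... [b_c y_c]
  is symmetric in b_0 and some b_m. The first bound holds in every characteristic, so neither the
  homotopies nor the liftings of alternating forms may divide by integers. \<open>Tor_i\<close> in
  degree j is \<open>H_i\<close> in S-degree k + j c. Vanishing of \<open>H_i\<close> from degree N
  on therefore gives t_i < (N - k) / c, and a gain of one degree lowers the bound by 1/c.\<close>

section \<open>Koszul complexes\<close>

text \<open>An element of the exterior power tensored with a module is given by its coefficients, as an
  alternating function on lists of generators; this way the differential needs no signs.\<close>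

definition alternating :: "('g list \<Rightarrow> 'm::ab_group_add) \<Rightarrow> bool" where
  "alternating \<omega> \<longleftrightarrow>
     (\<forall>l a b l'. \<omega> (l @ a # b # l') = - \<omega> (l @ b # a # l')) \<and> (\<forall>l a l'. \<omega> (l @ a # a # l') = 0)"

definition kos :: "'g set \<Rightarrow> nat \<Rightarrow> 'm set \<Rightarrow> ('g list \<Rightarrow> 'm::ab_group_add) set" where
  "kos G i C = {\<omega>. alternating \<omega> \<and> (\<forall>l. \<omega> l \<in> C) \<and> (\<forall>l. \<omega> l \<noteq> 0 \<longrightarrow> length l = i \<and> set l \<subseteq> G)}"

definition kdiff :: "'g set \<Rightarrow> ('g \<Rightarrow> 'm \<Rightarrow> 'm) \<Rightarrow> ('g list \<Rightarrow> 'm) \<Rightarrow> 'g list \<Rightarrow> 'm::comm_monoid_add" where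
  "kdiff G \<rho> \<omega> l = (\<Sum>a\<in>G. \<rho> a (\<omega> (a # l)))"

text \<open>Left exterior multiplication by the generator \<open>v\<close>: the value at a list is
  the sum, over the positions of \<open>v\<close> in it, of the value of \<open>\<omega>\<close> at
  the list without that entry, with sign (-1)^position.\<close>

primrec wedge :: "'g \<Rightarrow> ('g list \<Rightarrow> 'm::ab_group_add) \<Rightarrow> 'g list \<Rightarrow> 'm" where
  "wedge v \<omega> [] = 0"
| "wedge v \<omega> (a # l) = (if a = v then \<omega> l else 0) - wedge v (\<lambda>l. \<omega> (a # l)) l"

text \<open>Coefficients range over single graded components and over auxiliary sets built during
  the chases. These are closed under addition, but multiplication by a polynomial leaves
  them.\<close>

definition subgroup_set :: "'m::ab_group_add set \<Rightarrow> bool" where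
  "subgroup_set C \<longleftrightarrow> 0 \<in> C \<and> (\<forall>x\<in>C. \<forall>y\<in>C. x - y \<in> C)"

lemma subgroup_setI: "0 \<in> C \<Longrightarrow> (\<And>x y. x \<in> C \<Longrightarrow> y \<in> C \<Longrightarrow> x - y \<in> C) \<Longrightarrow> subgroup_set C"
  by (simp add: subgroup_set_def)

lemma subgroup_set_zero: "subgroup_set C \<Longrightarrow> 0 \<in> C"
  by (simp add: subgroup_set_def)

lemma subgroup_set_diff: "subgroup_set C \<Longrightarrow> x \<in> C \<Longrightarrow> y \<in> C \<Longrightarrow> x - y \<in> C"
  by (simp add: subgroup_set_def)

lemma subgroup_set_uminus: "subgroup_set C \<Longrightarrow> x \<in> C \<Longrightarrow> - x \<in> C"
  using subgroup_set_diff[of C 0 x] by (simp add: subgroup_set_zero)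

lemma subgroup_set_add: "subgroup_set C \<Longrightarrow> x \<in> C \<Longrightarrow> y \<in> C \<Longrightarrow> x + y \<in> C"
  using subgroup_set_diff[of C x "- y"] by (simp add: subgroup_set_uminus)

lemma subgroup_set_sum: "subgroup_set C \<Longrightarrow> (\<And>i. i \<in> I \<Longrightarrow> f i \<in> C) \<Longrightarrow> sum f I \<in> C"
  by (induction I rule: infinite_finite_induct) (auto intro: subgroup_set_add subgroup_set_zero)

lemma sum_fun_apply: "sum f I x = (\<Sum>i\<in>I. f i x)" for f :: "'i \<Rightarrow> 'a \<Rightarrow> 'm::comm_monoid_add"
  by (induction I rule: infinite_finite_induct) auto

lemma alternating_swap: "alternating \<omega> \<Longrightarrow> \<omega> (l @ a # b # l') = - \<omega> (l @ b # a # l')"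
  unfolding alternating_def by blast

lemma alternating_rep: "alternating \<omega> \<Longrightarrow> \<omega> (l @ a # a # l') = 0"
  unfolding alternating_def by blast

lemma alternating_swap0: "alternating \<omega> \<Longrightarrow> \<omega> (a # b # l') = - \<omega> (b # a # l')"
  using alternating_swap[of \<omega> "[]" a b l'] by simp

lemma alternating_rep0: "alternating \<omega> \<Longrightarrow> \<omega> (a # a # l') = 0"
  using alternating_rep[of \<omega> "[]" a l'] by simp

lemma alternating_contract:
  assumes "alternating \<omega>"
  shows "alternating (\<lambda>l. \<omega> (a # l))"
  unfolding alternating_def
proof (intro conjI allI)
  fix l b d l'
  show "\<omega> (a # l @ b # d # l') = - \<omega> (a # l @ d # b # l')"
    using alternating_swap[OF assms, of "a # l" b d l'] by simp
  show "\<omega> (a # l @ b # b # l') = 0"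
    using alternating_rep[OF assms, of "a # l" b l'] by simp
qed

lemma alternating_compose:
  assumes "alternating \<omega>" "\<phi> 0 = 0" "\<And>l. \<phi> (- \<omega> l) = - \<phi> (\<omega> l)"
  shows "alternating (\<lambda>l. \<phi> (\<omega> l))"
  unfolding alternating_def
proof (intro conjI allI)
  fix l a b l'
  show "\<phi> (\<omega> (l @ a # b # l')) = - \<phi> (\<omega> (l @ b # a # l'))"
    by (subst alternating_swap[OF assms(1)]) (rule assms(3))
  show "\<phi> (\<omega> (l @ a # a # l')) = 0" by (simp add: alternating_rep[OF assms(1)] assms(2))
qed

lemma alternating_diff: "alternating \<omega> \<Longrightarrow> alternating \<eta> \<Longrightarrow> alternating (\<omega> - \<eta>)"
proof (subst alternating_def, intro conjI allI)
  fix l a b l'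
  assume *: "alternating \<omega>" "alternating \<eta>"
  show "(\<omega> - \<eta>) (l @ a # b # l') = - (\<omega> - \<eta>) (l @ b # a # l')"
    unfolding fun_diff_def alternating_swap[OF *(1), of l a b l'] alternating_swap[OF *(2), of l a b l']
    by simp
qed (simp add: alternating_rep)

lemma alternating_sum: "(\<And>i. i \<in> I \<Longrightarrow> alternating (\<omega> i)) \<Longrightarrow> alternating (\<lambda>l. \<Sum>i\<in>I. \<omega> i l)"
  unfolding alternating_def
proof (intro conjI allI)
  fix l l' :: "'b list" and a b
  assume *: "\<And>i. i \<in> I \<Longrightarrow> (\<forall>l a b l'. \<omega> i (l @ a # b # l') = - \<omega> i (l @ b # a # l')) \<and>
     (\<forall>l a l'. \<omega> i (l @ a # a # l') = 0)"
  show "(\<Sum>i\<in>I. \<omega> i (l @ a # b # l')) = - (\<Sum>i\<in>I. \<omega> i (l @ b # a # l'))"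
    unfolding sum_negf[symmetric] using * by (intro sum.cong) blast+
  show "(\<Sum>i\<in>I. \<omega> i (l @ a # a # l')) = 0" using * by (intro sum.neutral) blast
qed

lemma kosI:
  "alternating \<omega> \<Longrightarrow> (\<And>l. \<omega> l \<in> C) \<Longrightarrow> (\<And>l. \<omega> l \<noteq> 0 \<Longrightarrow> length l = i \<and> set l \<subseteq> G) \<Longrightarrow> \<omega> \<in> kos G i C"
  by (simp add: kos_def)

lemma kosD:
  assumes "\<omega> \<in> kos G i C"
  shows "alternating \<omega>" "\<omega> l \<in> C" "\<omega> l \<noteq> 0 \<Longrightarrow> length l = i" "\<omega> l \<noteq> 0 \<Longrightarrow> set l \<subseteq> G"
  using assms by (simp_all add: kos_def)

lemma kos_mono: "\<omega> \<in> kos G i C \<Longrightarrow> (\<And>l. \<omega> l \<in> C') \<Longrightarrow> \<omega> \<in> kos G i C'"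
  by (simp add: kos_def)

lemma kos_diff:
  assumes "subgroup_set C" "\<omega> \<in> kos G i C" "\<eta> \<in> kos G i C"
  shows "\<omega> - \<eta> \<in> kos G i C"
proof (rule kosI)
  show "alternating (\<omega> - \<eta>)" by (intro alternating_diff kosD(1)[OF assms(2)] kosD(1)[OF assms(3)])
  show "(\<omega> - \<eta>) l \<in> C" for l by (simp add: subgroup_set_diff[OF assms(1)] kosD(2)[OF assms(2)] kosD(2)[OF assms(3)])
  show "length l = i \<and> set l \<subseteq> G" if "(\<omega> - \<eta>) l \<noteq> 0" for l
    using that kosD(3,4)[OF assms(2), of l] kosD(3,4)[OF assms(3), of l] by fastforce
qed

lemma kos_zero: "0 \<in> C \<Longrightarrow> 0 \<in> kos G i C"
  by (rule kosI) (auto simp: alternating_def)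

lemma subgroup_set_kos: "subgroup_set C \<Longrightarrow> subgroup_set (kos G i C)"
  by (rule subgroup_setI) (simp_all add: kos_diff kos_zero subgroup_set_zero)

text \<open>The map \<open>\<phi>\<close> has to be odd but not additive. This generality is what
  lets \<open>kos_lift\<close> compose with a section chosen by hand.\<close>

lemma kos_compose:
  assumes "\<omega> \<in> kos G i C" "\<phi> 0 = 0" "\<And>x. x \<in> C \<Longrightarrow> \<phi> (- x) = - \<phi> x" "\<And>x. x \<in> C \<Longrightarrow> \<phi> x \<in> C'"
  shows "(\<lambda>l. \<phi> (\<omega> l)) \<in> kos G i C'"
proof (rule kosI)
  show "alternating (\<lambda>l. \<phi> (\<omega> l))"
    by (rule alternating_compose[OF kosD(1)[OF assms(1)] assms(2) assms(3)[OF kosD(2)[OF assms(1)]]])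
  show "\<phi> (\<omega> l) \<in> C'" for l by (intro assms(4) kosD(2)[OF assms(1)])
  show "length l = i \<and> set l \<subseteq> G" if "\<phi> (\<omega> l) \<noteq> 0" for l
    using that kosD(3,4)[OF assms(1), of l] assms(2) by metis
qed

lemma kos_0_iff: "\<omega> \<in> kos G 0 C \<longleftrightarrow> (\<exists>x\<in>C. 0 \<in> C \<and> \<omega> = (\<lambda>l. if l = [] then x else 0))"
proof
  assume *: "\<omega> \<in> kos G 0 C"
  then have "\<omega> = (\<lambda>l. if l = [] then \<omega> [] else 0)"
    using kosD(3)[OF *] by fastforce
  moreover have "0 \<in> C" using kosD(2)[OF *, of "[undefined]"] kosD(3)[OF *, of "[undefined]"] by force
  ultimately show "\<exists>x\<in>C. 0 \<in> C \<and> \<omega> = (\<lambda>l. if l = [] then x else 0)"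
    using kosD(2)[OF *] by blast
qed (auto simp: kos_def alternating_def split: if_splits)

section \<open>Exterior multiplication and contraction\<close>

lemma wedge_nonzero: "wedge v \<omega> l \<noteq> 0 \<Longrightarrow> \<exists>l1 l2. l = l1 @ v # l2 \<and> \<omega> (l1 @ l2) \<noteq> 0"
proof (induction l arbitrary: \<omega>)
  case (Cons a l)
  show ?case
  proof (cases "a = v \<and> \<omega> l \<noteq> 0")
    case True
    then show ?thesis by (intro exI[of _ "[]"] exI[of _ l]) simp
  next
    case False
    then have "wedge v (\<lambda>l. \<omega> (a # l)) l \<noteq> 0" using Cons.prems by (auto split: if_splits)
    from Cons.IH[OF this] show ?thesis by (metis append_Cons)
  qed
qed simp

lemma wedge_mem: "subgroup_set C \<Longrightarrow> (\<And>l. \<omega> l \<in> C) \<Longrightarrow> wedge v \<omega> l \<in> C"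
  by (induction l arbitrary: \<omega>) (simp_all only: wedge.simps subgroup_set_diff subgroup_set_zero split: if_splits, simp)

lemma wedge_compose:
  assumes "\<phi> 0 = 0" "\<And>x y. \<phi> (x - y) = \<phi> x - \<phi> y"
  shows "wedge v (\<lambda>l. \<phi> (\<omega> l)) l = \<phi> (wedge v \<omega> l)"
  by (induction l arbitrary: \<omega>) (auto simp: assms)

lemma wedge_zero: "wedge v (\<lambda>_. 0) l = 0"
  using wedge_nonzero by fastforce

lemma wedge_add: "wedge v (\<lambda>l. \<omega> l + \<eta> l) l = wedge v \<omega> l + wedge v \<eta> l"
  by (induction l arbitrary: \<omega> \<eta>) auto

lemma wedge_diff: "wedge v (\<omega> - \<eta>) l = wedge v \<omega> l - wedge v \<eta> l"
proof (induction l arbitrary: \<omega> \<eta>)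
  case (Cons a l)
  have "(\<lambda>l. (\<omega> - \<eta>) (a # l)) = (\<lambda>l. \<omega> (a # l)) - (\<lambda>l. \<eta> (a # l))" by auto
  then show ?case by (simp add: Cons.IH)
qed simp

lemma wedge_uminus: "wedge v (\<lambda>l. - \<omega> l) l = - wedge v \<omega> l"
  by (rule wedge_compose) auto

lemma wedge_sum: "wedge v (\<lambda>l. \<Sum>i\<in>I. \<omega> i l) l = (\<Sum>i\<in>I. wedge v (\<omega> i) l)"
  by (induction I rule: infinite_finite_induct) (simp_all add: wedge_zero wedge_add)

lemma alternating_wedge:
  assumes "alternating \<omega>"
  shows "alternating (wedge v \<omega>)"
  unfolding alternating_def
proof (intro conjI allI)
  fix l a b l'
  show "wedge v \<omega> (l @ a # b # l') = - wedge v \<omega> (l @ b # a # l')"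
    using assms
  proof (induction l arbitrary: \<omega>)
    case Nil
    have "(\<lambda>l. \<omega> (a # b # l)) = (\<lambda>l. - \<omega> (b # a # l))"
      by (rule ext) (rule alternating_swap0[OF Nil])
    then show ?case by (simp add: wedge_uminus)
  next
    case (Cons x l)
    have "\<omega> (l @ a # b # l') = - \<omega> (l @ b # a # l')" using Cons.prems by (rule alternating_swap)
    with Cons.IH[OF alternating_contract[OF Cons.prems]] show ?case by simp
  qed
  show "wedge v \<omega> (l @ a # a # l') = 0"
    using assms
  proof (induction l arbitrary: \<omega>)
    case Nil
    have "(\<lambda>l. \<omega> (a # a # l)) = (\<lambda>_. 0)"
      using alternating_rep0[OF Nil] by auto
    then show ?case by (auto simp: wedge_zero)
  next
    case (Cons x l)
    have "\<omega> (l @ a # a # l') = 0" using Cons.prems by (rule alternating_rep)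
    with Cons.IH[OF alternating_contract[OF Cons.prems]] show ?case by simp
  qed
qed

lemma wedge_kos:
  assumes "\<omega> \<in> kos G i C" "subgroup_set C" "v \<in> G"
  shows "wedge v \<omega> \<in> kos G (Suc i) C"
proof (rule kosI)
  show "alternating (wedge v \<omega>)" by (intro alternating_wedge kosD(1)[OF assms(1)])
  show "wedge v \<omega> l \<in> C" for l by (intro wedge_mem kosD(2)[OF assms(1)] assms(2))
  show "length l = Suc i \<and> set l \<subseteq> G" if "wedge v \<omega> l \<noteq> 0" for l
  proof -
    obtain l1 l2 where "l = l1 @ v # l2" "\<omega> (l1 @ l2) \<noteq> 0"
      using wedge_nonzero[OF \<open>wedge v \<omega> l \<noteq> 0\<close>] by blast
    then show ?thesis using kosD(3,4)[OF assms(1), of "l1 @ l2"] assms(3) by auto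
  qed
qed

text \<open>Contracting with \<open>v\<close> and multiplying by \<open>v\<close> again is the
  projection to the lists that contain \<open>v\<close>. An entry different from \<open>v\<close> is
  passed at the price of two signs, one from \<open>alternating\<close> and one from
  \<open>wedge\<close>.\<close>

lemma wedge_contract:
  assumes "alternating \<omega>" "v \<in> set l"
  shows "wedge v (\<lambda>l. \<omega> (v # l)) l = \<omega> l"
  using assms
proof (induction l arbitrary: \<omega>)
  case (Cons a l)
  show ?case
  proof (cases "a = v")
    case True
    then show ?thesis using alternating_rep0[OF Cons.prems(1)] by (simp add: wedge_zero)
  next
    case False
    have "(\<lambda>l. \<omega> (v # a # l)) = (\<lambda>l. - \<omega> (a # v # l))"
      by (rule ext) (rule alternating_swap0[OF Cons.prems(1)])
    then have "wedge v (\<lambda>l. \<omega> (v # l)) (a # l) = wedge v (\<lambda>l. \<omega> (a # v # l)) l"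
      using False by (simp add: wedge_uminus)
    also have "\<dots> = \<omega> (a # l)"
      using Cons.IH[OF alternating_contract[OF Cons.prems(1), of a]] Cons.prems(2) False by simp
    finally show ?thesis .
  qed
qed simp

section \<open>The Koszul differential\<close>

lemma kdiff_kos:
  assumes "\<omega> \<in> kos G (Suc i) C" "subgroup_set C'"
    "\<And>a x. a \<in> G \<Longrightarrow> x \<in> C \<Longrightarrow> \<rho> a x \<in> C'"
    "\<And>a. a \<in> G \<Longrightarrow> \<rho> a 0 = 0" "\<And>a x. a \<in> G \<Longrightarrow> x \<in> C \<Longrightarrow> \<rho> a (- x) = - \<rho> a x"
  shows "kdiff G \<rho> \<omega> \<in> kos G i C'"
proof (rule kosI)
  have "alternating (\<lambda>l. \<Sum>a\<in>G. \<rho> a (\<omega> (a # l)))"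
    by (rule alternating_sum, rule alternating_compose[OF alternating_contract[OF kosD(1)[OF assms(1)]]])
       (simp_all add: assms(4,5) kosD(2)[OF assms(1)])
  then show "alternating (kdiff G \<rho> \<omega>)" by (simp add: kdiff_def[abs_def])
  show "kdiff G \<rho> \<omega> l \<in> C'" for l
    unfolding kdiff_def using assms by (intro subgroup_set_sum) (auto simp: kosD(2)[OF assms(1)])
  show "length l = i \<and> set l \<subseteq> G" if "kdiff G \<rho> \<omega> l \<noteq> 0" for l
  proof -
    obtain a where a: "a \<in> G" "\<rho> a (\<omega> (a # l)) \<noteq> 0"
      using sum.not_neutral_contains_not_neutral[OF \<open>kdiff G \<rho> \<omega> l \<noteq> 0\<close>[unfolded kdiff_def]] by blast
    then have "\<omega> (a # l) \<noteq> 0" using assms(4) by auto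
    then show ?thesis using kosD(3,4)[OF assms(1), of "a # l"] by simp
  qed
qed

lemma kdiff_kos_0:
  assumes "\<omega> \<in> kos G 0 C" "\<And>a. a \<in> G \<Longrightarrow> \<rho> a 0 = 0"
  shows "kdiff G \<rho> \<omega> = 0"
proof
  fix l
  have "\<omega> (a # l) = 0" for a using kosD(3)[OF assms(1), of "a # l"] by auto
  then show "kdiff G \<rho> \<omega> l = 0 l" using assms(2) by (simp add: kdiff_def)
qed

lemma sum_alternating:
  fixes f :: "'a \<Rightarrow> 'a \<Rightarrow> 'm::ab_group_add"
  assumes "finite A" "\<And>a b. f a b = - f b a" "\<And>a. f a a = 0"
  shows "(\<Sum>a\<in>A. \<Sum>b\<in>A. f a b) = 0"
  using assms(1)
proof (induction A)
  case (insert x A)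
  have "(\<Sum>a\<in>A. f a x) = - (\<Sum>b\<in>A. f x b)"
    unfolding sum_negf[symmetric] by (intro sum.cong refl assms(2))
  then show ?case using insert by (simp add: sum.distrib assms(3))
qed simp

locale commuting_action =
  fixes G :: "'g set" and \<rho> :: "'g \<Rightarrow> 'm \<Rightarrow> 'm::ab_group_add"
  assumes finite_G: "finite G"
    and action_diff: "\<rho> a (x - y) = \<rho> a x - \<rho> a y"
    and action_commute: "\<rho> a (\<rho> b x) = \<rho> b (\<rho> a x)"
begin

lemma action_zero [simp]: "\<rho> a 0 = 0"
  using action_diff[of a 0 0] by simp

lemma action_uminus: "\<rho> a (- x) = - \<rho> a x"
  using action_diff[of a 0 x] by simp

lemma action_add: "\<rho> a (x + y) = \<rho> a x + \<rho> a y"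
  using action_diff[of a x "- y"] by (simp add: action_uminus)

lemma action_sum: "\<rho> a (sum f I) = (\<Sum>i\<in>I. \<rho> a (f i))"
  by (induction I rule: infinite_finite_induct) (auto simp: action_add)

lemma kdiff_diff: "kdiff G \<rho> (\<omega> - \<eta>) = kdiff G \<rho> \<omega> - kdiff G \<rho> \<eta>"
  by (rule ext) (simp add: kdiff_def action_diff sum_subtractf)

lemma kdiff_zero [simp]: "kdiff G \<rho> 0 = 0"
  by (rule ext) (simp add: kdiff_def)

lemma kdiff_uminus: "kdiff G \<rho> (- \<omega>) = - kdiff G \<rho> \<omega>"
  using kdiff_diff[of 0 \<omega>] by simp

lemma kdiff_add: "kdiff G \<rho> (\<omega> + \<eta>) = kdiff G \<rho> \<omega> + kdiff G \<rho> \<eta>"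
  using kdiff_diff[of \<omega> "- \<eta>"] by (simp add: kdiff_uminus)

lemma kdiff_sum: "kdiff G \<rho> (sum \<omega> I) = (\<Sum>i\<in>I. kdiff G \<rho> (\<omega> i))"
  by (rule ext) (simp add: kdiff_def sum_fun_apply action_sum sum.swap[of _ I])

lemma kdiff_kdiff:
  assumes "alternating \<omega>"
  shows "kdiff G \<rho> (kdiff G \<rho> \<omega>) = 0"
proof
  fix l
  have "kdiff G \<rho> (kdiff G \<rho> \<omega>) l = (\<Sum>a\<in>G. \<Sum>b\<in>G. \<rho> a (\<rho> b (\<omega> (b # a # l))))"
    by (simp add: kdiff_def action_sum)
  also have "\<dots> = 0"
  proof (rule sum_alternating[OF finite_G])
    show "\<rho> a (\<rho> b (\<omega> (b # a # l))) = - \<rho> b (\<rho> a (\<omega> (a # b # l)))" for a b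
      by (subst alternating_swap0[OF assms]) (simp add: action_uminus action_commute)
    show "\<rho> a (\<rho> a (\<omega> (a # a # l))) = 0" for a by (simp add: alternating_rep0[OF assms])
  qed
  finally show "kdiff G \<rho> (kdiff G \<rho> \<omega>) l = 0 l" by simp
qed

text \<open>Exterior multiplication by \<open>v\<close> is a homotopy from multiplication by
  \<open>v\<close> to zero. Acyclicity for the indeterminates and the annihilation of Koszul
  homology by its generators both rest on this identity.\<close>

lemma kdiff_wedge:
  assumes "v \<in> G"
  shows "kdiff G \<rho> (wedge v \<omega>) l = \<rho> v (\<omega> l) - wedge v (kdiff G \<rho> \<omega>) l"
proof -
  have "wedge v (kdiff G \<rho> \<omega>) l = (\<Sum>a\<in>G. \<rho> a (wedge v (\<lambda>l. \<omega> (a # l)) l))"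
    unfolding kdiff_def[abs_def] wedge_sum by (intro sum.cong refl wedge_compose) (auto simp: action_diff)
  moreover have "(\<Sum>a\<in>G. \<rho> a (if a = v then \<omega> l else 0)) = \<rho> v (\<omega> l)"
    using assms finite_G by (subst sum.remove[of G v]) (auto intro!: sum.neutral)
  ultimately show ?thesis by (simp add: kdiff_def action_diff sum_subtractf)
qed

lemma kdiff_kos_stable:
  assumes "\<omega> \<in> kos G (Suc i) C" "subgroup_set C'" "\<And>a x. a \<in> G \<Longrightarrow> x \<in> C \<Longrightarrow> \<rho> a x \<in> C'"
  shows "kdiff G \<rho> \<omega> \<in> kos G i C'"
  using assms by (intro kdiff_kos) (auto simp: action_uminus)

end

text \<open>Alternating forms lift through a surjection because it has an odd section: choose preimages
  for one element of each pair \<open>{x, - x}\<close>.\<close>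

lemma kos_lift:
  fixes \<phi> :: "'m::ab_group_add \<Rightarrow> 'n::ab_group_add"
  assumes \<omega>: "\<omega> \<in> kos G i C" and C: "subgroup_set C" and C': "subgroup_set C'"
    and surj: "\<And>x. x \<in> C \<Longrightarrow> \<exists>y\<in>C'. \<phi> y = x"
    and odd: "\<And>y. y \<in> C' \<Longrightarrow> \<phi> (- y) = - \<phi> y"
    and char: "(\<forall>x\<in>C. x = - x \<longrightarrow> x = 0) \<or> (\<forall>y\<in>C'. - y = y)"
    and z: "\<phi> 0 = 0"
  obtains \<eta> where "\<eta> \<in> kos G i C'" "\<And>l. \<phi> (\<eta> l) = \<omega> l"
proof -
  define r where "r x = (SOME y. y \<in> {x, - x})" for x :: 'n
  define g where "g x = (if x = 0 then 0 else SOME y. y \<in> C' \<and> \<phi> y = x)" for x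
  have g: "g x \<in> C' \<and> \<phi> (g x) = x" if "x \<in> C" for x
  proof (cases "x = 0")
    case True
    then show ?thesis by (simp add: g_def subgroup_set_zero[OF C'] z)
  next
    case False
    then show ?thesis using someI_ex[of "\<lambda>y. y \<in> C' \<and> \<phi> y = x"] surj[OF that] by (auto simp: g_def)
  qed
  define s where "s x = (if x = r x then g (r x) else - g (r x))" for x
  have r: "r x = x \<or> r x = - x" for x
    unfolding r_def using someI[of "\<lambda>y. y \<in> {x, - x}" x] by auto
  have r_neg: "r (- x) = r x" for x by (simp add: r_def insert_commute)
  have s0: "s 0 = 0" using r[of 0] by (simp add: s_def g_def)
  have rep: "s x \<in> C' \<and> \<phi> (s x) = x" if "x \<in> C" "- x \<in> C" for x
    using r[of x] g[OF that(1)] g[OF that(2)] C' odd by (auto simp: s_def subgroup_set_uminus)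
  have s_odd: "s (- x) = - s x" if "x \<in> C" "- x \<in> C" for x
  proof (cases "x = - x")
    \<comment> \<open>The fixed points of negation are the only obstruction to an odd section. By
      \<open>char\<close> either 0 is the only one, or every available preimage is its own
      negative.\<close>
    case True
    from char show ?thesis
    proof
      assume "\<forall>x\<in>C. x = - x \<longrightarrow> x = 0"
      then have "x = 0" using True that by blast
      then show ?thesis by (simp add: s0)
    next
      assume "\<forall>y\<in>C'. - y = y"
      then have "- s x = s x" using rep[OF that] by blast
      then show ?thesis using True by simp
    qed
  next
    case False
    have "s (- x) = (if - x = r x then g (r x) else - g (r x))" by (simp only: s_def r_neg)
    moreover have "s x = (if x = r x then g (r x) else - g (r x))" by (simp only: s_def)
    moreover have "(- x = r x) \<longleftrightarrow> x \<noteq> r x" using r[of x] False by metis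
    ultimately show ?thesis by simp
  qed
  show thesis
  proof
    have neg: "- \<omega> l \<in> C" for l using kosD(2)[OF \<omega>] C by (auto intro: subgroup_set_uminus)
    show "\<phi> (s (\<omega> l)) = \<omega> l" for l using rep[OF kosD(2)[OF \<omega>] neg] by blast
    show "(\<lambda>l. s (\<omega> l)) \<in> kos G i C'"
      using rep s_odd C by (intro kos_compose[OF \<omega>] s0) (auto intro: subgroup_set_uminus)
  qed
qed

section \<open>Acyclicity of the Koszul complex of the indeterminates\<close>

definition var :: "'v \<Rightarrow> ('v, 'k::comm_ring_1) mpoly" where
  "var v = Poly_Mapping.single (Poly_Mapping.single v 1) 1"

lemma lookup_single_mult:
  fixes p :: "('v, 'k::comm_ring_1) mpoly"
  shows "lookup (Poly_Mapping.single u c * p) m = (\<Sum>m'\<in>keys p. if u + m' = m then c * lookup p m' else 0)"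
proof -
  have "Poly_Mapping.single u c * p = (\<Sum>m'\<in>keys p. Poly_Mapping.single (u + m') (c * lookup p m'))"
    by (subst poly_sum_singles[of p]) (simp add: sum_distrib_left Poly_Mapping.mult_single)
  then show ?thesis
    by (simp add: Poly_Mapping.lookup_sum Poly_Mapping.lookup_single when_def)
qed

lemma lookup_single_mult_add:
  fixes p :: "('v, 'k::comm_ring_1) mpoly"
  shows "lookup (Poly_Mapping.single u c * p) (u + m) = c * lookup p m"
  unfolding lookup_single_mult by (auto simp: Poly_Mapping.in_keys_iff)

lemma lookup_var_mult_add: "lookup (var v * p) (m + Poly_Mapping.single v 1) = lookup p m"
  unfolding var_def by (subst add.commute, subst lookup_single_mult_add) simp

lemma lookup_var_mult_0: "v \<notin> keys m \<Longrightarrow> lookup (var v * p) m = 0"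
  unfolding var_def lookup_single_mult by (intro sum.neutral) (auto simp: keys_add_nat)

lemma keys_nat_decomp:
  assumes "v \<in> keys (m :: 'v \<Rightarrow>\<^sub>0 nat)"
  obtains m' where "m = m' + Poly_Mapping.single v 1"
proof
  show "m = (m - Poly_Mapping.single v 1) + Poly_Mapping.single v 1"
    using assms by (intro poly_mapping_eqI)
      (auto simp: Poly_Mapping.lookup_add Poly_Mapping.lookup_minus Poly_Mapping.lookup_single when_def Poly_Mapping.in_keys_iff)
qed

lemma mdeg_single [simp]: "mdeg (Poly_Mapping.single v e) = e"
  by (simp add: mdeg_def)

lemma var_homog: "v \<in> V \<Longrightarrow> var v \<in> homog V 1"
  by (auto simp: homog_def polys_def var_def)

lemma subgroup_set_homog: "subgroup_set (homog V e :: ('v, 'k::comm_ring_1) mpoly set)"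
  by (rule subgroup_setI) (simp, metis diff_conv_add_uminus homog_add homog_uminus)

lemma commuting_action_mult:
  "finite G \<Longrightarrow> commuting_action G (\<lambda>v p. (\<phi> v :: 'a::comm_ring_1) * p)"
  by unfold_locales (auto simp: algebra_simps)

text \<open>The multidegree of the exterior basis element indexed by the list.\<close>

definition exponents :: "'v list \<Rightarrow> ('v \<Rightarrow>\<^sub>0 nat)" where
  "exponents l = sum_list (map (\<lambda>v. Poly_Mapping.single v 1) l)"

lemma exponents_simps [simp]:
  "exponents [] = 0" "exponents (a # l) = Poly_Mapping.single a 1 + exponents l"
  "exponents (l @ l') = exponents l + exponents l'"
  by (simp_all add: exponents_def)

lemma keys_exponents [simp]: "keys (exponents l) = set l"
  by (induction l) (auto simp: keys_add_nat)

text \<open>The choice depends on the multidegree alone. The Koszul differential preserves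
  multidegrees, so all terms that meet in one coefficient use the same generator.\<close>

definition pivot :: "('v \<Rightarrow>\<^sub>0 nat) \<Rightarrow> 'v" where
  "pivot \<alpha> = (SOME v. v \<in> keys \<alpha>)"

lemma pivot_mem: "\<alpha> \<noteq> 0 \<Longrightarrow> pivot \<alpha> \<in> keys \<alpha>"
  unfolding pivot_def by (rule someI_ex) (metis keys_eq_empty ex_in_conv)

text \<open>In multidegree \<open>\<alpha> \<noteq> 0\<close> the homotopy is exterior multiplication by the generator \<open>v\<close>
  divided by the indeterminate \<open>v\<close>, for a fixed \<open>v\<close> in the support of \<open>\<alpha>\<close>.\<close>

definition khom_coeff :: "('v list \<Rightarrow> ('v, 'k::comm_ring_1) mpoly) \<Rightarrow> 'v list \<Rightarrow> ('v \<Rightarrow>\<^sub>0 nat) \<Rightarrow> 'k" where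
  "khom_coeff \<omega> l m = (if m + exponents l = 0 then 0 else
     (let v = pivot (m + exponents l) in lookup (wedge v \<omega> l) (m + Poly_Mapping.single v 1)))"

definition khom :: "('v list \<Rightarrow> ('v, 'k::comm_ring_1) mpoly) \<Rightarrow> 'v list \<Rightarrow> ('v, 'k) mpoly" where
  "khom \<omega> l = Abs_poly_mapping (khom_coeff \<omega> l)"

text \<open>The support is finite although the pivot varies with \<open>m\<close>: a non-zero
  coefficient forces the pivot to be an entry of \<open>l\<close>, which leaves finitely many
  shifted supports.\<close>

lemma lookup_khom: "lookup (khom \<omega> l) m = khom_coeff \<omega> l m"
proof -
  have "{m. khom_coeff \<omega> l m \<noteq> 0} \<subseteq> (\<Union>v\<in>set l. (\<lambda>m'. m' - Poly_Mapping.single v 1) ` keys (wedge v \<omega> l))"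
  proof
    fix m assume "m \<in> {m. khom_coeff \<omega> l m \<noteq> 0}"
    then obtain v where v: "lookup (wedge v \<omega> l) (m + Poly_Mapping.single v 1) \<noteq> 0"
      by (auto simp: khom_coeff_def Let_def split: if_splits)
    then have "wedge v \<omega> l \<noteq> 0" by auto
    then have "v \<in> set l" using wedge_nonzero by fastforce
    moreover have "m + Poly_Mapping.single v 1 \<in> keys (wedge v \<omega> l)" using v by (simp add: Poly_Mapping.in_keys_iff)
    moreover have "m = (m + Poly_Mapping.single v 1) - Poly_Mapping.single v 1" by simp
    ultimately show "m \<in> (\<Union>v\<in>set l. (\<lambda>m'. m' - Poly_Mapping.single v 1) ` keys (wedge v \<omega> l))" by blast
  qed
  then have "finite {m. khom_coeff \<omega> l m \<noteq> 0}" by (rule finite_subset) auto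
  then show ?thesis by (simp add: khom_def)
qed

lemma khom_uminus: "khom (\<lambda>l. - \<omega> l) l = - khom \<omega> l"
  by (intro poly_mapping_eqI) (simp add: lookup_khom khom_coeff_def Let_def wedge_uminus)

lemma khom_zero: "khom (\<lambda>_. 0) l = 0"
  by (intro poly_mapping_eqI) (simp add: lookup_khom khom_coeff_def Let_def wedge_zero)

lemma khom_kos:
  fixes \<omega> :: "'v list \<Rightarrow> ('v, 'k::comm_ring_1) mpoly"
  assumes \<omega>: "\<omega> \<in> kos V i (homog V e)"
  shows "khom \<omega> \<in> kos V (Suc i) (homog V (e - 1))"
proof (rule kosI)
  note alt = alternating_wedge[OF kosD(1)[OF \<omega>]]
  show "alternating (khom \<omega>)"
    unfolding alternating_def
  proof (intro conjI allI poly_mapping_eqI)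
    fix l l' :: "'v list" and a b m
    \<comment> \<open>The multidegree, and with it the pivot, ignores the order of the list, so the
      sign rule of \<open>wedge\<close> for a fixed generator applies.\<close>
    have "exponents (l @ a # b # l') = exponents (l @ b # a # l')" by (simp add: ac_simps)
    then show "lookup (khom \<omega> (l @ a # b # l')) m = lookup (- khom \<omega> (l @ b # a # l')) m"
      unfolding lookup_khom Poly_Mapping.lookup_uminus khom_coeff_def Let_def
      by (subst alternating_swap[OF alt]) simp
    show "lookup (khom \<omega> (l @ a # a # l')) m = lookup 0 m"
      unfolding lookup_khom khom_coeff_def Let_def by (simp add: alternating_rep[OF alt])
  qed
  have *: "m + Poly_Mapping.single v 1 \<in> keys (wedge v \<omega> l) \<and> wedge v \<omega> l \<in> homog V e \<and> v \<in> V \<and> keys m \<subseteq> V"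
    if "m \<in> keys (khom \<omega> l)" and v: "v = pivot (m + exponents l)" for l m v
  proof -
    have 1: "m + Poly_Mapping.single v 1 \<in> keys (wedge v \<omega> l)"
      using that by (simp add: Poly_Mapping.in_keys_iff lookup_khom khom_coeff_def Let_def split: if_splits)
    moreover have 2: "wedge v \<omega> l \<in> homog V e"
      by (intro wedge_mem subgroup_set_homog kosD(2)[OF \<omega>])
    ultimately have "keys (m + Poly_Mapping.single v 1) \<subseteq> V"
      unfolding homog_def polys_def by blast
    then show ?thesis using 1 2 by (simp add: keys_add_nat)
  qed
  show "khom \<omega> l \<in> homog V (e - 1)" for l
    unfolding homog_def polys_def
  proof (intro CollectI conjI ballI)
    fix m assume m: "m \<in> keys (khom \<omega> l)"
    define v where "v = pivot (m + exponents l)"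
    note *[OF m v_def]
    then show "keys m \<subseteq> V" "int (mdeg m) = e - 1"
      by (force simp: homog_def mdeg_add)+
  qed
  show "length l = Suc i \<and> set l \<subseteq> V" if "khom \<omega> l \<noteq> 0" for l
  proof -
    obtain m where m: "m \<in> keys (khom \<omega> l)" using \<open>khom \<omega> l \<noteq> 0\<close> by fastforce
    define v where "v = pivot (m + exponents l)"
    have "wedge v \<omega> l \<noteq> 0" "v \<in> V" using *[OF m v_def] by auto
    then show ?thesis
      using kosD(3,4)[OF wedge_kos[OF \<omega> subgroup_set_homog], of v l] by blast
  qed
qed

text \<open>In a multidegree with pivot \<open>v\<close>, the differential of
  \<open>khom \<omega>\<close> is that of \<open>wedge v \<omega>\<close> divided by the
  indeterminate \<open>v\<close>, and \<open>kdiff_wedge\<close> evaluates the latter on a cycle.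
  Dividing by an indeterminate instead of by the degree keeps the homotopy valid in every
  characteristic. Homology survives only in multidegree 0, which \<open>const\<close>
  excludes.\<close>

theorem koszul_acyclic:
  fixes \<omega> :: "'v list \<Rightarrow> ('v, 'k::comm_ring_1) mpoly"
  assumes V: "finite V" and \<omega>: "\<omega> \<in> kos V i (homog V e)"
    and cycle: "kdiff V (\<lambda>v p. var v * p) \<omega> = 0" and const: "lookup (\<omega> []) 0 = 0"
  shows "kdiff V (\<lambda>v p. var v * p) (khom \<omega>) = \<omega>"
proof (intro ext poly_mapping_eqI)
  fix l m
  interpret commuting_action V "\<lambda>v (p :: ('v, 'k) mpoly). var v * p" by (rule commuting_action_mult[OF V])
  have kk: "kdiff V (\<lambda>v p. var v * p) (khom \<omega>) \<in> kos V i (homog V e)"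
    using homog_mult[OF var_homog, of _ V _ "e - 1"]
    by (intro kdiff_kos_stable[OF khom_kos[OF \<omega>]] subgroup_set_homog) auto
  show "lookup (kdiff V (\<lambda>v p. var v * p) (khom \<omega>) l) m = lookup (\<omega> l) m"
  proof (cases "set l \<subseteq> V \<and> keys m \<subseteq> V \<and> m + exponents l \<noteq> 0")
    \<comment> \<open>Here both sides are zero: a form over \<open>V\<close> without constant term
      has no coefficient outside the indeterminates \<open>V\<close> or in multidegree 0.\<close>
    case False
    have "lookup (\<eta> l) m = 0" if \<eta>: "\<eta> \<in> kos V i (homog V e)" "lookup (\<eta> []) 0 = 0" for \<eta>
    proof (rule ccontr)
      assume nz: "lookup (\<eta> l) m \<noteq> 0"
      then have "\<eta> l \<noteq> 0" by auto
      then have "set l \<subseteq> V" by (rule kosD(4)[OF \<eta>(1)])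
      moreover have "keys m \<subseteq> V"
        using kosD(2)[OF \<eta>(1), of l] nz by (auto simp: homog_def polys_def Poly_Mapping.in_keys_iff)
      ultimately have "m + exponents l = 0" using False by blast
      then have "keys m \<union> set l = {}" by (metis keys_add_nat keys_exponents keys_zero)
      then have "l = []" "m = 0" by auto
      then show False using nz \<eta>(2) by simp
    qed
    moreover have "lookup (kdiff V (\<lambda>v p. var v * p) (khom \<omega>) []) 0 = 0"
      by (simp add: kdiff_def Poly_Mapping.lookup_sum lookup_var_mult_0)
    ultimately show ?thesis using \<omega> const kk by metis
  next
    case True
    define v where "v = pivot (m + exponents l)"
    have "v \<in> keys (m + exponents l)" using True pivot_mem unfolding v_def by blast
    then have v: "v \<in> V" "v \<in> keys m \<or> v \<in> set l" using True by (auto simp: keys_add_nat)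
    define W where "W a = wedge v \<omega> (a # l)" for a
    \<comment> \<open>The comparison below could fail only for \<open>a = v\<close> when
      \<open>v\<close> does not divide \<open>m\<close>, since then the left side has nothing to
      shift. But in that case \<open>v\<close> lies in \<open>l\<close>, and
      \<open>wedge v \<omega>\<close> vanishes at a list that contains \<open>v\<close>
      twice.\<close>
    have Wv: "W v = 0" if "v \<notin> keys m"
      using that v wedge_contract[OF kosD(1)[OF \<omega>], of v l] by (simp add: W_def)
    have "lookup (var a * khom \<omega> (a # l)) m = lookup (var a * W a) (m + Poly_Mapping.single v 1)" for a
    proof (cases "a \<in> keys m")
      case True
      then obtain m' where m': "m = m' + Poly_Mapping.single a 1" by (rule keys_nat_decomp)
      have eq: "m' + exponents (a # l) = m + exponents l" by (simp add: m' ac_simps)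
      have "lookup (var a * khom \<omega> (a # l)) m = khom_coeff \<omega> (a # l) m'"
        unfolding m' lookup_var_mult_add lookup_khom ..
      also have "\<dots> = lookup (W a) (m' + Poly_Mapping.single v 1)"
        unfolding khom_coeff_def eq Let_def v_def[symmetric] W_def
        using \<open>set l \<subseteq> V \<and> keys m \<subseteq> V \<and> m + exponents l \<noteq> 0\<close> by simp
      also have "\<dots> = lookup (var a * W a) (m + Poly_Mapping.single v 1)"
        using lookup_var_mult_add[of a "W a" "m' + Poly_Mapping.single v 1"] by (simp add: m' ac_simps)
      finally show ?thesis .
    next
      case False
      show ?thesis
      proof (cases "a = v")
        case True
        then show ?thesis using False Wv by (simp add: lookup_var_mult_0)
      next
        case neq: False
        then have "a \<notin> keys (m + Poly_Mapping.single v 1)" using False by (simp add: keys_add_nat)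
        then show ?thesis using False by (simp add: lookup_var_mult_0)
      qed
    qed
    then have "lookup (kdiff V (\<lambda>v p. var v * p) (khom \<omega>) l) m =
        lookup (kdiff V (\<lambda>v p. var v * p) (wedge v \<omega>) l) (m + Poly_Mapping.single v 1)"
      by (simp add: kdiff_def Poly_Mapping.lookup_sum W_def)
    also have "\<dots> = lookup (var v * \<omega> l) (m + Poly_Mapping.single v 1)"
      unfolding kdiff_wedge[OF v(1)] cycle by (simp add: zero_fun_def wedge_zero)
    finally show ?thesis by (simp only: lookup_var_mult_add)
  qed
qed

lemma commuting_action_pscale:
  "finite G \<Longrightarrow> commuting_action G (\<lambda>v. pscale (\<phi> v :: 'a::comm_ring_1) :: ('b \<Rightarrow>\<^sub>0 'a) \<Rightarrow> _)"
  by unfold_locales (auto intro!: poly_mapping_eqI simp: Poly_Mapping.lookup_minus algebra_simps)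

lemma subgroup_set_free_comp: "subgroup_set (free_comp V B d e :: ('b \<Rightarrow>\<^sub>0 ('v, 'k::field) mpoly) set)"
proof -
  interpret graded_module V pscale "free_comp V B d :: int \<Rightarrow> ('b \<Rightarrow>\<^sub>0 ('v, 'k) mpoly) set"
    by (rule graded_module_free)
  show ?thesis by (rule subgroup_setI) (metis comp_zero, metis diff_conv_add_uminus comp_add comp_uminus)
qed

theorem koszul_acyclic_free:
  fixes \<omega> :: "'v list \<Rightarrow> 'b \<Rightarrow>\<^sub>0 ('v, 'k::field) mpoly"
  assumes V: "finite V" and \<omega>: "\<omega> \<in> kos V i (free_comp V B d e)"
    and cycle: "kdiff V (\<lambda>v. pscale (var v)) \<omega> = 0" and const: "\<And>b. lookup (lookup (\<omega> []) b) 0 = 0"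
  obtains \<eta> where "\<eta> \<in> kos V (Suc i) (free_comp V B d (e - 1))" "kdiff V (\<lambda>v. pscale (var v)) \<eta> = \<omega>"
proof
  define \<omega>' where "\<omega>' b l = lookup (\<omega> l) b" for b l
  have \<omega>': "\<omega>' b \<in> kos V i (homog V (e - d b))" for b
    unfolding \<omega>'_def[abs_def] using \<omega> by (rule kos_compose) (auto simp: free_comp_def)
  have hom: "kdiff V (\<lambda>v p. var v * p) (khom (\<omega>' b)) = \<omega>' b" for b
  proof (rule koszul_acyclic[OF V \<omega>'])
    show "kdiff V (\<lambda>v p. var v * p) (\<omega>' b) = 0"
    proof
      fix l
      have "lookup (kdiff V (\<lambda>v. pscale (var v)) \<omega> l) b = 0" by (simp add: cycle)
      then show "kdiff V (\<lambda>v p. var v * p) (\<omega>' b) l = 0 l"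
        by (simp add: kdiff_def Poly_Mapping.lookup_sum \<omega>'_def)
    qed
  qed (simp add: \<omega>'_def const)
  \<comment> \<open>The basis may be infinite. As \<open>V\<close> is finite, only finitely many
    lists carry values, so finitely many basis elements occur in all of them together and the
    homotopy can be applied coordinatewise.\<close>
  define B' where "B' = (\<Union>l\<in>{l. set l \<subseteq> V \<and> length l = i}. keys (\<omega> l))"
  have fin: "finite B'" unfolding B'_def using V by (simp add: finite_lists_length_eq)
  have outside: "\<omega>' b = (\<lambda>_. 0)" if "b \<notin> B'" for b
  proof (rule ext, rule ccontr)
    fix l assume "\<omega>' b l \<noteq> 0"
    then have b: "b \<in> keys (\<omega> l)" by (simp add: \<omega>'_def Poly_Mapping.in_keys_iff)
    then have "\<omega> l \<noteq> 0" by auto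
    then show False using that b kosD(3,4)[OF \<omega>] by (auto simp: B'_def)
  qed
  define \<eta> where "\<eta> l = (\<Sum>b\<in>B'. Poly_Mapping.single b (khom (\<omega>' b) l))" for l
  have \<eta>: "lookup (\<eta> l) b = khom (\<omega>' b) l" for l b
    unfolding \<eta>_def Poly_Mapping.lookup_sum
    using fin outside[of b] by (auto simp: Poly_Mapping.lookup_single when_def khom_zero)
  note k = khom_kos[OF \<omega>']
  show "\<eta> \<in> kos V (Suc i) (free_comp V B d (e - 1))"
  proof (rule kosI)
    show "alternating \<eta>"
      unfolding alternating_def
    proof (intro conjI allI)
      fix l a b l'
      have "khom (\<omega>' x) (l @ a # b # l') = - khom (\<omega>' x) (l @ b # a # l')"
        "khom (\<omega>' x) (l @ a # a # l') = 0" for x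
        using kosD(1)[OF k[of x]] by (rule alternating_swap, rule alternating_rep)
      then show "\<eta> (l @ a # b # l') = - \<eta> (l @ b # a # l')" "\<eta> (l @ a # a # l') = 0"
        by (auto intro!: poly_mapping_eqI[where f = "\<eta> _"] simp: \<eta>)
    qed
    show "\<eta> l \<in> free_comp V B d (e - 1)" for l
      unfolding free_comp_def
    proof (intro CollectI conjI allI subsetI)
      show "lookup (\<eta> l) b \<in> homog V (e - 1 - d b)" for b
        using kosD(2)[OF k, of b l] by (simp add: \<eta> algebra_simps)
      fix b assume "b \<in> keys (\<eta> l)"
      then have "khom (\<omega>' b) l \<noteq> 0" by (simp add: \<eta> Poly_Mapping.in_keys_iff)
      then have "b \<in> B'" using outside[of b] khom_zero by metis
      then show "b \<in> B" using kosD(2)[OF \<omega>] by (auto simp: B'_def free_comp_def)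
    qed
    show "length l = Suc i \<and> set l \<subseteq> V" if "\<eta> l \<noteq> 0" for l
    proof -
      have "\<exists>b. lookup (\<eta> l) b \<noteq> 0" using \<open>\<eta> l \<noteq> 0\<close> by (metis Poly_Mapping.lookup_zero poly_mapping_eqI)
      then show ?thesis unfolding \<eta> using kosD(3,4)[OF k] by blast
    qed
  qed
  show "kdiff V (\<lambda>v. pscale (var v)) \<eta> = \<omega>"
  proof (rule ext, rule poly_mapping_eqI)
    fix l b
    have "kdiff V (\<lambda>v p. var v * p) (khom (\<omega>' b)) l = lookup (\<omega> l) b" unfolding hom \<omega>'_def ..
    then show "lookup (kdiff V (\<lambda>v. pscale (var v)) \<eta> l) b = lookup (\<omega> l) b"
      by (simp add: kdiff_def Poly_Mapping.lookup_sum \<eta>)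
  qed
qed

section \<open>Graded Betti numbers and Koszul homology\<close>

lemma var_polys: "v \<in> V \<Longrightarrow> var v \<in> polys V"
  by (rule homog_polys) (rule var_homog)

lemma (in graded_module) subgroup_set_comp: "subgroup_set (M j)"
  by (rule subgroup_setI) (metis comp_zero, metis diff_conv_add_uminus comp_add comp_uminus)

lemma const_homog: "Poly_Mapping.single 0 a \<in> homog V 0"
  by (auto simp: homog_def polys_def)

lemma (in graded_module) eq_uminus_imp_zero:
  assumes "(2 :: 'k) \<noteq> 0" "x \<in> graded_carrier M" "x = - x"
  shows "x = 0"
proof -
  have c: "Poly_Mapping.single 0 a \<in> polys V" for a :: 'k by (rule homog_polys) (rule const_homog)
  have "(1 + 1 :: ('v, 'k) mpoly) = Poly_Mapping.single 0 2"
    by (simp only: Poly_Mapping.single_one[symmetric] Poly_Mapping.single_add[symmetric] one_add_one)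
  then have "Poly_Mapping.single 0 (inverse 2) * (1 + 1) = (1 :: ('v, 'k) mpoly)"
    using assms(1) by (simp only: Poly_Mapping.mult_single) simp
  then have "x = act (Poly_Mapping.single 0 (inverse 2) * (1 + 1)) x"
    using assms(2) by (simp add: act_one)
  also have "\<dots> = act (Poly_Mapping.single 0 (inverse 2)) (act 1 x + act 1 x)"
    using assms(2) by (simp only: act_mult[OF c polys_add[OF polys_one polys_one]] act_add_left[OF polys_one polys_one])
  also have "act 1 x + act 1 x = 0" using assms(2) add.right_inverse[of x] assms(3) by (simp add: act_one)
  finally show ?thesis by (simp add: act_zero_right c)
qed

lemma poly_mapping_uminus_eq:
  fixes f :: "'b \<Rightarrow>\<^sub>0 ('v, 'k::comm_ring_1) mpoly"
  assumes "(2 :: 'k) = 0"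
  shows "- f = f"
proof (rule poly_mapping_eqI, rule poly_mapping_eqI)
  fix b m
  have "lookup (lookup f b) m + lookup (lookup f b) m = 0"
    using assms by (metis mult_2 mult_zero_left)
  then show "lookup (lookup (- f) b) m = lookup (lookup f b) m"
    by (simp add: add_eq_0_iff)
qed

section \<open>Lifting Koszul forms through linear maps\<close>

context graded_module
begin

context
  fixes B :: "'b set" and d :: "'b \<Rightarrow> int" and g :: "'b \<Rightarrow> 'm"
  assumes g: "\<And>b. b \<in> B \<Longrightarrow> g b \<in> M (d b)"
begin

lemma lin_uminus:
  assumes "f \<in> free_carrier V B"
  shows "lin act g (- f) = - lin act g f"
proof -
  have "- f \<in> free_carrier V B"
    using assms by (auto simp: free_carrier_def polys_uminus)
  then have "lin act g (- f + f) = lin act g (- f) + lin act g f" using assms by (intro lin_add[OF g])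
  moreover have "lin act g 0 = 0" by (simp add: lin_def)
  ultimately show ?thesis by (simp add: eq_neg_iff_add_eq_0)
qed

lemma lin_homogeneous_preimage:
  assumes h: "h \<in> free_carrier V B" and x: "lin act g h \<in> M j"
  obtains h' where "h' \<in> free_comp V B d j" "lin act g h' = lin act g h"
proof -
  obtain J f where J: "finite J" "\<And>j. j \<in> J \<Longrightarrow> f j \<in> free_comp V B d j" "h = (\<Sum>j\<in>J. f j)"
    by (rule free_decomp[OF h, where d = d]) blast
  define f' where "f' j = (if j \<in> J then f j else 0)" for j
  \<comment> \<open>The degree \<open>j\<close> need not occur in the decomposition of
    \<open>h\<close>. It is added with component 0 so that \<open>indep\<close> can be applied at
    \<open>j\<close>.\<close>
  define J' where "J' = insert j J"
  have f': "f' i \<in> free_comp V B d i" for i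
    using J(2) by (auto simp: f'_def free_comp_def)
  have h_eq: "h = (\<Sum>i\<in>J'. f' i)"
    unfolding J(3) J'_def f'_def using J(1) by (intro sum.mono_neutral_cong_left) auto
  have J': "finite J'" "j \<in> J'" using J(1) by (auto simp: J'_def)
  define z where "z i = lin act g (f' i) - (if i = j then lin act g h else 0)" for i
  have "lin act g h = (\<Sum>i\<in>J'. lin act g (f' i))"
    unfolding h_eq by (rule lin_sum[where d = d and B = B]) (simp_all add: g free_comp_carrier[OF f'])
  then have "(\<Sum>i\<in>J'. z i) = 0"
    using J' by (simp add: z_def sum_subtractf)
  moreover have "z i \<in> M i" for i
    unfolding z_def using x lin_comp[OF g f', of i]
    by (auto intro: subgroup_set_diff[OF subgroup_set_comp] comp_zero)
  ultimately have "z j = 0" using indep[of J' z j] J' by blast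
  then show thesis using that[OF f'[of j]] by (simp add: z_def)
qed

lemma kos_lin_lift:
  assumes \<omega>: "\<omega> \<in> kos V q (M e)" and ran: "\<And>l. \<omega> l \<in> lin act g ` free_carrier V B"
  shows "\<exists>\<eta>\<in>kos V q (free_comp V B d e). \<omega> = (\<lambda>l. lin act g (\<eta> l))"
proof -
  define C where "C = M e \<inter> lin act g ` free_carrier V B"
  have neg: "- f \<in> free_carrier V B" if "f \<in> free_carrier V B" for f :: "'b \<Rightarrow>\<^sub>0 ('v, 'k) mpoly"
    using that by (auto simp: free_carrier_def polys_uminus)
  have C: "subgroup_set C"
  proof (rule subgroup_setI)
    have "0 = lin act g 0" by (simp add: lin_def)
    then show "0 \<in> C" using comp_zero free_carrier_zero unfolding C_def by blast
  next
    fix x y assume "x \<in> C" "y \<in> C"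
    then obtain f h where f: "f \<in> free_carrier V B" "x = lin act g f"
      and h: "h \<in> free_carrier V B" "y = lin act g h" and M: "x \<in> M e" "y \<in> M e"
      by (auto simp: C_def)
    have "x - y = lin act g (f + - h)"
      using f h neg[of h] by (simp only: lin_add[OF g] lin_uminus) simp
    moreover have "f + - h \<in> free_carrier V B" using f h by (intro free_carrier_add neg)
    moreover have "x - y \<in> M e" using M by (rule subgroup_set_diff[OF subgroup_set_comp])
    ultimately show "x - y \<in> C" unfolding C_def by blast
  qed
  have "(\<forall>x\<in>C. x = - x \<longrightarrow> x = 0) \<or> (\<forall>y\<in>(free_comp V B d e :: ('b \<Rightarrow>\<^sub>0 ('v, 'k) mpoly) set). - y = y)"
  proof (cases "(2 :: 'k) = 0")
    case True
    then show ?thesis by (simp add: poly_mapping_uminus_eq)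
  next
    case False
    then show ?thesis using eq_uminus_imp_zero comp_carrier by (auto simp: C_def)
  qed
  moreover have "\<omega> \<in> kos V q C"
    using kosD(2)[OF \<omega>] ran by (intro kos_mono[OF \<omega>]) (simp add: C_def)
  moreover have "\<exists>y\<in>free_comp V B d e. lin act g y = x" if "x \<in> C" for x
  proof -
    obtain h where "h \<in> free_carrier V B" "x = lin act g h" "x \<in> M e" using \<open>x \<in> C\<close> by (auto simp: C_def)
    then show ?thesis using lin_homogeneous_preimage[of h e] by metis
  qed
  ultimately obtain \<eta> where "\<eta> \<in> kos V q (free_comp V B d e)" "\<And>l. lin act g (\<eta> l) = \<omega> l"
    using C lin_uminus[OF free_comp_carrier, of _ d e]
    by (elim kos_lift[where \<phi> = "lin act g", OF _ C subgroup_set_free_comp]) (auto simp: lin_def)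
  then show ?thesis by (intro bexI[of _ \<eta>]) auto
qed

lemma kos_lin:
  assumes "\<omega> \<in> kos V q (free_comp V B d e)"
  shows "(\<lambda>l. lin act g (\<omega> l)) \<in> kos V q (M e)"
  using assms by (rule kos_compose) (simp_all add: lin_def[of act g 0] lin_uminus free_comp_carrier lin_comp[OF g])

lemma lin_kdiff:
  assumes "\<omega> \<in> kos V q (free_comp V B d e)"
  shows "lin act g (kdiff V (\<lambda>v. pscale (var v)) \<omega> l) = kdiff V (\<lambda>v. act (var v)) (\<lambda>l. lin act g (\<omega> l)) l"
proof -
  have c: "\<omega> l \<in> free_carrier V B" for l by (rule free_comp_carrier) (rule kosD(2)[OF assms])
  have "lin act g (kdiff V (\<lambda>v. pscale (var v)) \<omega> l) = (\<Sum>v\<in>V. lin act g (pscale (var v) (\<omega> (v # l))))"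
    unfolding kdiff_def by (rule lin_sum[where d = d and B = B]) (simp_all add: g free_carrier_pscale var_polys c)
  then show ?thesis by (simp add: kdiff_def lin_pscale[OF g] var_polys c cong: sum.cong)
qed

end

end

lemma kdiff_free_comp:
  fixes \<omega> :: "'v list \<Rightarrow> 'b \<Rightarrow>\<^sub>0 ('v, 'k::field) mpoly"
  assumes "finite V" "\<omega> \<in> kos V (Suc q) (free_comp V B d e)"
  shows "kdiff V (\<lambda>v. pscale (var v)) \<omega> \<in> kos V q (free_comp V B d (e + 1))"
proof -
  interpret commuting_action V "\<lambda>v. pscale (var v) :: ('b \<Rightarrow>\<^sub>0 ('v, 'k) mpoly) \<Rightarrow> _"
    by (rule commuting_action_pscale[OF assms(1)])
  interpret L: graded_module V pscale "free_comp V B d :: int \<Rightarrow> ('b \<Rightarrow>\<^sub>0 ('v, 'k) mpoly) set"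
    by (rule graded_module_free)
  show ?thesis
    using L.act_comp[OF var_homog] by (intro kdiff_kos_stable[OF assms(2)] subgroup_set_free_comp) (subst add.commute)
qed

section \<open>Comparison of a free resolution with the Koszul complex\<close>

lemma const_coeff_mult: "lookup (p * q) 0 = lookup p 0 * lookup q 0"
  for p :: "('v, 'k::comm_ring_1) mpoly"
proof -
  have *: "lookup (Poly_Mapping.single u c * q) 0 = (if u = 0 then c * lookup q 0 else 0)" for u and c :: 'k
  proof (cases "u = 0")
    case True
    then show ?thesis using lookup_single_mult_add[of 0 c q 0] by simp
  next
    case False
    then have "u + m' \<noteq> 0" for m' by (metis keys_add_nat Un_empty keys_eq_empty)
    then show ?thesis using False by (simp add: lookup_single_mult)
  qed
  show ?thesis
    by (subst poly_sum_singles[of p]) (simp add: sum_distrib_right Poly_Mapping.lookup_sum * Poly_Mapping.in_keys_iff)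
qed

text \<open>Reduction of a free module modulo the ideal of the indeterminates, that is, the map from
  F to its tensor product with K.\<close>

definition const_part :: "('b \<Rightarrow>\<^sub>0 ('v, 'k::zero) mpoly) \<Rightarrow> ('b \<Rightarrow>\<^sub>0 'k)" where
  "const_part = Poly_Mapping.map (\<lambda>p. lookup p 0)"

lemma lookup_const_part [simp]: "lookup (const_part f) b = lookup (lookup f b) 0"
  by (simp add: const_part_def Poly_Mapping.map.rep_eq when_def)

lemma diff_tensor_const_part:
  "const_part (lin pscale (diff F i) h) = diff_tensor F i (const_part h)"
proof (rule poly_mapping_eqI)
  fix b
  have "lookup (diff_tensor F i (const_part h)) b =
      (\<Sum>x\<in>keys (const_part h). lookup (lookup h x) 0 * lookup (lookup (diff F i x) b) 0)"
    by (simp add: diff_tensor_def lin_def Poly_Mapping.lookup_sum const_part_def[symmetric])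
  also have "\<dots> = (\<Sum>x\<in>keys h. lookup (lookup h x) 0 * lookup (lookup (diff F i x) b) 0)"
    by (rule sum.mono_neutral_left) (auto simp: Poly_Mapping.in_keys_iff)
  finally show "lookup (const_part (lin pscale (diff F i) h)) b = lookup (diff_tensor F i (const_part h)) b"
    by (simp add: lin_def Poly_Mapping.lookup_sum const_coeff_mult)
qed

text \<open>The chase takes place in the double complex of Koszul forms of degree \<open>q\<close>
  with coefficients in the free module of degree \<open>p\<close>, along the antidiagonal
  \<open>q + p = i\<close>. The last two premises say that \<open>f\<close> fits into a zigzag on
  both sides; the conclusion splits it into a Koszul part and a resolution part. The induction moves
  towards \<open>p = 0\<close>, where the augmentation brings in \<open>van\<close>. Koszul
  generators have degree 1, so coefficients live in degree \<open>j - q\<close>.\<close>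

lemma (in graded_module) resolution_koszul_zigzag:
  fixes F :: "('b, 'v, 'k, 'm) free_complex" and i :: nat and j :: int
  assumes V: "finite V" and F: "graded_free_resolution V act M F"
    and van: "\<And>\<omega>. \<omega> \<in> kos V i (M (j - int i)) \<Longrightarrow> kdiff V (\<lambda>v. act (var v)) \<omega> = 0 \<Longrightarrow>
      \<exists>\<eta>\<in>kos V (Suc i) (M (j - int i - 1)). kdiff V (\<lambda>v. act (var v)) \<eta> = \<omega>"
  defines "\<delta> \<equiv> kdiff V (\<lambda>v. pscale (var v))" and "D \<equiv> \<lambda>p. lin pscale (diff F p)"
    and "C \<equiv> \<lambda>p e. free_comp V (basis F p) (bdeg F p) e"
  shows "q + p = i \<Longrightarrow> f \<in> kos V q (C p (j - int q)) \<Longrightarrow>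
    q = 0 \<or> (\<exists>g\<in>kos V (q - 1) (C (Suc p) (j - int q + 1)). \<delta> f = (\<lambda>l. D (Suc p) (g l))) \<Longrightarrow>
    p = 0 \<or> (\<exists>f1\<in>kos V (Suc q) (C (p - 1) (j - int q - 1)). \<delta> f1 = (\<lambda>l. D p (f l))) \<Longrightarrow>
    \<exists>g\<in>kos V (Suc q) (C p (j - int q - 1)). \<exists>h\<in>kos V q (C (Suc p) (j - int q)).
    f = \<delta> g + (\<lambda>l. D (Suc p) (h l))"
proof -
  have aug: "aug F b \<in> M (bdeg F 0 b)" if "b \<in> basis F 0" for b
    using F that by (simp add: graded_free_resolution_def)
  have diff: "diff F (Suc p) b \<in> C p (bdeg F (Suc p) b)" if "b \<in> basis F (Suc p)" for b p
    using F that by (simp add: graded_free_resolution_def C_def)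
  have surj: "lin act (aug F) ` free_carrier V (basis F 0) = graded_carrier M"
    using F by (simp add: graded_free_resolution_def)
  have ex0: "D (Suc 0) ` free_carrier V (basis F (Suc 0)) =
      {f \<in> free_carrier V (basis F 0). lin act (aug F) f = 0}"
    using F by (simp add: graded_free_resolution_def D_def)
  have exS: "D (Suc (Suc p)) ` free_carrier V (basis F (Suc (Suc p))) =
      {f \<in> free_carrier V (basis F (Suc p)). D (Suc p) f = 0}" for p
    using F by (simp add: graded_free_resolution_def D_def)
  interpret L: graded_module V pscale "C p" for p
    unfolding C_def by (rule graded_module_free)
  interpret K: commuting_action V "\<lambda>v. pscale (var v) :: ('b \<Rightarrow>\<^sub>0 ('v, 'k) mpoly) \<Rightarrow> _"
    by (rule commuting_action_pscale[OF V])
  have car: "\<omega> l \<in> free_carrier V (basis F p)" if "\<omega> \<in> kos V q (C p e)" for \<omega> l p q e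
    using kosD(2)[OF that] by (auto simp: C_def dest: free_comp_carrier)
  have \<delta>_kos: "\<delta> \<omega> \<in> kos V q (C p (e + 1))" if "\<omega> \<in> kos V (Suc q) (C p e)" for \<omega> p q e
    using that unfolding \<delta>_def C_def by (rule kdiff_free_comp[OF V])
  have D_kos: "(\<lambda>l. D (Suc p) (\<omega> l)) \<in> kos V q (C p e)" if "\<omega> \<in> kos V q (C (Suc p) e)" for \<omega> p q e
    unfolding D_def by (rule L.kos_lin[OF diff]) (use that in \<open>auto simp: C_def\<close>)
  have D\<delta>: "D (Suc p) (\<delta> \<omega> l) = \<delta> (\<lambda>l. D (Suc p) (\<omega> l)) l" if "\<omega> \<in> kos V q (C (Suc p) e)" for \<omega> p q e l
    unfolding D_def \<delta>_def by (rule L.lin_kdiff[OF diff]) (use that in \<open>auto simp: C_def\<close>)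
  have \<delta>\<delta>: "\<delta> (\<delta> \<omega>) = 0" if "\<omega> \<in> kos V q (C p e)" for \<omega> p q e
    unfolding \<delta>_def by (rule K.kdiff_kdiff) (rule kosD(1)[OF that])
  have DD: "D (Suc p) (D (Suc (Suc p)) x) = 0" if "x \<in> free_carrier V (basis F (Suc (Suc p)))" for p x
    using exS[of p] that by blast
  have D_diff: "D (Suc p) (x - y) = D (Suc p) x - D (Suc p) y"
    if "x \<in> free_carrier V (basis F (Suc p))" "y \<in> free_carrier V (basis F (Suc p))" for p x y
  proof -
    have "- y \<in> free_carrier V (basis F (Suc p))" using that by (auto simp: free_carrier_def polys_uminus)
    then have "D (Suc p) (x + - y) = D (Suc p) x + D (Suc p) (- y)"
      unfolding D_def using that by (intro L.lin_add[OF diff]) auto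
    moreover have "D (Suc p) (- y) = - D (Suc p) y"
      unfolding D_def using that by (intro L.lin_uminus[OF diff]) auto
    ultimately show ?thesis by simp
  qed
  have lift: "\<exists>h\<in>kos V q (C (Suc p) e). \<omega> = (\<lambda>l. D (Suc p) (h l))"
    if \<omega>: "\<omega> \<in> kos V q (C p e)" and ran: "\<And>l. \<omega> l \<in> D (Suc p) ` free_carrier V (basis F (Suc p))" for \<omega> q p e
  proof -
    show ?thesis
      using L.kos_lin_lift[OF diff \<omega> ran[unfolded D_def]] unfolding D_def C_def .
  qed
  show "q + p = i \<Longrightarrow> f \<in> kos V q (C p (j - int q)) \<Longrightarrow>
    q = 0 \<or> (\<exists>g\<in>kos V (q - 1) (C (Suc p) (j - int q + 1)). \<delta> f = (\<lambda>l. D (Suc p) (g l))) \<Longrightarrow>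
    p = 0 \<or> (\<exists>f1\<in>kos V (Suc q) (C (p - 1) (j - int q - 1)). \<delta> f1 = (\<lambda>l. D p (f l))) \<Longrightarrow>
    \<exists>g\<in>kos V (Suc q) (C p (j - int q - 1)). \<exists>h\<in>kos V q (C (Suc p) (j - int q)).
      f = \<delta> g + (\<lambda>l. D (Suc p) (h l))"
  proof (induction p arbitrary: q f)
    case (0 q f)
    \<comment> \<open>The augmentation turns \<open>f\<close> into a Koszul cycle over the module, a
      boundary by \<open>van\<close>. Lifting its primitive to \<open>g\<close> makes
      \<open>f - \<delta> g\<close> augment to zero, so it comes from the next free module.\<close>
    define \<omega> where "\<omega> l = lin act (aug F) (f l)" for l
    have q: "q = i" using 0 by simp
    have f: "f \<in> kos V i (free_comp V (basis F 0) (bdeg F 0) (j - int i))" using 0(2) by (simp add: C_def q)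
    have \<omega>: "\<omega> \<in> kos V i (M (j - int i))" unfolding \<omega>_def[abs_def] by (rule kos_lin[OF aug f])
    have "kdiff V (\<lambda>v. act (var v)) \<omega> = 0"
      using 0(3)
    proof
      assume "q = 0"
      then show ?thesis using \<omega> by (intro kdiff_kos_0) (auto simp: q act_zero_right var_polys)
    next
      assume "\<exists>g\<in>kos V (q - 1) (C (Suc 0) (j - int q + 1)). \<delta> f = (\<lambda>l. D (Suc 0) (g l))"
      then obtain g where g: "g \<in> kos V (q - 1) (C (Suc 0) (j - int q + 1))" "\<delta> f = (\<lambda>l. D (Suc 0) (g l))" ..
      have "lin act (aug F) (D (Suc 0) (g l)) = 0" for l using car[OF g(1), of l] ex0 by blast
      then show ?thesis
        using lin_kdiff[OF aug f] g(2) by (intro ext) (simp add: \<omega>_def[abs_def] \<delta>_def)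
    qed
    then obtain \<eta> where \<eta>: "\<eta> \<in> kos V (Suc i) (M (j - int i - 1))" "kdiff V (\<lambda>v. act (var v)) \<eta> = \<omega>"
      using van[OF \<omega>] by blast
    have ran: "\<eta> l \<in> lin act (aug F) ` free_carrier V (basis F 0)" for l
      unfolding surj using kosD(2)[OF \<eta>(1)] by (rule comp_carrier)
    obtain g where g: "g \<in> kos V (Suc i) (free_comp V (basis F 0) (bdeg F 0) (j - int i - 1))"
        "\<eta> = (\<lambda>l. lin act (aug F) (g l))"
      using kos_lin_lift[OF aug \<eta>(1) ran] by blast
    have g': "g \<in> kos V (Suc q) (C 0 (j - int q - 1))" using g(1) by (simp add: C_def q)
    have \<delta>g: "\<delta> g \<in> kos V q (C 0 (j - int q))" using \<delta>_kos[OF g'] by simp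
    have "lin act (aug F) (\<delta> g l) = \<omega> l" for l
      using lin_kdiff[OF aug g(1), of l] g(2) \<eta>(2) by (simp add: \<delta>_def)
    moreover have fg: "f - \<delta> g \<in> kos V q (C 0 (j - int q))"
      using 0(2) \<delta>g by (intro kos_diff L.subgroup_set_comp)
    moreover have "lin act (aug F) (f l - \<delta> g l) = lin act (aug F) (f l) - lin act (aug F) (\<delta> g l)" for l
    proof -
      have "- \<delta> g l \<in> free_carrier V (basis F 0)"
        using car[OF \<delta>g, of l] by (auto simp: free_carrier_def polys_uminus)
      then have "lin act (aug F) (f l + - \<delta> g l) = lin act (aug F) (f l) + lin act (aug F) (- \<delta> g l)"
        using car[OF 0(2)] by (intro lin_add[OF aug]) auto
      then show ?thesis using lin_uminus[OF aug car[OF \<delta>g]] by simp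
    qed
    ultimately have "(f - \<delta> g) l \<in> D (Suc 0) ` free_carrier V (basis F (Suc 0))" for l
      unfolding ex0 using car[OF fg, of l] by (simp add: \<omega>_def)
    then obtain h where "h \<in> kos V q (C (Suc 0) (j - int q))" "f - \<delta> g = (\<lambda>l. D (Suc 0) (h l))"
      using lift[OF fg] by blast
    then show ?case using g' by (intro bexI[of _ g] bexI[of _ h]) (simp_all add: algebra_simps)
  next
    case (Suc p q f)
    have f: "f \<in> kos V q (C (Suc p) (j - int q))" by fact
    obtain f1 where f1: "f1 \<in> kos V (Suc q) (C p (j - int (Suc q)))" "\<delta> f1 = (\<lambda>l. D (Suc p) (f l))"
      using Suc.prems(4) by (auto simp: algebra_simps)
    have "\<exists>g\<in>kos V (Suc (Suc q)) (C p (j - int (Suc q) - 1)). \<exists>h\<in>kos V (Suc q) (C (Suc p) (j - int (Suc q))).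
        f1 = \<delta> g + (\<lambda>l. D (Suc p) (h l))"
    proof (rule Suc.IH[OF _ f1(1)])
      show "Suc q + p = i" using Suc.prems(1) by simp
      show "Suc q = 0 \<or> (\<exists>g\<in>kos V (Suc q - 1) (C (Suc p) (j - int (Suc q) + 1)). \<delta> f1 = (\<lambda>l. D (Suc p) (g l)))"
        using f f1(2) by (intro disjI2 bexI[of _ f]) simp_all
      \<comment> \<open>\<open>D f1\<close> is a Koszul cycle because applying
        \<open>\<delta>\<close> to it gives \<open>D (D f) = 0\<close>. Its homological degree is
        positive, so no constant term obstructs acyclicity.\<close>
      show "p = 0 \<or> (\<exists>f2\<in>kos V (Suc (Suc q)) (C (p - 1) (j - int (Suc q) - 1)). \<delta> f2 = (\<lambda>l. D p (f1 l)))"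
      proof (cases p)
        case (Suc p')
        have Df1: "(\<lambda>l. D p (f1 l)) \<in> kos V (Suc q) (C p' (j - int (Suc q)))"
          using D_kos[of f1 "Suc q" p'] f1(1) by (simp add: Suc)
        have "\<delta> (\<lambda>l. D p (f1 l)) = 0"
        proof
          fix l
          have "\<delta> (\<lambda>l. D p (f1 l)) l = D p (D (Suc p) (f l))"
            using D\<delta>[of f1 "Suc q" p'] f1 by (simp add: Suc)
          then show "\<delta> (\<lambda>l. D p (f1 l)) l = 0 l" using DD[of "f l" p'] car[OF f] by (simp add: Suc)
        qed
        moreover have "D p (f1 []) = 0" using kosD(3)[OF Df1, of "[]"] by auto
        ultimately obtain f2 where "f2 \<in> kos V (Suc (Suc q)) (C p' (j - int (Suc q) - 1))" "\<delta> f2 = (\<lambda>l. D p (f1 l))"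
          using koszul_acyclic_free[OF V Df1[unfolded C_def]] unfolding \<delta>_def C_def by (metis Poly_Mapping.lookup_zero)
        then show ?thesis by (auto simp: Suc)
      qed simp
    qed
    then obtain g1 h1 where g1: "g1 \<in> kos V (Suc (Suc q)) (C p (j - int (Suc q) - 1))"
      and h1: "h1 \<in> kos V (Suc q) (C (Suc p) (j - int (Suc q)))" and eq: "f1 = \<delta> g1 + (\<lambda>l. D (Suc p) (h1 l))"
      by blast
    \<comment> \<open>From \<open>\<delta> f1 = D f\<close> and the splitting of \<open>f1\<close>
      one gets \<open>D f = D (\<delta> h1)\<close>. Exactness of the resolution then expresses
      \<open>f - \<delta> h1\<close> through the next differential.\<close>
    have "\<delta> f1 = \<delta> (\<lambda>l. D (Suc p) (h1 l))"
      unfolding eq using \<delta>\<delta>[OF g1] K.kdiff_add[of "\<delta> g1" "\<lambda>l. D (Suc p) (h1 l)"] by (simp add: \<delta>_def)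
    then have *: "D (Suc p) (f l) = D (Suc p) (\<delta> h1 l)" for l
      using f1(2) D\<delta>[OF h1, of l] by metis
    have \<delta>h1: "\<delta> h1 \<in> kos V q (C (Suc p) (j - int q))" using \<delta>_kos[OF h1] by simp
    have fh: "f - \<delta> h1 \<in> kos V q (C (Suc p) (j - int q))"
      using f \<delta>h1 by (intro kos_diff L.subgroup_set_comp)
    have "(f - \<delta> h1) l \<in> D (Suc (Suc p)) ` free_carrier V (basis F (Suc (Suc p)))" for l
      unfolding exS using car[OF fh, of l] * car[OF f] car[OF \<delta>h1] by (simp add: D_diff)
    then obtain h where "h \<in> kos V q (C (Suc (Suc p)) (j - int q))" "f - \<delta> h1 = (\<lambda>l. D (Suc (Suc p)) (h l))"
      using lift[OF fh] by blast
    then show ?case using h1 by (intro bexI[of _ h1] bexI[of _ h]) (simp_all add: algebra_simps)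
  qed
qed

text \<open>A Tor cycle, read as an element with constant coefficients, has a differential without
  constant terms. Koszul acyclicity of the free module writes that differential as a Koszul
  boundary, so the zigzag starts at \<open>q = 0\<close>, \<open>p = i\<close>. Modulo the
  indeterminates the Koszul part of the resulting splitting disappears, and the resolution part is a
  boundary.\<close>

lemma (in graded_module) tor_cycles_subset_boundaries:
  fixes F :: "('b, 'v, 'k, 'm) free_complex" and i :: nat and j :: int
  assumes V: "finite V" and F: "graded_free_resolution V act M F"
    and van: "\<And>\<omega>. \<omega> \<in> kos V i (M (j - int i)) \<Longrightarrow> kdiff V (\<lambda>v. act (var v)) \<omega> = 0 \<Longrightarrow>
      \<exists>\<eta>\<in>kos V (Suc i) (M (j - int i - 1)). kdiff V (\<lambda>v. act (var v)) \<eta> = \<omega>"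
  shows "tor_cycles F i j \<subseteq> tor_boundaries F i j"
proof
  fix f assume f: "f \<in> tor_cycles F i j"
  define C where "C p e = (free_comp V (basis F p) (bdeg F p) e :: ('b \<Rightarrow>\<^sub>0 ('v, 'k) mpoly) set)" for p e
  define h :: "'b \<Rightarrow>\<^sub>0 ('v, 'k) mpoly" where "h = Poly_Mapping.map (Poly_Mapping.single 0) f"
  have h: "lookup h b = Poly_Mapping.single 0 (lookup f b)" for b
    by (simp add: h_def Poly_Mapping.map.rep_eq when_def)
  have const_h: "const_part h = f" by (rule poly_mapping_eqI) (simp add: h)
  have h0: "lookup h b = 0 \<longleftrightarrow> lookup f b = 0" for b
    unfolding h
  proof
    assume "Poly_Mapping.single 0 (lookup f b) = (0 :: ('v, 'k) mpoly)"
    then have "lookup (Poly_Mapping.single 0 (lookup f b)) (0 :: 'v \<Rightarrow>\<^sub>0 nat) = lookup 0 (0 :: 'v \<Rightarrow>\<^sub>0 nat)"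
      by (rule arg_cong)
    then show "lookup f b = 0" by simp
  qed simp
  have keys_h: "keys h = keys f" by (rule set_eqI) (simp only: Poly_Mapping.in_keys_iff h0)
  have f_keys: "b \<in> basis F i" "bdeg F i b = j" if "b \<in> keys f" for b
    using f that by (auto simp: tor_cycles_def tensor_comp_def)
  have hC: "h \<in> C i j"
    unfolding C_def free_comp_def
  proof (intro CollectI conjI allI)
    show "keys h \<subseteq> basis F i" using f_keys by (auto simp: keys_h)
    show "lookup h b \<in> homog V (j - bdeg F i b)" for b
      using f_keys(2)[of b] const_homog[of "lookup f b"] by (cases "b \<in> keys f") (auto simp: h Poly_Mapping.in_keys_iff)
  qed
  define \<omega> where "\<omega> l = (if l = [] then h else 0)" for l :: "'v list"
  have zero: "0 \<in> C p e" for p e by (simp add: C_def free_comp_def)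
  have \<omega>: "\<omega> \<in> kos V 0 (C i (j - int 0))"
    unfolding kos_0_iff \<omega>_def[abs_def] using hC zero by auto
  have "i = 0 \<or> (\<exists>f1\<in>kos V (Suc 0) (C (i - 1) (j - int 0 - 1)).
      kdiff V (\<lambda>v. pscale (var v)) f1 = (\<lambda>l. lin pscale (diff F i) (\<omega> l)))"
  proof (cases i)
    case (Suc p)
    interpret L: graded_module V pscale "C p"
      unfolding C_def by (rule graded_module_free)
    have diff: "diff F (Suc p) b \<in> C p (bdeg F (Suc p) b)" if "b \<in> basis F (Suc p)" for b
      using F that by (simp add: graded_free_resolution_def C_def)
    have D\<omega>: "(\<lambda>l. lin pscale (diff F (Suc p)) (\<omega> l)) \<in> kos V 0 (C p j)"
      by (rule L.kos_lin[OF diff]) (use \<omega> in \<open>auto simp: C_def Suc\<close>)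
    moreover have "kdiff V (\<lambda>v. pscale (var v)) (\<lambda>l. lin pscale (diff F (Suc p)) (\<omega> l)) = 0"
      by (rule kdiff_kos_0[OF D\<omega>]) simp
    moreover have "lookup (lookup (lin pscale (diff F (Suc p)) (\<omega> [])) b) 0 = 0" for b
    proof -
      have "const_part (lin pscale (diff F (Suc p)) h) = 0"
        using f by (simp add: diff_tensor_const_part const_h tor_cycles_def Suc)
      then show ?thesis using lookup_const_part[of "lin pscale (diff F (Suc p)) h" b] by (simp add: \<omega>_def)
    qed
    ultimately obtain f1 where "f1 \<in> kos V (Suc 0) (C p (j - 1))"
        "kdiff V (\<lambda>v. pscale (var v)) f1 = (\<lambda>l. lin pscale (diff F (Suc p)) (\<omega> l))"
      using koszul_acyclic_free[OF V] unfolding C_def by metis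
    then show ?thesis by (auto simp: Suc)
  qed simp
  then obtain g \<eta> where g: "g \<in> kos V (Suc 0) (C i (j - int 0 - 1))" and \<eta>: "\<eta> \<in> kos V 0 (C (Suc i) (j - int 0))"
    and eq: "\<omega> = kdiff V (\<lambda>v. pscale (var v)) g + (\<lambda>l. lin pscale (diff F (Suc i)) (\<eta> l))"
    using resolution_koszul_zigzag[OF V F van, of 0 i \<omega>] \<omega> unfolding C_def by auto
  have "const_part h = const_part (kdiff V (\<lambda>v. pscale (var v)) g []) + const_part (lin pscale (diff F (Suc i)) (\<eta> []))"
    using fun_cong[OF eq, of "[]"] by (intro poly_mapping_eqI) (simp add: \<omega>_def Poly_Mapping.lookup_add)
  moreover have "const_part (kdiff V (\<lambda>v. pscale (var v)) g []) = 0"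
    by (rule poly_mapping_eqI) (simp add: kdiff_def Poly_Mapping.lookup_sum lookup_var_mult_0)
  ultimately have "f = diff_tensor F (Suc i) (const_part (\<eta> []))"
    by (simp add: const_h diff_tensor_const_part)
  moreover have "const_part (\<eta> []) \<in> tensor_comp F (Suc i) j"
    unfolding tensor_comp_def
  proof (rule CollectI, rule subsetI)
    fix b assume "b \<in> keys (const_part (\<eta> []))"
    then have b: "0 \<in> keys (lookup (\<eta> []) b)" by (simp add: Poly_Mapping.in_keys_iff)
    have "\<eta> [] \<in> C (Suc i) j" using kosD(2)[OF \<eta>] by simp
    moreover have "b \<in> keys (\<eta> [])" using b by (auto simp: Poly_Mapping.in_keys_iff)
    ultimately show "b \<in> {b \<in> basis F (Suc i). bdeg F (Suc i) b = j}"
      using b by (force simp: C_def free_comp_def homog_def)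
  qed
  ultimately show "f \<in> tor_boundaries F i j" unfolding tor_boundaries_def by blast
qed

lemma dim_quotient_eq_0: "Z \<subseteq> W \<Longrightarrow> dim_quotient Z W = 0"
proof -
  assume "Z \<subseteq> W"
  then have "enat 0 \<in> {enat (card C) | C. finite C \<and> C \<subseteq> Z \<and> Z \<subseteq> pscale_module.span (C \<union> W)}"
    using pscale_module.span_superset[of W] by (intro CollectI exI[of _ "{}"]) auto
  then have "dim_quotient Z W \<le> enat 0" unfolding dim_quotient_def by (rule Inf_lower)
  then show ?thesis by (simp flip: zero_enat_def)
qed

theorem (in graded_module) betti_eq_0:
  assumes "finite V"
    and "\<And>\<omega>. \<omega> \<in> kos V i (M (j - int i)) \<Longrightarrow> kdiff V (\<lambda>v. act (var v)) \<omega> = 0 \<Longrightarrow>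
      \<exists>\<eta>\<in>kos V (Suc i) (M (j - int i - 1)). kdiff V (\<lambda>v. act (var v)) \<eta> = \<omega>"
  shows "betti V act M i j = 0"
proof -
  have "graded_free_resolution V act M (resolution V act M)"
    unfolding resolution_def using graded_free_resolution_exists by (rule someI_ex)
  from tor_cycles_subset_boundaries[OF assms(1) this assms(2)] show ?thesis
    unfolding betti_def by (rule dim_quotient_eq_0)
qed

section \<open>Koszul cycles of a power of the maximal ideal\<close>

definition smul :: "'a::times \<Rightarrow> ('b \<Rightarrow> 'a) \<Rightarrow> 'b \<Rightarrow> 'a" where
  "smul p z = (\<lambda>m. p * z m)"

lemma smul_apply [simp]: "smul p z m = p * z m"
  by (simp add: smul_def)

lemma smul_zero [simp]: "smul p 0 = 0" for p :: "'a::comm_ring_1"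
  by (rule ext) simp

lemma smul_one [simp]: "smul 1 z = z" for z :: "'b \<Rightarrow> 'a::comm_ring_1"
  by (rule ext) simp

lemma smul_diff: "smul p (z - w) = smul p z - smul p w" for p :: "'a::comm_ring_1"
  by (rule ext) (simp add: algebra_simps)

lemma smul_uminus: "smul p (- z) = - smul p z" for p :: "'a::comm_ring_1"
  by (rule ext) simp

lemma smul_sum: "smul p (sum f I) = (\<Sum>i\<in>I. smul p (f i))" for p :: "'a::comm_ring_1"
  by (rule ext) (simp add: sum_fun_apply sum_distrib_left)

lemma smul_smul: "smul p (smul q z) = smul (p * q) z" for p :: "'a::comm_ring_1"
  by (rule ext) (simp add: mult.assoc)

lemma smul_left_commute: "smul p (smul q z) = smul q (smul p z)" for p :: "'a::comm_ring_1"
  by (simp add: smul_smul mult.commute)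

lemma commuting_action_smul:
  "finite G \<Longrightarrow> commuting_action G (\<lambda>v. smul (\<phi> v :: 'a::comm_ring_1) :: ('b \<Rightarrow> 'a) \<Rightarrow> _)"
  by unfold_locales (auto simp: smul_diff intro: smul_left_commute)

lemma exponents_list:
  obtains l where "exponents l = u" "length l = mdeg u" "set l = keys (u :: 'v \<Rightarrow>\<^sub>0 nat)"
proof -
  have "\<exists>l. exponents l = u \<and> length l = mdeg u"
  proof (induction "mdeg u" arbitrary: u)
    case 0
    have "u = 0"
    proof (rule ccontr)
      assume "u \<noteq> 0"
      then obtain v where "v \<in> keys u" by fastforce
      then obtain u' where "u = u' + Poly_Mapping.single v 1" by (rule keys_nat_decomp)
      then show False using 0 by (simp add: mdeg_add)
    qed
    then show ?case by (intro exI[of _ "[]"]) simp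
  next
    case (Suc d)
    then have "keys u \<noteq> {}" by (auto simp: mdeg_def)
    then obtain v where "v \<in> keys u" by fastforce
    then obtain u' where u': "u = u' + Poly_Mapping.single v 1" by (rule keys_nat_decomp)
    then have "d = mdeg u'" using Suc.hyps(2) by (simp add: mdeg_add)
    then obtain l where "exponents l = u' \<and> length l = mdeg u'" using Suc.hyps(1) by blast
    then show ?case using u' by (intro exI[of _ "v # l"]) (simp add: mdeg_add add.commute)
  qed
  then show thesis using that keys_exponents by metis
qed

lemma finite_monomials: "finite (monomials n c)"
proof (rule finite_subset)
  show "monomials n c \<subseteq> exponents ` {l. set l \<subseteq> {1..n} \<and> length l = c}"
  proof
    fix u assume u: "u \<in> monomials n c"
    obtain l where "exponents l = u" "length l = mdeg u" "set l = keys u" by (rule exponents_list)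
    then show "u \<in> exponents ` {l. set l \<subseteq> {1..n} \<and> length l = c}"
      using u by (auto simp: monomials_def)
  qed
  show "finite (exponents ` {l. set l \<subseteq> {1..n} \<and> length l = c})"
    by (intro finite_imageI finite_lists_length_eq) simp
qed

lemma monomials_0: "0 \<in> monomials n 0"
  by (simp add: monomials_def)

lemma monomials_add: "u \<in> monomials n a \<Longrightarrow> w \<in> monomials n b \<Longrightarrow> u + w \<in> monomials n (a + b)"
  by (simp add: monomials_def keys_add_nat mdeg_add)

lemma monomials_single: "i \<in> {1..n} \<Longrightarrow> Poly_Mapping.single i 1 \<in> monomials n 1"
  by (simp add: monomials_def)

abbreviation mono_poly :: "('v \<Rightarrow>\<^sub>0 nat) \<Rightarrow> ('v, 'k::comm_ring_1) mpoly" where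
  "mono_poly u \<equiv> Poly_Mapping.single u 1"

lemma mono_poly_homog: "u \<in> monomials n e \<Longrightarrow> mono_poly u \<in> homog {1..n} (int e)"
  by (auto simp: monomials_def homog_def polys_def)

lemma mono_poly_add: "mono_poly (u + w) = mono_poly u * mono_poly w"
  by (simp add: Poly_Mapping.mult_single)

lemma var_eq_mono_poly: "var i = mono_poly (Poly_Mapping.single i 1)"
  by (simp add: var_def)

text \<open>\<open>kchains n c t d\<close> is the component of degree \<open>d\<close> of the Koszul complex of the monomials
  of degree \<open>c\<close>, whose generators have degree \<open>c\<close>.\<close>

definition bd :: "nat \<Rightarrow> nat \<Rightarrow> ((nat \<Rightarrow>\<^sub>0 nat) list \<Rightarrow> (nat, 'k::field) mpoly) \<Rightarrow> (nat \<Rightarrow>\<^sub>0 nat) list \<Rightarrow> (nat, 'k) mpoly" where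
  "bd n c = kdiff (monomials n c) (\<lambda>u p. mono_poly u * p)"

definition kchains :: "nat \<Rightarrow> nat \<Rightarrow> nat \<Rightarrow> int \<Rightarrow> ((nat \<Rightarrow>\<^sub>0 nat) list \<Rightarrow> (nat, 'k::field) mpoly) set" where
  "kchains n c t d = kos (monomials n c) t (homog {1..n} (d - int t * int c))"

definition kcycles :: "nat \<Rightarrow> nat \<Rightarrow> nat \<Rightarrow> int \<Rightarrow> ((nat \<Rightarrow>\<^sub>0 nat) list \<Rightarrow> (nat, 'k::field) mpoly) set" where
  "kcycles n c t d = {z \<in> kchains n c t d. bd n c z = 0}"

definition kbounds :: "nat \<Rightarrow> nat \<Rightarrow> nat \<Rightarrow> int \<Rightarrow> ((nat \<Rightarrow>\<^sub>0 nat) list \<Rightarrow> (nat, 'k::field) mpoly) set" where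
  "kbounds n c t d = bd n c ` kchains n c (Suc t) d"

text \<open>The second Koszul differential, for the indeterminates of S, with coefficients in chains
  for \<open>bd\<close>. Its homology with coefficients in a graded S-module is Tor over S with the
  residue field, which measures regularity.\<close>

definition dX :: "nat \<Rightarrow> (nat list \<Rightarrow> (nat \<Rightarrow>\<^sub>0 nat) list \<Rightarrow> (nat, 'k::field) mpoly) \<Rightarrow>
    nat list \<Rightarrow> (nat \<Rightarrow>\<^sub>0 nat) list \<Rightarrow> (nat, 'k) mpoly" where
  "dX n = kdiff {1..n} (\<lambda>i. smul (var i))"

interpretation bd: commuting_action "monomials n c" "\<lambda>u p. mono_poly u * (p :: (nat, 'k::field) mpoly)" for n c
  by (rule commuting_action_mult[OF finite_monomials])

interpretation dX: commuting_action "{1..n}"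
    "\<lambda>i. smul (var i) :: ((nat \<Rightarrow>\<^sub>0 nat) list \<Rightarrow> (nat, 'k::field) mpoly) \<Rightarrow> _" for n :: nat
  by (rule commuting_action_smul) simp

lemma bd_diff: "bd n c (z - w) = bd n c z - bd n c w"
  unfolding bd_def by (rule bd.kdiff_diff)

lemma bd_uminus: "bd n c (- z) = - bd n c z"
  unfolding bd_def by (rule bd.kdiff_uminus)

lemma bd_zero [simp]: "bd n c 0 = 0"
  unfolding bd_def by (rule bd.kdiff_zero)

lemma bd_sum: "bd n c (sum f I) = (\<Sum>i\<in>I. bd n c (f i))"
  unfolding bd_def by (rule bd.kdiff_sum)

lemma bd_smul: "bd n c (smul p z) = smul p (bd n c z)"
  by (rule ext) (simp add: bd_def kdiff_def sum_distrib_left mult.left_commute)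

lemma bd_wedge:
  "u \<in> monomials n c \<Longrightarrow> bd n c (wedge u z) = smul (mono_poly u) z - wedge u (bd n c z)"
  unfolding bd_def by (rule ext) (simp add: bd.kdiff_wedge)

lemma wedge_smul: "wedge u (smul p z) = smul p (wedge u z)" for p :: "'a::comm_ring_1"
  by (rule ext) (simp add: smul_def wedge_compose[of "\<lambda>x. p * x"] right_diff_distrib)

lemma wedge_fun_zero [simp]: "wedge u 0 = 0"
  by (rule ext) (simp add: zero_fun_def wedge_zero)

lemma wedge_fun_diff: "wedge u (z - w) = wedge u z - wedge u w"
  by (rule ext) (simp add: wedge_diff)

lemma subgroup_set_kchains: "subgroup_set (kchains n c t d)"
  unfolding kchains_def by (intro subgroup_set_kos subgroup_set_homog)

lemma subgroup_set_kcycles: "subgroup_set (kcycles n c t d)"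
  using subgroup_set_kchains[of n c t d]
  by (intro subgroup_setI) (auto simp: kcycles_def bd_diff intro: subgroup_set_zero subgroup_set_diff)

lemma subgroup_set_kbounds:
  "subgroup_set (kbounds n c t d :: ((nat \<Rightarrow>\<^sub>0 nat) list \<Rightarrow> (nat, 'k::field) mpoly) set)"
proof (rule subgroup_setI)
  show "0 \<in> kbounds n c t d"
    unfolding kbounds_def by (rule image_eqI[of _ _ 0]) (auto intro: subgroup_set_zero subgroup_set_kchains)
  fix x y :: "(nat \<Rightarrow>\<^sub>0 nat) list \<Rightarrow> (nat, 'k) mpoly"
  assume "x \<in> kbounds n c t d" "y \<in> kbounds n c t d"
  then obtain z w where "x = bd n c z" "y = bd n c w" "z \<in> kchains n c (Suc t) d" "w \<in> kchains n c (Suc t) d"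
    by (auto simp: kbounds_def)
  then show "x - y \<in> kbounds n c t d"
    unfolding kbounds_def
    by (intro image_eqI[of _ _ "z - w"]) (auto simp: bd_diff intro: subgroup_set_diff subgroup_set_kchains)
qed

lemma smul_kchains:
  assumes "p \<in> homog {1..n} e" "z \<in> kchains n c t d"
  shows "smul p z \<in> kchains n c t (e + d)"
  unfolding smul_def kchains_def
  using homog_mult[OF assms(1), of _ "d - int t * int c"]
  by (intro kos_compose[OF assms(2)[unfolded kchains_def]]) (simp_all add: algebra_simps)

lemma smul_kbounds:
  assumes "p \<in> homog {1..n} e" "z \<in> kbounds n c t d"
  shows "smul p z \<in> kbounds n c t (e + d)"
proof -
  obtain w where "z = bd n c w" "w \<in> kchains n c (Suc t) d" using assms(2) by (auto simp: kbounds_def)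
  then show ?thesis
    using smul_kchains[OF assms(1)] unfolding kbounds_def by (intro image_eqI[of _ _ "smul p w"]) (simp_all add: bd_smul)
qed

lemma wedge_kchains:
  assumes "u \<in> monomials n c" "z \<in> kchains n c t d"
  shows "wedge u z \<in> kchains n c (Suc t) (d + int c)"
proof -
  have "d + int c - int (Suc t) * int c = d - int t * int c" by (simp add: algebra_simps)
  then show ?thesis
    using assms unfolding kchains_def by (simp only:) (intro wedge_kos subgroup_set_homog)
qed

lemma bd_kchains: "z \<in> kchains n c (Suc t) d \<Longrightarrow> bd n c z \<in> kchains n c t d"
  unfolding kchains_def bd_def
proof (rule bd.kdiff_kos_stable)
  fix u and p :: "(nat, 'a) mpoly"
  assume "u \<in> monomials n c" "p \<in> homog {1..n} (d - int (Suc t) * int c)"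
  then have "mono_poly u * p \<in> homog {1..n} (int c + (d - int (Suc t) * int c))"
    by (intro homog_mult mono_poly_homog)
  also have "int c + (d - int (Suc t) * int c) = d - int t * int c" by (simp add: algebra_simps)
  finally show "mono_poly u * p \<in> homog {1..n} (d - int t * int c)" .
qed (assumption | rule subgroup_set_homog)+

lemma bd_bd: "z \<in> kchains n c t d \<Longrightarrow> bd n c (bd n c z) = 0"
  unfolding kchains_def bd_def by (intro bd.kdiff_kdiff) (rule kosD(1))

lemma bd_kcycles: "z \<in> kchains n c (Suc t) d \<Longrightarrow> bd n c z \<in> kcycles n c t d"
  by (simp add: kcycles_def bd_kchains bd_bd)

lemma bd_kchains_0: "z \<in> kchains n c 0 d \<Longrightarrow> bd n c z = 0"
  unfolding kchains_def bd_def by (rule kdiff_kos_0) auto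

lemma kcycles_0: "kcycles n c 0 d = kchains n c 0 d"
  by (auto simp: kcycles_def bd_kchains_0)

text \<open>On cycles, \<open>wedge u\<close> is a primitive for multiplication by the monomial
  \<open>u\<close>. Hence the ideal generated by the monomials of degree c kills the
  homology.\<close>

lemma mono_smul_kbounds:
  assumes "u \<in> monomials n c" "z \<in> kcycles n c t d"
  shows "smul (mono_poly u) z \<in> kbounds n c t (int c + d)"
proof -
  have "smul (mono_poly u) z = bd n c (wedge u z)"
    using assms by (simp add: bd_wedge kcycles_def)
  moreover have "wedge u z \<in> kchains n c (Suc t) (int c + d)"
    using wedge_kchains[OF assms(1), of z t d] assms(2) by (simp add: kcycles_def add.commute)
  ultimately show ?thesis unfolding kbounds_def by blast
qed

lemma dX_kos:
  assumes "x \<in> kos {1..n} (Suc i) C" "subgroup_set C'" "\<And>i z. i \<in> {1..n} \<Longrightarrow> z \<in> C \<Longrightarrow> smul (var i) z \<in> C'"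
  shows "dX n x \<in> kos {1..n} i C'"
  unfolding dX_def by (rule dX.kdiff_kos_stable[OF assms])

lemma bd_dX: "bd n c (dX n x l) = dX n (\<lambda>l. bd n c (x l)) l"
  by (simp add: dX_def kdiff_def bd_sum bd_smul)

text \<open>The chains form a free S-module, so the homotopy \<open>khom\<close> can be applied
  separately at each list \<open>m\<close> of monomials. The generators sit in degree
  \<open>t * c\<close>; constant coefficients, and with them homology, occur only there and for
  \<open>i = 0\<close>.\<close>

lemma kchains_dX_acyclic:
  fixes x :: "nat list \<Rightarrow> (nat \<Rightarrow>\<^sub>0 nat) list \<Rightarrow> (nat, 'k::field) mpoly"
  assumes x: "x \<in> kos {1..n} i (kchains n c t e)" and cycle: "dX n x = 0" and "i > 0 \<or> e \<noteq> int t * int c"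
  shows "\<exists>y\<in>kos {1..n} (Suc i) (kchains n c t (e - 1)). dX n y = x"
proof -
  define \<omega> where "\<omega> m l = x l m" for m l
  have xl: "x l \<in> kos (monomials n c) t (homog {1..n} (e - int t * int c))" for l
    using kosD(2)[OF x] by (simp add: kchains_def)
  have \<omega>: "\<omega> m \<in> kos {1..n} i (homog {1..n} (e - int t * int c))" for m
    unfolding \<omega>_def[abs_def] by (rule kos_compose[OF x]) (auto simp: kchains_def dest: kosD(2))
  have hom: "kdiff {1..n} (\<lambda>v p. var v * p) (khom (\<omega> m)) = \<omega> m" for m
  proof (rule koszul_acyclic[OF _ \<omega>])
    show "kdiff {1..n} (\<lambda>v p. var v * p) (\<omega> m) = 0"
    proof
      fix l
      have "dX n x l m = 0" by (simp add: cycle)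
      then show "kdiff {1..n} (\<lambda>v p. var v * p) (\<omega> m) l = 0 l"
        by (simp add: dX_def kdiff_def \<omega>_def sum_fun_apply)
    qed
    show "lookup (\<omega> m []) 0 = 0"
      using assms(3)
    proof
      assume "i > 0"
      then have "x [] = 0" using kosD(3)[OF x, of "[]"] by auto
      then show ?thesis by (simp add: \<omega>_def)
    next
      assume "e \<noteq> int t * int c"
      then show ?thesis using kosD(2)[OF \<omega>, of m "[]"] by (force simp: homog_def Poly_Mapping.in_keys_iff)
    qed
  qed simp
  define y where "y l m = khom (\<omega> m) l" for l m
  note k = khom_kos[OF \<omega>]
  have "y \<in> kos {1..n} (Suc i) (kchains n c t (e - 1))"
  proof (rule kosI)
    show "alternating y"
      unfolding alternating_def
    proof (intro conjI allI ext)
      fix l a b l' m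
      show "y (l @ a # b # l') m = (- y (l @ b # a # l')) m"
        unfolding y_def fun_Compl_def by (rule alternating_swap) (rule kosD(1)[OF k])
      show "y (l @ a # a # l') m = 0 m"
        unfolding y_def zero_fun_apply by (rule alternating_rep) (rule kosD(1)[OF k])
    qed
    show "length l = Suc i \<and> set l \<subseteq> {1..n}" if "y l \<noteq> 0" for l
    proof -
      have "\<exists>m. y l m \<noteq> 0"
      proof (rule ccontr)
        assume "\<nexists>m. y l m \<noteq> 0"
        then have "y l = 0" by (intro ext) simp
        then show False using that by simp
      qed
      then obtain m where "y l m \<noteq> 0" ..
      then show ?thesis unfolding y_def using kosD(3,4)[OF k] by blast
    qed
    show "y l \<in> kchains n c t (e - 1)" for l
      unfolding kchains_def
    proof (rule kosI)
      show "alternating (y l)"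
        unfolding alternating_def
      proof (intro conjI allI)
        fix m a b m'
        have "\<omega> (m @ a # b # m') = (\<lambda>l. - \<omega> (m @ b # a # m') l)"
          unfolding \<omega>_def by (rule ext) (rule alternating_swap[OF kosD(1)[OF xl]])
        then show "y l (m @ a # b # m') = - y l (m @ b # a # m')"
          unfolding y_def by (simp only: khom_uminus)
        have "\<omega> (m @ a # a # m') = (\<lambda>l. 0)"
          unfolding \<omega>_def by (rule ext) (rule alternating_rep[OF kosD(1)[OF xl]])
        then show "y l (m @ a # a # m') = 0"
          unfolding y_def by (simp only: khom_zero)
      qed
      show "y l m \<in> homog {1..n} (e - 1 - int t * int c)" for m
        using kosD(2)[OF k, of m l] by (simp add: y_def algebra_simps)
      show "length m = t \<and> set m \<subseteq> monomials n c" if "y l m \<noteq> 0" for m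
      proof -
        have "\<omega> m \<noteq> (\<lambda>_. 0)" using that khom_zero unfolding y_def by metis
        then obtain l' where "x l' m \<noteq> 0" unfolding \<omega>_def by blast
        then show ?thesis using kosD(3,4)[OF xl] by blast
      qed
    qed
  qed
  moreover have "dX n y = x"
  proof (intro ext)
    fix l m
    have "dX n y l m = kdiff {1..n} (\<lambda>v p. var v * p) (khom (\<omega> m)) l"
      by (simp add: dX_def kdiff_def y_def sum_fun_apply)
    then show "dX n y l m = x l m" by (simp only: hom \<omega>_def)
  qed
  ultimately show ?thesis by blast
qed

text \<open>\<open>kos_lift\<close> applies in every characteristic: if 2 is non-zero, no non-zero
  element equals its negative, and if 2 = 0, every element does.\<close>

lemma kbounds_lift:
  fixes w :: "nat list \<Rightarrow> (nat \<Rightarrow>\<^sub>0 nat) list \<Rightarrow> (nat, 'k::field) mpoly"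
  assumes w: "w \<in> kos {1..n} i (kbounds n c t e)"
  shows "\<exists>w'\<in>kos {1..n} i (kchains n c (Suc t) e). w = (\<lambda>l. bd n c (w' l))"
proof -
  have torsion: "x = 0" if "(2 :: 'k) \<noteq> 0" "x = - x" for x :: "(nat \<Rightarrow>\<^sub>0 nat) list \<Rightarrow> (nat, 'k) mpoly"
  proof (intro ext poly_mapping_eqI)
    fix m a
    have "lookup (x m) a = lookup ((- x) m) a" using that(2) by metis
    then have "lookup (x m) a + lookup (x m) a = 0" by (simp add: fun_Compl_def)
    then have "2 * lookup (x m) a = 0" by simp
    then show "lookup (x m) a = lookup (0 m) a" using that(1) by (simp del: mult_eq_0_iff add: no_zero_divisors mult_eq_0_iff)
  qed
  have char2: "- y = y" if "(2 :: 'k) = 0" for y :: "(nat \<Rightarrow>\<^sub>0 nat) list \<Rightarrow> (nat, 'k) mpoly"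
  proof (intro ext poly_mapping_eqI)
    fix m a
    have "lookup (y m) a + lookup (y m) a = 0" using that by (metis mult_2 mult_zero_left)
    then show "lookup ((- y) m) a = lookup (y m) a" by (simp add: fun_Compl_def add_eq_0_iff)
  qed
  have "(\<forall>x\<in>kbounds n c t e :: ((nat \<Rightarrow>\<^sub>0 nat) list \<Rightarrow> (nat, 'k) mpoly) set. x = - x \<longrightarrow> x = 0) \<or>
      (\<forall>y\<in>kchains n c (Suc t) e :: ((nat \<Rightarrow>\<^sub>0 nat) list \<Rightarrow> (nat, 'k) mpoly) set. - y = y)"
    using torsion char2 by blast
  then obtain \<eta> where "\<eta> \<in> kos {1..n} i (kchains n c (Suc t) e)" "\<And>l. bd n c (\<eta> l) = w l"
    by (elim kos_lift[where \<phi> = "bd n c", OF w subgroup_set_kbounds subgroup_set_kchains, rotated 2])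
       (auto simp: kbounds_def bd_uminus)
  then show ?thesis by (intro bexI[of _ \<eta>]) auto
qed

section \<open>Regularity of the modules of cycles\<close>

text \<open>Castelnuovo--Mumford regularity at most \<open>r\<close>, in terms of Koszul homology with respect to the
  indeterminates; \<open>e\<close> is the internal degree minus the homological degree \<open>i\<close>.\<close>

definition kregular :: "'k::field itself \<Rightarrow> nat \<Rightarrow> nat \<Rightarrow> nat \<Rightarrow> int \<Rightarrow> bool" where
  "kregular TYPE('k) n c t r \<longleftrightarrow> (\<forall>i e. \<forall>x\<in>kos {1..n} i (kcycles n c t e :: ((nat \<Rightarrow>\<^sub>0 nat) list \<Rightarrow> (nat, 'k) mpoly) set).
     e > r \<longrightarrow> dX n x = 0 \<longrightarrow> (\<exists>y\<in>kos {1..n} (Suc i) (kcycles n c t (e - 1)). dX n y = x))"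

lemma kregularD:
  assumes "kregular TYPE('k::field) n c t r"
    "(x :: nat list \<Rightarrow> (nat \<Rightarrow>\<^sub>0 nat) list \<Rightarrow> (nat, 'k) mpoly) \<in> kos {1..n} i (kcycles n c t e)" "e > r" "dX n x = 0"
  shows "\<exists>y\<in>kos {1..n} (Suc i) (kcycles n c t (e - 1)). dX n y = x"
  using assms unfolding kregular_def by blast

lemma kregular_decomp:
  fixes z :: "(nat \<Rightarrow>\<^sub>0 nat) list \<Rightarrow> (nat, 'k::field) mpoly"
  assumes reg: "kregular TYPE('k) n c t r" and z: "z \<in> kcycles n c t d" and "d > r"
  obtains y where "\<And>i. y i \<in> kcycles n c t (d - 1)" "z = (\<Sum>i\<in>{1..n}. smul (var i) (y i))"
proof -
  define x where "x l = (if l = [] then z else 0)" for l :: "nat list"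
  have x: "x \<in> kos {1..n} 0 (kcycles n c t d)"
    unfolding kos_0_iff x_def[abs_def] using z by (auto intro: subgroup_set_zero subgroup_set_kcycles)
  have "dX n x = 0" unfolding dX_def by (rule kdiff_kos_0[OF x]) simp
  then obtain y where y: "y \<in> kos {1..n} (Suc 0) (kcycles n c t (d - 1))" "dX n y = x"
    using kregularD[OF reg x \<open>d > r\<close>] by blast
  have "z = dX n y []" by (simp add: y(2) x_def)
  then show thesis using that[of "\<lambda>i. y [i]"] kosD(2)[OF y(1)] by (simp add: dX_def kdiff_def)
qed

text \<open>Every cycle that lies \<open>e\<close> degrees or more above \<open>r\<close> is a sum
  of monomials of degree \<open>e\<close> times cycles. Formulated with a subgroup \<open>D\<close>,
  the induction can replace \<open>D\<close> by its preimage under multiplication by a variable, so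
  \<open>D\<close> need not be a submodule.\<close>

lemma kregular_generated:
  fixes D :: "((nat \<Rightarrow>\<^sub>0 nat) list \<Rightarrow> (nat, 'k::field) mpoly) set"
  assumes reg: "kregular TYPE('k) n c t r"
    and "subgroup_set D" "d \<ge> r + int e"
    and "\<And>u z. u \<in> monomials n e \<Longrightarrow> z \<in> kcycles n c t (d - int e) \<Longrightarrow> smul (mono_poly u) z \<in> D"
  shows "kcycles n c t d \<subseteq> D"
  using assms(2-)
proof (induction e arbitrary: d D)
  case 0
  show ?case using 0(3)[OF monomials_0] by auto
next
  case (Suc e)
  show ?case
  proof
    fix z :: "(nat \<Rightarrow>\<^sub>0 nat) list \<Rightarrow> (nat, 'k) mpoly"
    assume z: "z \<in> kcycles n c t d"
    have "d > r" using Suc.prems(2) by simp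
    then obtain y where y: "\<And>i. y i \<in> kcycles n c t (d - 1)" "z = (\<Sum>i\<in>{1..n}. smul (var i) (y i))"
      using kregular_decomp[OF reg z] by blast
    have "smul (var i) (y i) \<in> D" if i: "i \<in> {1..n}" for i
    proof -
      have "kcycles n c t (d - 1) \<subseteq> {z. smul (var i) z \<in> D}"
      proof (rule Suc.IH)
        show "subgroup_set {z. smul (var i) z \<in> D}"
          using Suc.prems(1) by (intro subgroup_setI) (auto simp: smul_diff intro: subgroup_set_zero subgroup_set_diff)
        show "d - 1 \<ge> r + int e" using Suc.prems(2) by simp
        fix u and z :: "(nat \<Rightarrow>\<^sub>0 nat) list \<Rightarrow> (nat, 'k) mpoly"
        assume u: "u \<in> monomials n e" and "z \<in> kcycles n c t (d - 1 - int e)"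
        then have "z \<in> kcycles n c t (d - int (Suc e))" by (simp add: algebra_simps)
        moreover have "Poly_Mapping.single i 1 + u \<in> monomials n (Suc e)"
          using monomials_add[OF monomials_single[OF i] u] by simp
        ultimately have "smul (mono_poly (Poly_Mapping.single i 1 + u)) z \<in> D" by (intro Suc.prems(3))
        then show "smul (mono_poly u) z \<in> {z. smul (var i) z \<in> D}"
          by (simp add: smul_smul var_eq_mono_poly flip: mono_poly_add)
      qed
      then show ?thesis using y(1) by blast
    qed
    then show "z \<in> D" unfolding y(2) by (rule subgroup_set_sum[OF Suc.prems(1)])
  qed
qed

lemma kregular_vanishing:
  assumes "kregular TYPE('k::field) n c t r" "d \<ge> r + int c"
  shows "kcycles n c t d \<subseteq> (kbounds n c t d :: ((nat \<Rightarrow>\<^sub>0 nat) list \<Rightarrow> (nat, 'k) mpoly) set)"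
proof (rule kregular_generated[OF assms(1) subgroup_set_kbounds assms(2)])
  fix u and z :: "(nat \<Rightarrow>\<^sub>0 nat) list \<Rightarrow> (nat, 'k) mpoly"
  assume "u \<in> monomials n c" "z \<in> kcycles n c t (d - int c)"
  then show "smul (mono_poly u) z \<in> kbounds n c t d" using mono_smul_kbounds[of u n c z t "d - int c"] by simp
qed

text \<open>A dX-primitive \<open>y\<close> of a form \<open>x\<close> of cycles exists among the
  chains. The obstruction to \<open>y\<close> consisting of cycles is \<open>bd y\<close>, a
  dX-cycle one step lower, which the induction hypothesis writes as \<open>dX w\<close>. If
  \<open>w\<close> consists of boundaries, a lift of \<open>w\<close> corrects
  \<open>y\<close>.\<close>

theorem kregular_kcycles: "kregular TYPE('k::field) n c t (int t * (int c + 1))"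
proof (induction t)
  case 0
  show ?case
    unfolding kregular_def
  proof (intro allI ballI impI)
    fix i e and x :: "nat list \<Rightarrow> (nat \<Rightarrow>\<^sub>0 nat) list \<Rightarrow> (nat, 'k) mpoly"
    assume "x \<in> kos {1..n} i (kcycles n c 0 e)" "e > int 0 * (int c + 1)" "dX n x = 0"
    then show "\<exists>y\<in>kos {1..n} (Suc i) (kcycles n c 0 (e - 1)). dX n y = x"
      unfolding kcycles_0 by (intro kchains_dX_acyclic) auto
  qed
next
  case (Suc t)
  show ?case
    unfolding kregular_def
  proof (intro allI ballI impI)
    fix i e and x :: "nat list \<Rightarrow> (nat \<Rightarrow>\<^sub>0 nat) list \<Rightarrow> (nat, 'k) mpoly"
    assume x: "x \<in> kos {1..n} i (kcycles n c (Suc t) e)" and e: "e > int (Suc t) * (int c + 1)" and cycle: "dX n x = 0"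
    have x': "x \<in> kos {1..n} i (kchains n c (Suc t) e)"
      using kosD(2)[OF x] by (intro kos_mono[OF x]) (simp add: kcycles_def)
    have bd_x: "bd n c (x l) = 0" for l using kosD(2)[OF x] by (simp add: kcycles_def)
    have "e \<noteq> int (Suc t) * int c" using e by (simp add: algebra_simps)
    then obtain y where y: "y \<in> kos {1..n} (Suc i) (kchains n c (Suc t) (e - 1))" "dX n y = x"
      using kchains_dX_acyclic[OF x' cycle] by blast
    define b where "b l = bd n c (y l)" for l
    have b: "b \<in> kos {1..n} (Suc i) (kcycles n c t (e - 1))"
      unfolding b_def[abs_def] by (rule kos_compose[where \<phi> = "bd n c", OF y(1)]) (simp_all only: bd_zero bd_uminus bd_kcycles)
    have "dX n b = 0"
      using bd_dX[of n c y] by (intro ext) (simp add: b_def[abs_def] y(2) bd_x flip: bd_dX)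
    moreover have "e - 1 > int t * (int c + 1)" using e by (simp add: algebra_simps)
    ultimately obtain w where w: "w \<in> kos {1..n} (Suc (Suc i)) (kcycles n c t (e - 1 - 1))" "dX n w = b"
      using kregularD[OF Suc.IH b] by blast
    \<comment> \<open>This inequality fixes the constant. Two degrees are spent on the two
      primitives, and what is left must still be at least c above the bound for \<open>t\<close>,
      where cycles are boundaries; increasing the bound by c + 1 per step is just enough.\<close>
    have "e - 1 - 1 \<ge> int t * (int c + 1) + int c" using e by (simp add: algebra_simps)
    from kregular_vanishing[OF Suc.IH this]
    have "w \<in> kos {1..n} (Suc (Suc i)) (kbounds n c t (e - 1 - 1))"
      using kosD(2)[OF w(1)] by (intro kos_mono[OF w(1)]) blast
    then obtain w' where w': "w' \<in> kos {1..n} (Suc (Suc i)) (kchains n c (Suc t) (e - 1 - 1))" "w = (\<lambda>l. bd n c (w' l))"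
      using kbounds_lift by blast
    have dw': "dX n w' \<in> kos {1..n} (Suc i) (kchains n c (Suc t) (e - 1))"
    proof (rule dX_kos[OF w'(1) subgroup_set_kchains])
      fix i and z :: "(nat \<Rightarrow>\<^sub>0 nat) list \<Rightarrow> (nat, 'k) mpoly"
      assume "i \<in> {1..n}" "z \<in> kchains n c (Suc t) (e - 1 - 1)"
      then show "smul (var i) z \<in> kchains n c (Suc t) (e - 1)"
        using smul_kchains[OF var_homog, of i n z c "Suc t" "e - 1 - 1"] by simp
    qed
    have "bd n c ((y - dX n w') l) = 0" for l
      using bd_dX[of n c w' l] w'(2) w(2) by (simp add: bd_diff b_def[symmetric])
    then have "y - dX n w' \<in> kos {1..n} (Suc i) (kcycles n c (Suc t) (e - 1))"
      using kos_diff[OF subgroup_set_kchains y(1) dw'] kosD(2)[OF kos_diff[OF subgroup_set_kchains y(1) dw']]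
      by (elim kos_mono) (simp add: kcycles_def)
    moreover have "dX n (y - dX n w') = x"
      unfolding dX_def dX.kdiff_diff dX.kdiff_kdiff[OF kosD(1)[OF w'(1)]]
      using y(2) by (simp add: dX_def)
    ultimately show "\<exists>y\<in>kos {1..n} (Suc i) (kcycles n c (Suc t) (e - 1)). dX n y = x" by blast
  qed
qed

section \<open>Products of linear syzygies\<close>

text \<open>Left multiplication by the linear syzygy \<open>x_i [b x_j] - x_j [b x_i]\<close>, of
  degree c + 1. It is an operator on forms, so products of such syzygies are compositions.\<close>

primrec lsyz :: "(nat \<Rightarrow>\<^sub>0 nat) \<Rightarrow> nat \<times> nat \<Rightarrow> ((nat \<Rightarrow>\<^sub>0 nat) list \<Rightarrow> (nat, 'k::field) mpoly) \<Rightarrow>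
    (nat \<Rightarrow>\<^sub>0 nat) list \<Rightarrow> (nat, 'k) mpoly" where
  "lsyz b (i, j) z = smul (var i) (wedge (b + Poly_Mapping.single j 1) z)
     - smul (var j) (wedge (b + Poly_Mapping.single i 1) z)"

lemma monomials_pred_add:
  "c \<ge> 1 \<Longrightarrow> b \<in> monomials n (c - 1) \<Longrightarrow> i \<in> {1..n} \<Longrightarrow> b + Poly_Mapping.single i 1 \<in> monomials n c"
  using monomials_add[OF _ monomials_single, of b n "c - 1" i] by simp

lemma lsyz_diff: "lsyz b p (z - w) = lsyz b p z - lsyz b p w"
  by (cases p) (simp add: wedge_fun_diff smul_diff)

lemma lsyz_zero [simp]: "lsyz b p 0 = 0"
  by (cases p) simp

lemma lsyz_add: "lsyz b p (z + w) = lsyz b p z + lsyz b p w"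
  using lsyz_diff[of b p "z + w" w] by (simp add: algebra_simps)

lemma lsyz_smul: "lsyz b p (smul q z) = smul q (lsyz b p z)"
  by (cases p) (simp only: lsyz.simps wedge_smul smul_diff smul_left_commute)

context
  fixes n c :: nat
  assumes c: "c \<ge> 1"
begin

text \<open>The multiplier is itself a cycle, as both of its terms have boundary
  \<open>x_i x_j b\<close>. What remains of the Leibniz rule is the sign for homological degree
  1.\<close>

lemma bd_lsyz:
  assumes "b \<in> monomials n (c - 1)" "p \<in> {1..n} \<times> {1..n}"
  shows "bd n c (lsyz b p z) = - lsyz b p (bd n c z)"
proof -
  obtain i j where p: "p = (i, j)" "i \<in> {1..n}" "j \<in> {1..n}" using assms(2) by auto
  have "smul (var i) (smul (mono_poly (b + Poly_Mapping.single j 1)) z) =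
      smul (var j) (smul (mono_poly (b + Poly_Mapping.single i 1)) z)"
    by (simp add: smul_smul var_eq_mono_poly Poly_Mapping.mult_single ac_simps)
  then show ?thesis
    unfolding p(1) lsyz.simps bd_diff bd_smul bd_wedge[OF monomials_pred_add[OF c assms(1) p(2)]]
      bd_wedge[OF monomials_pred_add[OF c assms(1) p(3)]] smul_diff by simp
qed

lemma lsyz_kchains:
  assumes "b \<in> monomials n (c - 1)" "p \<in> {1..n} \<times> {1..n}" "z \<in> kchains n c t d"
  shows "lsyz b p z \<in> kchains n c (Suc t) (d + int c + 1)"
proof -
  obtain i j where p: "p = (i, j)" "i \<in> {1..n}" "j \<in> {1..n}" using assms(2) by auto
  have "smul (var i') (wedge (b + Poly_Mapping.single j' 1) z) \<in> kchains n c (Suc t) (d + int c + 1)"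
    if "i' \<in> {1..n}" "j' \<in> {1..n}" for i' j'
    using smul_kchains[OF var_homog[OF that(1)] wedge_kchains[OF monomials_pred_add[OF c assms(1) that(2)] assms(3)]]
    by (simp add: add.commute)
  then show ?thesis unfolding p(1) lsyz.simps using p by (intro subgroup_set_diff[OF subgroup_set_kchains])
qed

lemma lsyz_kcycles:
  assumes "b \<in> monomials n (c - 1)" "p \<in> {1..n} \<times> {1..n}" "z \<in> kcycles n c t d"
  shows "lsyz b p z \<in> kcycles n c (Suc t) (d + int c + 1)"
  using assms by (simp add: kcycles_def lsyz_kchains bd_lsyz)

lemma lsyz_kbounds:
  assumes "b \<in> monomials n (c - 1)" "p \<in> {1..n} \<times> {1..n}" "z \<in> kbounds n c t d"
  shows "lsyz b p z \<in> kbounds n c (Suc t) (d + int c + 1)"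
proof -
  obtain w where w: "z = bd n c w" "w \<in> kchains n c (Suc t) d" using assms(3) by (auto simp: kbounds_def)
  have "lsyz b p z = bd n c (- lsyz b p w)" using assms by (simp add: w(1) bd_lsyz bd_uminus)
  moreover have "- lsyz b p w \<in> kchains n c (Suc (Suc t)) (d + int c + 1)"
    using assms w by (intro subgroup_set_uminus subgroup_set_kchains lsyz_kchains)
  ultimately show ?thesis unfolding kbounds_def by blast
qed

text \<open>An arbitrary subgroup \<open>D\<close> takes the place of the span of the two kinds of elements. The linear
  syzygies appear in the diagram chase for the regularity.\<close>

lemma kcycles_top_degree_step:
  fixes D :: "((nat \<Rightarrow>\<^sub>0 nat) list \<Rightarrow> (nat, 'k::field) mpoly) set"
  assumes D: "subgroup_set D"
    and syz: "\<And>b p z. b \<in> monomials n (c - 1) \<Longrightarrow> p \<in> {1..n} \<times> {1..n} \<Longrightarrow>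
      z \<in> kcycles n c t (int t * (int c + 1)) \<Longrightarrow> lsyz b p z \<in> D"
    and low: "\<And>i z. i \<in> {1..n} \<Longrightarrow> z \<in> kcycles n c (Suc t) (int (Suc t) * (int c + 1) - 1) \<Longrightarrow> smul (var i) z \<in> D"
  shows "kcycles n c (Suc t) (int (Suc t) * (int c + 1)) \<subseteq> D"
proof
  fix x :: "(nat \<Rightarrow>\<^sub>0 nat) list \<Rightarrow> (nat, 'k) mpoly"
  define d where "d = int (Suc t) * (int c + 1)"
  assume "x \<in> kcycles n c (Suc t) (int (Suc t) * (int c + 1))"
  then have x: "x \<in> kchains n c (Suc t) d" "bd n c x = 0" by (simp_all add: kcycles_def d_def)
  define x' where "x' l = (if l = [] then x else 0)" for l :: "nat list"
  have x': "x' \<in> kos {1..n} 0 (kchains n c (Suc t) d)"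
    unfolding kos_0_iff x'_def[abs_def] using x by (auto intro: subgroup_set_zero subgroup_set_kchains)
  have "dX n x' = 0" unfolding dX_def by (rule kdiff_kos_0[OF x']) simp
  moreover have "d \<noteq> int (Suc t) * int c" by (simp add: d_def algebra_simps)
  ultimately obtain y where y: "y \<in> kos {1..n} (Suc 0) (kchains n c (Suc t) (d - 1))" "dX n y = x'"
    using kchains_dX_acyclic[OF x'] by blast
  define b where "b l = bd n c (y l)" for l
  have b: "b \<in> kos {1..n} (Suc 0) (kcycles n c t (d - 1))"
    unfolding b_def[abs_def] by (rule kos_compose[where \<phi> = "bd n c", OF y(1)]) (simp_all only: bd_zero bd_uminus bd_kcycles)
  have "dX n b = 0"
    by (intro ext) (simp add: b_def[abs_def] y(2) x'_def x(2) flip: bd_dX)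
  moreover have "d - 1 > int t * (int c + 1)" using c by (simp add: d_def algebra_simps)
  ultimately obtain w where w: "w \<in> kos {1..n} (Suc (Suc 0)) (kcycles n c t (d - 1 - 1))" "dX n w = b"
    using kregularD[OF kregular_kcycles b] by blast
  \<comment> \<open>The degree \<open>d - 2\<close> of \<open>w\<close> is one short of the range
    where cycles are boundaries, so \<open>w\<close> itself may have no lift. The products of
    \<open>w [i, j]\<close> with both variables do: a cycle of this degree is a sum of
    \<open>u z\<close> with \<open>u\<close> of degree c - 1, and \<open>x_i u z\<close> is the
    boundary of \<open>[u x_i] z\<close>. The mismatch of the two lifts is a linear syzygy times
    \<open>z\<close>.\<close>
  define P where "P i j = {z. \<exists>p\<in>kchains n c (Suc t) (d - 1). \<exists>q\<in>kchains n c (Suc t) (d - 1).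
      bd n c p = smul (var i) z \<and> bd n c q = smul (var j) z \<and> smul (var j) p - smul (var i) q \<in> D}" for i j
  have P: "kcycles n c t (d - 1 - 1) \<subseteq> P i j" if ij: "i \<in> {1..n}" "j \<in> {1..n}" for i j
  proof (rule kregular_generated[OF kregular_kcycles])
    show "subgroup_set (P i j)"
    proof (rule subgroup_setI)
      show "0 \<in> P i j"
        unfolding P_def using subgroup_set_zero[OF D] subgroup_set_zero[OF subgroup_set_kchains]
        by (intro CollectI bexI[of _ 0]) auto
      fix z z' assume "z \<in> P i j" "z' \<in> P i j"
      then obtain p q p' q' where
        pq: "p \<in> kchains n c (Suc t) (d - 1)" "q \<in> kchains n c (Suc t) (d - 1)"
          "bd n c p = smul (var i) z" "bd n c q = smul (var j) z" "smul (var j) p - smul (var i) q \<in> D"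
          "p' \<in> kchains n c (Suc t) (d - 1)" "q' \<in> kchains n c (Suc t) (d - 1)"
          "bd n c p' = smul (var i) z'" "bd n c q' = smul (var j) z'" "smul (var j) p' - smul (var i) q' \<in> D"
        unfolding P_def by blast
      have "smul (var j) (p - p') - smul (var i) (q - q') =
          (smul (var j) p - smul (var i) q) - (smul (var j) p' - smul (var i) q')"
        by (simp add: smul_diff)
      also have "\<dots> \<in> D" by (rule subgroup_set_diff[OF D pq(5) pq(10)])
      finally have "smul (var j) (p - p') - smul (var i) (q - q') \<in> D" .
      moreover have "p - p' \<in> kchains n c (Suc t) (d - 1)" "q - q' \<in> kchains n c (Suc t) (d - 1)"
        using pq by (auto intro: subgroup_set_diff[OF subgroup_set_kchains])
      ultimately show "z - z' \<in> P i j"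
        unfolding P_def using pq by (intro CollectI bexI[of _ "p - p'"] bexI[of _ "q - q'"]) (simp_all add: bd_diff smul_diff)
    qed
    show "d - 1 - 1 \<ge> int t * (int c + 1) + int (c - 1)" using c by (simp add: d_def algebra_simps)
    fix u and z :: "(nat \<Rightarrow>\<^sub>0 nat) list \<Rightarrow> (nat, 'k) mpoly"
    assume u: "u \<in> monomials n (c - 1)" and "z \<in> kcycles n c t (d - 1 - 1 - int (c - 1))"
    then have z: "z \<in> kcycles n c t (int t * (int c + 1))" using c by (simp add: d_def algebra_simps)
    have ch: "wedge (u + Poly_Mapping.single i' 1) z \<in> kchains n c (Suc t) (d - 1)" if "i' \<in> {1..n}" for i'
      using wedge_kchains[OF monomials_pred_add[OF c u that], of z t "int t * (int c + 1)"] z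
      by (simp add: kcycles_def d_def algebra_simps)
    have bdw: "bd n c (wedge (u + Poly_Mapping.single i' 1) z) = smul (var i') (smul (mono_poly u) z)"
      if "i' \<in> {1..n}" for i'
      using bd_wedge[OF monomials_pred_add[OF c u that], of z] z
      by (simp add: kcycles_def smul_smul var_eq_mono_poly Poly_Mapping.mult_single add.commute)
    have "smul (var j) (wedge (u + Poly_Mapping.single i 1) z) - smul (var i) (wedge (u + Poly_Mapping.single j 1) z)
        = lsyz u (j, i) z" by simp
    also have "\<dots> \<in> D" using u ij z by (intro syz) auto
    finally show "smul (mono_poly u) z \<in> P i j"
      unfolding P_def using ch[OF ij(1)] ch[OF ij(2)] bdw[OF ij(1)] bdw[OF ij(2)] by blast
  qed
  have wP: "w [i, j] \<in> P i j" if "i \<in> {1..n}" "j \<in> {1..n}" for i j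
    using P[OF that] kosD(2)[OF w(1)] by blast
  then have "\<forall>i\<in>{1..n}. \<forall>j\<in>{1..n}. \<exists>p q. p \<in> kchains n c (Suc t) (d - 1) \<and> q \<in> kchains n c (Suc t) (d - 1) \<and>
      bd n c p = smul (var i) (w [i, j]) \<and> bd n c q = smul (var j) (w [i, j]) \<and> smul (var j) p - smul (var i) q \<in> D"
    unfolding P_def by blast
  then obtain p q where pq: "\<And>i j. i \<in> {1..n} \<Longrightarrow> j \<in> {1..n} \<Longrightarrow>
      p i j \<in> kchains n c (Suc t) (d - 1) \<and> q i j \<in> kchains n c (Suc t) (d - 1) \<and>
      bd n c (p i j) = smul (var i) (w [i, j]) \<and> bd n c (q i j) = smul (var j) (w [i, j]) \<and>
      smul (var j) (p i j) - smul (var i) (q i j) \<in> D"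
    by metis
  \<comment> \<open>A substitute for \<open>dX\<close> of a lift of \<open>w\<close>. For i < j the
    summand is the lift of \<open>x_i w [i, j]\<close>; for i > j it comes from the lift for the
    pair (j, i), with a sign because \<open>w\<close> alternates.\<close>
  define y' where "y' j = (\<Sum>i\<in>{1..n}. (if i < j then p i j else 0) - (if j < i then q j i else 0))" for j
  have y': "y' j \<in> kchains n c (Suc t) (d - 1)" if "j \<in> {1..n}" for j
    unfolding y'_def using pq that
    by (intro subgroup_set_sum[OF subgroup_set_kchains] subgroup_set_diff[OF subgroup_set_kchains])
       (auto intro: subgroup_set_zero[OF subgroup_set_kchains])
  have bd_y': "bd n c (y' j) = bd n c (y [j])" if j: "j \<in> {1..n}" for j
  proof -
    have "bd n c (y' j) = (\<Sum>i\<in>{1..n}. smul (var i) (w [i, j]))"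
      unfolding y'_def bd_sum
    proof (rule sum.cong[OF refl])
      fix i assume i: "i \<in> {1..n}"
      have wij: "w [i, j] = - w [j, i]" "w [i, i] = 0"
        using alternating_swap0[OF kosD(1)[OF w(1)]] alternating_rep0[OF kosD(1)[OF w(1)]] by blast+
      show "bd n c ((if i < j then p i j else 0) - (if j < i then q j i else 0)) = smul (var i) (w [i, j])"
        using pq[OF i j] pq[OF j i] wij
        by (cases i j rule: linorder_cases) (simp_all add: bd_diff bd_uminus smul_uminus)
    qed
    also have "\<dots> = b [j]" unfolding w(2)[symmetric] by (simp add: dX_def kdiff_def)
    finally show ?thesis by (simp add: b_def)
  qed
  have x_eq: "x = (\<Sum>j\<in>{1..n}. smul (var j) (y [j]))"
    using fun_cong[OF y(2), of "[]"] by (simp add: dX_def kdiff_def x'_def)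
  have "(\<Sum>j\<in>{1..n}. smul (var j) (y [j] - y' j)) \<in> D"
  proof (intro subgroup_set_sum[OF D] low)
    fix j assume j: "j \<in> {1..n}"
    show "y [j] - y' j \<in> kcycles n c (Suc t) (int (Suc t) * (int c + 1) - 1)"
      unfolding d_def[symmetric] kcycles_def
      using subgroup_set_diff[OF subgroup_set_kchains kosD(2)[OF y(1)] y'[OF j]] bd_y'[OF j] by (simp add: bd_diff)
  qed
  moreover have "(\<Sum>j\<in>{1..n}. smul (var j) (y' j)) \<in> D"
  proof -
    \<comment> \<open>The sum is regrouped by pairs i < j, so that the two lifts attached to one
      pair meet in the combination that membership in \<open>P\<close> places in
      \<open>D\<close>.\<close>
    define A where "A i j = (if i < j then smul (var j) (p i j) else 0)" for i j
    define B where "B i j = (if i < j then smul (var i) (q i j) else 0)" for i j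
    have "(\<Sum>j\<in>{1..n}. smul (var j) (y' j)) = (\<Sum>j\<in>{1..n}. \<Sum>i\<in>{1..n}. A i j - B j i)"
      unfolding y'_def smul_sum by (intro sum.cong refl) (simp add: A_def B_def smul_diff)
    also have "\<dots> = (\<Sum>j\<in>{1..n}. \<Sum>i\<in>{1..n}. A i j) - (\<Sum>j\<in>{1..n}. \<Sum>i\<in>{1..n}. B j i)"
      by (simp only: sum_subtractf)
    also have "(\<Sum>j\<in>{1..n}. \<Sum>i\<in>{1..n}. B j i) = (\<Sum>j\<in>{1..n}. \<Sum>i\<in>{1..n}. B i j)"
      by (rule sum.swap)
    also have "(\<Sum>j\<in>{1..n}. \<Sum>i\<in>{1..n}. A i j) - \<dots> = (\<Sum>j\<in>{1..n}. \<Sum>i\<in>{1..n}. A i j - B i j)"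
      by (simp only: sum_subtractf)
    also have "\<dots> \<in> D"
    proof (intro subgroup_set_sum[OF D])
      fix i j assume "j \<in> {1..n}" "i \<in> {1..n}"
      then show "A i j - B i j \<in> D"
        using pq subgroup_set_zero[OF D] by (cases "i < j") (simp_all add: A_def B_def)
    qed
    finally show ?thesis .
  qed
  ultimately have "(\<Sum>j\<in>{1..n}. smul (var j) (y [j] - y' j)) + (\<Sum>j\<in>{1..n}. smul (var j) (y' j)) \<in> D"
    by (rule subgroup_set_add[OF D])
  then show "x \<in> D" unfolding x_eq by (simp add: smul_diff sum_subtractf)
qed

end

section \<open>Cycles of top degree and exchange of the monomials in a product\<close>

primrec lprod :: "(nat \<Rightarrow> nat \<Rightarrow>\<^sub>0 nat) \<Rightarrow> nat \<Rightarrow> (nat \<times> nat) list \<Rightarrow>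
    ((nat \<Rightarrow>\<^sub>0 nat) list \<Rightarrow> (nat, 'k::field) mpoly) \<Rightarrow> (nat \<Rightarrow>\<^sub>0 nat) list \<Rightarrow> (nat, 'k) mpoly" where
  "lprod \<beta> k [] z = z"
| "lprod \<beta> k (p # ps) z = lsyz (\<beta> k) p (lprod \<beta> (Suc k) ps z)"

text \<open>The monomials are a function of the index, with index 0 for the scalar factor and 1, 2,
  ... for the syzygies. Permutations of all of them then act by composition with
  \<open>\<beta>\<close>.\<close>

definition mlprod :: "(nat \<Rightarrow> nat \<Rightarrow>\<^sub>0 nat) \<Rightarrow> (nat \<times> nat) list \<Rightarrow>
    ((nat \<Rightarrow>\<^sub>0 nat) list \<Rightarrow> (nat, 'k::field) mpoly) \<Rightarrow> (nat \<Rightarrow>\<^sub>0 nat) list \<Rightarrow> (nat, 'k) mpoly" where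
  "mlprod \<beta> ps z = smul (mono_poly (\<beta> 0)) (lprod \<beta> 1 ps z)"

lemma lprod_cong:
  "(\<And>i. k \<le> i \<Longrightarrow> i < k + length ps \<Longrightarrow> \<beta> i = \<beta>' i) \<Longrightarrow> lprod \<beta> k ps z = lprod \<beta>' k ps z"
  by (induction ps arbitrary: k) auto

lemma lprod_snoc: "lprod \<beta> k (ps @ [p]) z = lprod \<beta> k ps (lsyz (\<beta> (k + length ps)) p z)"
  by (induction ps arbitrary: k) simp_all

lemma lprod_diff: "lprod \<beta> k ps (z - w) = lprod \<beta> k ps z - lprod \<beta> k ps w"
  by (induction ps arbitrary: k) (simp_all add: lsyz_diff)

lemma lprod_smul: "lprod \<beta> k ps (smul q z) = smul q (lprod \<beta> k ps z)"
  by (induction ps arbitrary: k) (simp_all add: lsyz_smul)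

lemma lprod_zero: "lprod \<beta> k ps 0 = 0"
  using lprod_diff[of \<beta> k ps 0 0] by simp

context
  fixes n c :: nat
  assumes c: "c \<ge> 1"
begin

lemma lprod_kcycles:
  assumes "\<And>i. k \<le> i \<Longrightarrow> i < k + length ps \<Longrightarrow> \<beta> i \<in> monomials n (c - 1)"
    "set ps \<subseteq> {1..n} \<times> {1..n}" "z \<in> kcycles n c t d"
  shows "lprod \<beta> k ps z \<in> kcycles n c (length ps + t) (int (length ps) * (int c + 1) + d)"
  using assms(1,2)
proof (induction ps arbitrary: k)
  case (Cons p ps)
  have "lprod \<beta> (Suc k) ps z \<in> kcycles n c (length ps + t) (int (length ps) * (int c + 1) + d)"
    using Cons.prems by (intro Cons.IH) auto
  from lsyz_kcycles[OF c Cons.prems(1) _ this, of k p] Cons.prems(2) show ?case by (simp add: algebra_simps)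
qed (simp add: assms(3))

text \<open>Splits off \<open>s\<close> linear syzygies and leaves a cycle of homological degree
  \<open>r\<close>. Each round applies \<open>kcycles_top_degree_step\<close> to the preimage of
  \<open>D\<close> under the product found so far; elements that are multiples of a variable go into
  \<open>D\<close> at once.\<close>

lemma kcycles_top_degree:
  fixes D :: "((nat \<Rightarrow>\<^sub>0 nat) list \<Rightarrow> (nat, 'k::field) mpoly) set"
  assumes "subgroup_set D"
    and "\<And>\<beta> ps z. (\<And>i. 1 \<le> i \<Longrightarrow> i \<le> s \<Longrightarrow> \<beta> i \<in> monomials n (c - 1)) \<Longrightarrow> set ps \<subseteq> {1..n} \<times> {1..n} \<Longrightarrow> length ps = s \<Longrightarrow>
      z \<in> kcycles n c r (int r * (int c + 1)) \<Longrightarrow> lprod \<beta> 1 ps z \<in> D"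
    and "\<And>i z. i \<in> {1..n} \<Longrightarrow> z \<in> kcycles n c (s + r) (int (s + r) * (int c + 1) - 1) \<Longrightarrow> smul (var i) z \<in> D"
  shows "kcycles n c (s + r) (int (s + r) * (int c + 1)) \<subseteq> D"
  using assms(2-)
proof (induction s arbitrary: r)
  case 0
  show ?case using 0(1)[of _ "[]"] by auto
next
  case (Suc s)
  have sr: "s + Suc r = Suc s + r" by simp
  have "kcycles n c (s + Suc r) (int (s + Suc r) * (int c + 1)) \<subseteq> D"
  proof (rule Suc.IH)
    fix \<beta> ps and z :: "(nat \<Rightarrow>\<^sub>0 nat) list \<Rightarrow> (nat, 'k) mpoly"
    assume \<beta>: "\<And>i. 1 \<le> i \<Longrightarrow> i \<le> s \<Longrightarrow> \<beta> i \<in> monomials n (c - 1)" and ps: "set ps \<subseteq> {1..n} \<times> {1..n}" "length ps = s"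
      and z: "z \<in> kcycles n c (Suc r) (int (Suc r) * (int c + 1))"
    have "kcycles n c (Suc r) (int (Suc r) * (int c + 1)) \<subseteq> {z. lprod \<beta> 1 ps z \<in> D}"
    proof (rule kcycles_top_degree_step[OF c])
      show "subgroup_set {z. lprod \<beta> 1 ps z \<in> D}"
        using assms(1) by (intro subgroup_setI) (auto simp: lprod_diff lprod_zero intro: subgroup_set_zero subgroup_set_diff)
    next
      fix b p and z :: "(nat \<Rightarrow>\<^sub>0 nat) list \<Rightarrow> (nat, 'k) mpoly"
      assume b: "b \<in> monomials n (c - 1)" "p \<in> {1..n} \<times> {1..n}" and z: "z \<in> kcycles n c r (int r * (int c + 1))"
      \<comment> \<open>Index \<open>Suc s\<close> is the first one that \<open>ps\<close> does not
        read, so the new monomial can be stored there without changing the product.\<close>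
      define \<beta>' where "\<beta>' = \<beta>(Suc s := b)"
      have "lprod \<beta> 1 ps (lsyz b p z) = lprod \<beta>' 1 ps (lsyz b p z)"
        by (rule lprod_cong) (auto simp: \<beta>'_def ps)
      also have "\<dots> = lprod \<beta>' 1 (ps @ [p]) z"
        by (simp add: lprod_snoc ps \<beta>'_def)
      also have "\<dots> \<in> D"
        using \<beta> b ps z by (intro Suc.prems(1)) (auto simp: \<beta>'_def)
      finally show "lsyz b p z \<in> {z. lprod \<beta> 1 ps z \<in> D}" by simp
    next
      fix i and z :: "(nat \<Rightarrow>\<^sub>0 nat) list \<Rightarrow> (nat, 'k) mpoly"
      assume i: "i \<in> {1..n}" and z: "z \<in> kcycles n c (Suc r) (int (Suc r) * (int c + 1) - 1)"
      have "lprod \<beta> 1 ps z \<in> kcycles n c (Suc s + r) (int (Suc s + r) * (int c + 1) - 1)"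
        using lprod_kcycles[OF _ ps(1) z, of 1 \<beta>] \<beta> by (simp add: ps(2) algebra_simps)
      from Suc.prems(2)[OF i this] show "smul (var i) z \<in> {z. lprod \<beta> 1 ps z \<in> D}"
        by (simp only: lprod_smul mem_Collect_eq)
    qed
    then show "lprod \<beta> 1 ps z \<in> D" using z by blast
  next
    fix i and z :: "(nat \<Rightarrow>\<^sub>0 nat) list \<Rightarrow> (nat, 'k) mpoly"
    assume "i \<in> {1..n}" "z \<in> kcycles n c (s + Suc r) (int (s + Suc r) * (int c + 1) - 1)"
    then show "smul (var i) z \<in> D" unfolding sr by (rule Suc.prems(2))
  qed
  then show ?case unfolding sr .
qed

text \<open>The sum is the boundary of \<open>[a x_i] [b x_j] z - [a x_j] [b x_i] z\<close>. Thus
  exchanging the scalar monomial with that of the syzygy changes the sign in homology.\<close>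

lemma mono_smul_lsyz_swap:
  assumes a: "a \<in> monomials n (c - 1)" and b: "b \<in> monomials n (c - 1)"
    and p: "p \<in> {1..n} \<times> {1..n}" and z: "z \<in> kcycles n c t d"
  shows "smul (mono_poly a) (lsyz b p z) + smul (mono_poly b) (lsyz a p z) \<in> kbounds n c (Suc t) (d + 2 * int c)"
proof -
  obtain i j where ij: "p = (i, j)" "i \<in> {1..n}" "j \<in> {1..n}" using p by auto
  define e where "e i = (Poly_Mapping.single i 1 :: nat \<Rightarrow>\<^sub>0 nat)" for i :: nat
  note m = monomials_pred_add[OF c, folded e_def]
  define w where "w = wedge (a + e i) (wedge (b + e j) z) - wedge (a + e j) (wedge (b + e i) z)"
  have z0: "z \<in> kchains n c t d" "bd n c z = 0" using z by (simp_all add: kcycles_def)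
  have "wedge u (wedge u' z) \<in> kchains n c (Suc (Suc t)) (d + 2 * int c)"
    if "u \<in> monomials n c" "u' \<in> monomials n c" for u u'
    using wedge_kchains[OF that(1) wedge_kchains[OF that(2) z0(1)]] by (simp add: algebra_simps)
  then have "w \<in> kchains n c (Suc (Suc t)) (d + 2 * int c)"
    unfolding w_def using a b ij m by (intro subgroup_set_diff[OF subgroup_set_kchains]) auto
  moreover have bdw: "bd n c (wedge (u + e i') (wedge (u' + e j') z)) =
      smul (mono_poly u) (smul (var i') (wedge (u' + e j') z)) - smul (mono_poly u') (smul (var j') (wedge (u + e i') z))"
    if "u \<in> monomials n (c - 1)" "u' \<in> monomials n (c - 1)" "i' \<in> {1..n}" "j' \<in> {1..n}" for u u' i' j'
    using that m
    by (simp only: bd_wedge z0 wedge_fun_zero diff_zero wedge_smul wedge_fun_diff)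
       (simp add: smul_smul mono_poly_add var_eq_mono_poly e_def)
  have "bd n c w = smul (mono_poly a) (lsyz b p z) + smul (mono_poly b) (lsyz a p z)"
    unfolding w_def bd_diff bdw[OF a b ij(2,3)] bdw[OF a b ij(3,2)] ij(1) lsyz.simps e_def[symmetric]
    by (simp add: smul_diff algebra_simps)
  ultimately show ?thesis unfolding kbounds_def by (metis image_eqI)
qed

text \<open>The scalar \<open>a\<close> moves inwards through the outer syzygies, which commute with
  scalars and preserve boundaries, until it meets the one with index \<open>j\<close>.\<close>

lemma mono_smul_lprod_swap:
  assumes \<beta>: "\<And>i. \<beta> i \<in> monomials n (c - 1)" and a: "a \<in> monomials n (c - 1)"
    and ps: "set ps \<subseteq> {1..n} \<times> {1..n}" and z: "z \<in> kcycles n c t d" and "k \<le> j" "j < k + length ps"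
  shows "smul (mono_poly a) (lprod \<beta> k ps z) + smul (mono_poly (\<beta> j)) (lprod (\<beta>(j := a)) k ps z)
    \<in> kbounds n c (length ps + t) (int (length ps) * (int c + 1) + d + (int c - 1))"
  using ps \<open>k \<le> j\<close> \<open>j < k + length ps\<close>
proof (induction ps arbitrary: k)
  case (Cons p ps)
  have deg: "int (length ps) * (int c + 1) + d + 2 * int c = int (length (p # ps)) * (int c + 1) + d + (int c - 1)"
    by (simp add: algebra_simps)
  show ?case
  proof (cases "j = k")
    case True
    have eq: "lprod (\<beta>(k := a)) (Suc k) ps z = lprod \<beta> (Suc k) ps z" by (rule lprod_cong) auto
    have "lprod \<beta> (Suc k) ps z \<in> kcycles n c (length ps + t) (int (length ps) * (int c + 1) + d)"
      by (rule lprod_kcycles[OF _ _ z], rule \<beta>) (use Cons.prems in auto)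
    from mono_smul_lsyz_swap[OF a \<beta> _ this, of p k] Cons.prems(1)
    have "smul (mono_poly a) (lsyz (\<beta> k) p (lprod \<beta> (Suc k) ps z)) + smul (mono_poly (\<beta> k)) (lsyz a p (lprod \<beta> (Suc k) ps z))
      \<in> kbounds n c (length (p # ps) + t) (int (length (p # ps)) * (int c + 1) + d + (int c - 1))"
      unfolding deg by simp
    then show ?thesis unfolding True lprod.simps fun_upd_same eq .
  next
    case False
    then have j: "Suc k \<le> j" "j < Suc k + length ps" using Cons.prems by auto
    have "smul (mono_poly a) (lprod \<beta> (Suc k) ps z) + smul (mono_poly (\<beta> j)) (lprod (\<beta>(j := a)) (Suc k) ps z)
      \<in> kbounds n c (length ps + t) (int (length ps) * (int c + 1) + d + (int c - 1))"
      using Cons.prems(1) by (intro Cons.IH j) auto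
    from lsyz_kbounds[OF c \<beta> _ this, of p k] Cons.prems(1)
    have "lsyz (\<beta> k) p (smul (mono_poly a) (lprod \<beta> (Suc k) ps z) + smul (mono_poly (\<beta> j)) (lprod (\<beta>(j := a)) (Suc k) ps z))
      \<in> kbounds n c (length (p # ps) + t) (int (length (p # ps)) * (int c + 1) + d + (int c - 1))"
      by (simp add: algebra_simps)
    then show ?thesis using False by (simp only: lprod.simps lsyz_add lsyz_smul fun_upd_other not_sym)
  qed
qed simp

context
  fixes ps :: "(nat \<times> nat) list" and z :: "(nat \<Rightarrow>\<^sub>0 nat) list \<Rightarrow> (nat, 'k::field) mpoly" and t :: nat and d :: int
    and B :: "((nat \<Rightarrow>\<^sub>0 nat) list \<Rightarrow> (nat, 'k) mpoly) set"
  assumes ps: "set ps \<subseteq> {1..n} \<times> {1..n}" and z: "z \<in> kcycles n c t d"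
  defines "B \<equiv> kbounds n c (length ps + t) (int (length ps) * (int c + 1) + d + (int c - 1))"
begin

lemma subgroup_set_B: "subgroup_set B"
  unfolding B_def by (rule subgroup_set_kbounds)

lemma mlprod_transpose_0:
  assumes \<beta>: "\<And>i. \<beta> i \<in> monomials n (c - 1)" and j: "1 \<le> j" "j \<le> length ps"
  shows "mlprod (\<beta> \<circ> transpose 0 j) ps z + mlprod \<beta> ps z \<in> B"
proof -
  have "lprod (\<beta> \<circ> transpose 0 j) 1 ps z = lprod (\<beta>(j := \<beta> 0)) 1 ps z"
    by (rule lprod_cong) (auto simp: transpose_def)
  then show ?thesis
    using mono_smul_lprod_swap[OF \<beta> \<beta> ps z, of 1 j 0] j by (simp add: mlprod_def B_def add.commute)
qed

text \<open>Exchanges with index 0 are the ones available directly. Any other transposition (a b) is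
  (0 a)(0 b)(0 a), and three changes of sign amount to one.\<close>

lemma mlprod_transpose:
  assumes \<beta>: "\<And>i. \<beta> i \<in> monomials n (c - 1)" and "a \<le> length ps" "b \<le> length ps" "a \<noteq> b"
  shows "mlprod (\<beta> \<circ> transpose a b) ps z + mlprod \<beta> ps z \<in> B"
proof (cases "a = 0 \<or> b = 0")
  case True
  then show ?thesis
    using assms mlprod_transpose_0[OF \<beta>, of a] mlprod_transpose_0[OF \<beta>, of b] by (auto simp: transpose_commute)
next
  case False
  have eq: "transpose a b = transpose 0 a \<circ> transpose 0 b \<circ> transpose 0 a"
    using False assms(4) by (auto simp: transpose_def fun_eq_iff)
  define \<beta>1 where "\<beta>1 = \<beta> \<circ> transpose 0 a"
  define \<beta>2 where "\<beta>2 = \<beta>1 \<circ> transpose 0 b"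
  have 1: "mlprod \<beta>1 ps z + mlprod \<beta> ps z \<in> B"
    unfolding \<beta>1_def using False assms by (intro mlprod_transpose_0) auto
  have 2: "mlprod \<beta>2 ps z + mlprod \<beta>1 ps z \<in> B"
    unfolding \<beta>2_def using False assms by (intro mlprod_transpose_0) (auto simp: \<beta>1_def)
  have 3: "mlprod (\<beta>2 \<circ> transpose 0 a) ps z + mlprod \<beta>2 ps z \<in> B"
    using False assms by (intro mlprod_transpose_0) (auto simp: \<beta>1_def \<beta>2_def)
  have "mlprod (\<beta>2 \<circ> transpose 0 a) ps z + mlprod \<beta> ps z =
      ((mlprod (\<beta>2 \<circ> transpose 0 a) ps z + mlprod \<beta>2 ps z) - (mlprod \<beta>2 ps z + mlprod \<beta>1 ps z))
      + (mlprod \<beta>1 ps z + mlprod \<beta> ps z)" by (simp only: algebra_simps)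
  also have "\<dots> \<in> B"
    by (rule subgroup_set_add[OF subgroup_set_B subgroup_set_diff[OF subgroup_set_B 3 2] 1])
  finally show ?thesis by (simp add: eq \<beta>1_def \<beta>2_def comp_assoc)
qed

lemma mlprod_permute:
  assumes \<beta>: "\<And>i. \<beta> i \<in> monomials n (c - 1)" and p: "p permutes {..length ps}"
  shows "mlprod (\<beta> \<circ> p) ps z - smul (of_int (sign p)) (mlprod \<beta> ps z) \<in> B"
  using finite_atMost p
proof (induction rule: permutes_rev_induct)
  case id
  have eq: "mlprod (\<beta> \<circ> id) ps z - smul (of_int (sign id)) (mlprod \<beta> ps z) = 0" by (rule ext) simp
  show ?case unfolding eq by (rule subgroup_set_zero[OF subgroup_set_B])
next
  case (swap a b p)
  define p' where "p' = p \<circ> transpose a b"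
  have "permutation p" using swap.hyps by (auto simp: permutation_permutes)
  then have sgn: "sign p' = - sign p"
    using swap.hyps by (simp add: p'_def sign_compose permutation_swap_id sign_swap_id)
  have "mlprod (\<beta> \<circ> p') ps z - smul (of_int (sign p')) (mlprod \<beta> ps z) =
      (mlprod ((\<beta> \<circ> p) \<circ> transpose a b) ps z + mlprod (\<beta> \<circ> p) ps z)
      - (mlprod (\<beta> \<circ> p) ps z - smul (of_int (sign p)) (mlprod \<beta> ps z))"
    by (rule ext) (simp only: sgn, simp add: p'_def comp_assoc fun_Compl_def)
  also have "\<dots> \<in> B"
  proof (rule subgroup_set_diff[OF subgroup_set_B _ swap.IH])
    show "mlprod ((\<beta> \<circ> p) \<circ> transpose a b) ps z + mlprod (\<beta> \<circ> p) ps z \<in> B"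
      using swap.hyps \<beta> by (intro mlprod_transpose) (simp_all only: comp_apply atMost_iff not_False_eq_True)
  qed
  finally show ?case by (simp only: p'_def)
qed

end

end

section \<open>Antisymmetrised products\<close>

text \<open>Expanding the linear syzygies, the antisymmetrisation of their product becomes a combination
  of the following terms, in which a monomial of degree \<open>c\<close> multiplies a cycle.\<close>

primrec wprod :: "(nat \<Rightarrow> nat \<Rightarrow>\<^sub>0 nat) \<Rightarrow> nat \<Rightarrow> nat list \<Rightarrow>
    ((nat \<Rightarrow>\<^sub>0 nat) list \<Rightarrow> (nat, 'k::field) mpoly) \<Rightarrow> (nat \<Rightarrow>\<^sub>0 nat) list \<Rightarrow> (nat, 'k) mpoly" where
  "wprod \<beta> k [] z = z"
| "wprod \<beta> k (j # js) z = wedge (\<beta> k + Poly_Mapping.single j 1) (wprod \<beta> (Suc k) js z)"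

text \<open>The m-th summand of the boundary of \<open>wprod\<close>: the m-th bracket is replaced
  by its monomial, with sign (-1)^m.\<close>

primrec wface :: "(nat \<Rightarrow> nat \<Rightarrow>\<^sub>0 nat) \<Rightarrow> nat \<Rightarrow> nat list \<Rightarrow> nat \<Rightarrow>
    ((nat \<Rightarrow>\<^sub>0 nat) list \<Rightarrow> (nat, 'k::field) mpoly) \<Rightarrow> (nat \<Rightarrow>\<^sub>0 nat) list \<Rightarrow> (nat, 'k) mpoly" where
  "wface \<beta> k [] m z = 0"
| "wface \<beta> k (j # js) m z = (case m of
     0 \<Rightarrow> smul (mono_poly (\<beta> k + Poly_Mapping.single j 1)) (wprod \<beta> (Suc k) js z)
   | Suc m \<Rightarrow> - wedge (\<beta> k + Poly_Mapping.single j 1) (wface \<beta> (Suc k) js m z))"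

lemma wprod_cong:
  "(\<And>i. k \<le> i \<Longrightarrow> i < k + length js \<Longrightarrow> \<beta> i = \<beta>' i) \<Longrightarrow> wprod \<beta> k js z = wprod \<beta>' k js z"
  by (induction js arbitrary: k) auto

lemma wface_cong:
  "(\<And>i. k \<le> i \<Longrightarrow> i < k + length js \<Longrightarrow> \<beta> i = \<beta>' i) \<Longrightarrow> wface \<beta> k js m z = wface \<beta>' k js m z"
proof (induction js arbitrary: k m)
  case (Cons j js)
  have "wprod \<beta> (Suc k) js z = wprod \<beta>' (Suc k) js z" using Cons.prems by (intro wprod_cong) auto
  moreover have "wface \<beta> (Suc k) js m' z = wface \<beta>' (Suc k) js m' z" for m'
    using Cons.prems by (intro Cons.IH) auto
  moreover have "\<beta> k = \<beta>' k" using Cons.prems by simp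
  ultimately show ?case by (cases m) (simp_all only: wface.simps nat.case)
qed simp

lemma wedge_fun_uminus: "wedge u (- z) = - wedge u z"
  using wedge_fun_diff[of u 0 z] by simp

lemma wedge_fun_sum: "wedge u (sum f I) = (\<Sum>i\<in>I. wedge u (f i))"
proof (induction I rule: infinite_finite_induct)
  case (insert i I)
  have "wedge u (f i + sum f I) = wedge u (f i) - wedge u (- sum f I)"
    using wedge_fun_diff[of u "f i" "- sum f I"] by (simp only: diff_minus_eq_add)
  then show ?case using insert by (simp only: sum.insert wedge_fun_uminus diff_minus_eq_add insert.IH simp_thms)
qed (simp_all only: sum.infinite sum.empty wedge_fun_zero simp_thms)

context
  fixes n c :: nat
  assumes c: "c \<ge> 1"
begin

lemma wprod_kchains:
  assumes \<beta>: "\<And>i. \<beta> i \<in> monomials n (c - 1)" and "set js \<subseteq> {1..n}" and z: "z \<in> kchains n c t d"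
  shows "wprod \<beta> k js z \<in> kchains n c (length js + t) (d + int (length js) * int c)"
  using assms(2)
proof (induction js arbitrary: k)
  case (Cons j js)
  then have "wprod \<beta> (Suc k) js z \<in> kchains n c (length js + t) (d + int (length js) * int c)" by simp
  from wedge_kchains[OF monomials_pred_add[OF c \<beta>] this, of j k] Cons.prems show ?case
    by (simp add: algebra_simps)
qed (simp add: z)

lemma bd_wprod:
  assumes \<beta>: "\<And>i. \<beta> i \<in> monomials n (c - 1)" and "set js \<subseteq> {1..n}" and z: "bd n c z = 0"
  shows "bd n c (wprod \<beta> k js z) = (\<Sum>m<length js. wface \<beta> k js m z)"
  using assms(2)
proof (induction js arbitrary: k)
  case (Cons j js)
  have "bd n c (wprod \<beta> k (j # js) z) = smul (mono_poly (\<beta> k + Poly_Mapping.single j 1)) (wprod \<beta> (Suc k) js z)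
      - wedge (\<beta> k + Poly_Mapping.single j 1) (\<Sum>m<length js. wface \<beta> (Suc k) js m z)"
  proof -
    have "j \<in> {1..n}" "set js \<subseteq> {1..n}" using Cons.prems by auto
    then show ?thesis
      by (simp only: wprod.simps bd_wedge[OF monomials_pred_add[OF c \<beta>]] Cons.IH)
  qed
  then show ?case
    by (simp only: list.size add_0_right add_Suc_right sum.lessThan_Suc_shift wface.simps nat.case wedge_fun_sum)
       (simp add: sum_negf)
qed (simp add: z)

text \<open>In the m-th face the monomial with index \<open>k + m\<close> has left its bracket and
  is a scalar like \<open>a\<close>, so the two can be exchanged without a sign.\<close>

lemma mono_smul_wface_swap:
  assumes "m < length js"
  shows "smul (mono_poly a) (wface \<beta> k js m z) = smul (mono_poly (\<beta> (k + m))) (wface (\<beta>(k + m := a)) k js m z)"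
  using assms
proof (induction js arbitrary: k m)
  case (Cons j js)
  show ?case
  proof (cases m)
    case 0
    have eq: "wprod (\<beta>(k := a)) (Suc k) js z = wprod \<beta> (Suc k) js z" by (rule wprod_cong) auto
    show ?thesis
      unfolding 0 wface.simps nat.case add_0_right fun_upd_same eq smul_smul Poly_Mapping.mult_single
      by (simp only: ac_simps)
  next
    case (Suc m')
    have "smul (mono_poly a) (wface \<beta> (Suc k) js m' z) =
        smul (mono_poly (\<beta> (Suc k + m'))) (wface (\<beta>(Suc k + m' := a)) (Suc k) js m' z)"
      using Cons.prems by (intro Cons.IH) (simp add: Suc)
    moreover have "Suc k + m' = k + Suc m'" "k \<noteq> k + Suc m'" by simp_all
    ultimately show ?thesis
      by (simp only: Suc wface.simps nat.case fun_upd_other not_False_eq_True smul_uminus wedge_smul[symmetric])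
  qed
qed simp

text \<open>The m-th face, multiplied by the monomial with index 0, is symmetric in the indices 0
  and m + 1. Its antisymmetrisation therefore equals its own negative, hence vanishes as 2 is
  non-zero.\<close>

lemma antisymmetrised_wprod_cycle:
  fixes z :: "(nat \<Rightarrow>\<^sub>0 nat) list \<Rightarrow> (nat, 'k::field) mpoly"
  assumes \<beta>: "\<And>i. \<beta> i \<in> monomials n (c - 1)" and js: "set js \<subseteq> {1..n}" and z: "bd n c z = 0"
    and two: "(2 :: 'k) \<noteq> 0"
  shows "bd n c (\<Sum>p | p permutes {..length js}. smul (of_int (sign p))
    (smul (mono_poly (\<beta> (p 0))) (wprod (\<beta> \<circ> p) 1 js z))) = 0"
proof -
  let ?S = "{p. p permutes {..length js}}"
  define T where "T m \<gamma> = smul (mono_poly (\<gamma> 0)) (wface \<gamma> 1 js m z)" for m \<gamma>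
  have T: "T m (\<gamma> \<circ> transpose 0 (Suc m)) = T m \<gamma>" if "m < length js" for m \<gamma>
  proof -
    have "wface (\<gamma> \<circ> transpose 0 (Suc m)) 1 js m z = wface (\<gamma>(Suc m := \<gamma> 0)) 1 js m z"
      by (rule wface_cong) (auto simp: transpose_def)
    then show ?thesis
      using mono_smul_wface_swap[OF that, of "\<gamma> 0" \<gamma> 1 z] by (simp add: T_def)
  qed
  have zero: "(\<Sum>p\<in>?S. smul (of_int (sign p)) (T m (\<beta> \<circ> p))) = 0" if m: "m < length js" for m
  proof -
    define \<tau> where "\<tau> = transpose 0 (Suc m)"
    define X where "X = (\<Sum>p\<in>?S. smul (of_int (sign p)) (T m (\<beta> \<circ> p)))"
    have \<tau>: "\<tau> permutes {..length js}" unfolding \<tau>_def using m by (intro permutes_swap_id) auto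
    have \<tau>\<tau>: "p \<circ> \<tau> \<circ> \<tau> = p" for p :: "nat \<Rightarrow> nat" by (simp add: \<tau>_def comp_assoc)
    have "X = (\<Sum>p\<in>?S. smul (of_int (sign (p \<circ> \<tau>))) (T m (\<beta> \<circ> (p \<circ> \<tau>))))"
      unfolding X_def
      by (rule sum.reindex_bij_witness[of _ "\<lambda>p. p \<circ> \<tau>" "\<lambda>p. p \<circ> \<tau>"])
         (auto simp: \<tau>\<tau> intro: permutes_compose[OF \<tau>])
    also have "\<dots> = (\<Sum>p\<in>?S. - smul (of_int (sign p)) (T m (\<beta> \<circ> p)))"
    proof (rule sum.cong[OF refl])
      fix p assume "p \<in> ?S"
      then have "permutation p" by (auto simp: permutation_permutes)
      then have "sign (p \<circ> \<tau>) = - sign p"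
        by (simp add: \<tau>_def sign_compose permutation_swap_id sign_swap_id)
      moreover have "T m (\<beta> \<circ> (p \<circ> \<tau>)) = T m (\<beta> \<circ> p)"
        using T[OF m, of "\<beta> \<circ> p"] by (simp add: \<tau>_def comp_assoc)
      ultimately show "smul (of_int (sign (p \<circ> \<tau>))) (T m (\<beta> \<circ> (p \<circ> \<tau>))) = - smul (of_int (sign p)) (T m (\<beta> \<circ> p))"
        by (intro ext) (simp add: fun_Compl_def)
    qed
    also have "\<dots> = - X" by (simp add: X_def sum_negf)
    finally have X: "X = - X" .
    have "X = 0"
    proof (intro ext poly_mapping_eqI)
      fix x y
      have "lookup (X x) y = lookup ((- X) x) y" using X by metis
      then have "lookup (X x) y + lookup (X x) y = 0" by (simp add: fun_Compl_def)
      then have "2 * lookup (X x) y = 0" by (simp only: mult_2)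
      then show "lookup (X x) y = lookup (0 x) y" using two by simp
    qed
    then show ?thesis by (simp add: X_def)
  qed
  have "bd n c (\<Sum>p\<in>?S. smul (of_int (sign p)) (smul (mono_poly (\<beta> (p 0))) (wprod (\<beta> \<circ> p) 1 js z))) =
      (\<Sum>p\<in>?S. \<Sum>m<length js. smul (of_int (sign p)) (T m (\<beta> \<circ> p)))"
    using \<beta> by (simp add: bd_sum bd_smul bd_wprod[OF _ js z] smul_sum T_def)
  also have "\<dots> = (\<Sum>m<length js. \<Sum>p\<in>?S. smul (of_int (sign p)) (T m (\<beta> \<circ> p)))" by (rule sum.swap)
  also have "\<dots> = 0" using zero by (intro sum.neutral) auto
  finally show ?thesis .
qed

text \<open>One term of the expansion of \<open>lprod\<close>, with the first summand taken from
  every syzygy. The second summand is the first one for the swapped pair, with a minus sign, so all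
  other terms have the same form up to sign.\<close>

primrec sprod :: "(nat \<Rightarrow> nat \<Rightarrow>\<^sub>0 nat) \<Rightarrow> nat \<Rightarrow> (nat \<times> nat) list \<Rightarrow>
    ((nat \<Rightarrow>\<^sub>0 nat) list \<Rightarrow> (nat, 'k::field) mpoly) \<Rightarrow> (nat \<Rightarrow>\<^sub>0 nat) list \<Rightarrow> (nat, 'k) mpoly" where
  "sprod \<beta> k [] z = z"
| "sprod \<beta> k (p # ps) z = smul (var (fst p)) (wedge (\<beta> k + Poly_Mapping.single (snd p) 1) (sprod \<beta> (Suc k) ps z))"

lemma sprod_diff: "sprod \<beta> k ps (z - w) = sprod \<beta> k ps z - sprod \<beta> k ps w"
  by (induction ps arbitrary: k) (simp_all only: sprod.simps wedge_fun_diff smul_diff)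

lemma sprod_snoc: "sprod \<beta> k (ps @ [p]) z =
    sprod \<beta> k ps (smul (var (fst p)) (wedge (\<beta> (k + length ps) + Poly_Mapping.single (snd p) 1) z))"
  by (induction ps arbitrary: k) simp_all

lemma sprod_eq_wprod:
  fixes z :: "(nat \<Rightarrow>\<^sub>0 nat) list \<Rightarrow> (nat, 'k::field) mpoly"
  shows "sprod \<beta> k ps z = smul (mono_poly (exponents (map fst ps))) (wprod \<beta> k (map snd ps) z)"
proof (induction ps arbitrary: k)
  case (Cons p ps)
  have "mono_poly (exponents (fst p # map fst ps)) = (var (fst p) * mono_poly (exponents (map fst ps)) :: (nat, 'k) mpoly)"
    by (simp add: var_eq_mono_poly mono_poly_add[symmetric])
  then show ?case by (simp only: sprod.simps Cons.IH list.map wprod.simps wedge_smul smul_smul)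
qed simp

lemma exponents_monomials: "set l \<subseteq> {1..n} \<Longrightarrow> exponents l \<in> monomials n (length l)"
proof (induction l)
  case (Cons i l)
  then have "Poly_Mapping.single i 1 + exponents l \<in> monomials n (1 + length l)"
    by (intro monomials_add monomials_single) auto
  then show ?case by simp
qed (simp add: monomials_0)

text \<open>The induction expands the syzygies in \<open>ps\<close> one at a time and collects them
  in \<open>pre\<close>. When all c are expanded, the variables outside the brackets form a monomial
  of degree c. It is the same for all permutations and multiplies the antisymmetrised cycle, so the
  result is a boundary.\<close>

lemma antisymmetrised_expansion_kbounds:
  fixes z :: "(nat \<Rightarrow>\<^sub>0 nat) list \<Rightarrow> (nat, 'k::field) mpoly"
  assumes \<beta>: "\<And>i. \<beta> i \<in> monomials n (c - 1)" and z: "z \<in> kcycles n c t d" and two: "(2 :: 'k) \<noteq> 0"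
    and "set pre \<subseteq> {1..n} \<times> {1..n}" "set ps \<subseteq> {1..n} \<times> {1..n}" "length pre + length ps = c"
  shows "(\<Sum>p | p permutes {..c}. smul (of_int (sign p)) (smul (mono_poly (\<beta> (p 0)))
      (sprod (\<beta> \<circ> p) 1 pre (lprod (\<beta> \<circ> p) (1 + length pre) ps z))))
    \<in> kbounds n c (c + t) (int c * (int c + 1) + d + (int c - 1))"
  using assms(4-)
proof (induction ps arbitrary: pre)
  case Nil
  then have pre: "length pre = c" by simp
  let ?u = "exponents (map fst pre)" and ?js = "map snd pre"
  have u: "?u \<in> monomials n c" using exponents_monomials[of "map fst pre"] Nil(1) by (force simp: pre)
  have js: "set ?js \<subseteq> {1..n}" "length ?js = c" using Nil(1) by (auto simp: pre)
  define \<zeta> where "\<zeta> = (\<Sum>p | p permutes {..c}. smul (of_int (sign p)) (smul (mono_poly (\<beta> (p 0))) (wprod (\<beta> \<circ> p) 1 ?js z)))"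
  have "\<zeta> \<in> kchains n c (c + t) (int (c - 1) + (d + int c * int c))"
    unfolding \<zeta>_def
  proof (intro subgroup_set_sum[OF subgroup_set_kchains])
    fix p
    have "wprod (\<beta> \<circ> p) 1 ?js z \<in> kchains n c (c + t) (d + int c * int c)"
      using wprod_kchains[where \<beta> = "\<beta> \<circ> p" and k = 1 and z = z, OF _ js(1)] z \<beta> js(2) by (simp add: kcycles_def)
    then have "smul (mono_poly (\<beta> (p 0))) (wprod (\<beta> \<circ> p) 1 ?js z) \<in> kchains n c (c + t) (int (c - 1) + (d + int c * int c))"
      by (rule smul_kchains[OF mono_poly_homog[OF \<beta>]])
    moreover have "(of_int (sign p) :: (nat, 'k) mpoly) \<in> homog {1..n} 0"
      by (cases p rule: sign_cases) (simp_all add: homog_uminus)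
    ultimately show "smul (of_int (sign p)) (smul (mono_poly (\<beta> (p 0))) (wprod (\<beta> \<circ> p) 1 ?js z))
        \<in> kchains n c (c + t) (int (c - 1) + (d + int c * int c))"
      using smul_kchains by fastforce
  qed
  moreover have "bd n c \<zeta> = 0"
    using antisymmetrised_wprod_cycle[where \<beta> = \<beta>, OF \<beta> js(1) _ two] z js(2) by (simp add: \<zeta>_def kcycles_def)
  ultimately have "\<zeta> \<in> kcycles n c (c + t) (int (c - 1) + (d + int c * int c))" by (simp add: kcycles_def)
  from mono_smul_kbounds[OF u this]
  have "smul (mono_poly ?u) \<zeta> \<in> kbounds n c (c + t) (int c + (int (c - 1) + (d + int c * int c)))" .
  also have "int c + (int (c - 1) + (d + int c * int c)) = int c * (int c + 1) + d + (int c - 1)"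
    using c by (simp add: algebra_simps)
  also have "smul (mono_poly ?u) \<zeta> = (\<Sum>p | p permutes {..c}. smul (of_int (sign p)) (smul (mono_poly (\<beta> (p 0)))
      (sprod (\<beta> \<circ> p) 1 pre (lprod (\<beta> \<circ> p) (1 + length pre) [] z))))"
    unfolding \<zeta>_def smul_sum lprod.simps sprod_eq_wprod by (intro sum.cong refl) (simp only: smul_left_commute)
  finally show ?case .
next
  case (Cons q ps)
  obtain i j where q: "q = (i, j)" by (cases q)
  define X where "X pre p = smul (of_int (sign p)) (smul (mono_poly (\<beta> (p 0)))
      (sprod (\<beta> \<circ> p) 1 pre (lprod (\<beta> \<circ> p) (1 + length pre) ps z)))" for pre p
  have X: "(\<Sum>p | p permutes {..c}. X (pre @ [r]) p) \<in> kbounds n c (c + t) (int c * (int c + 1) + d + (int c - 1))"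
    if "r \<in> {1..n} \<times> {1..n}" for r
    unfolding X_def by (rule Cons.IH) (use Cons.prems that in auto)
  have "(i, j) \<in> {1..n} \<times> {1..n}" "(j, i) \<in> {1..n} \<times> {1..n}" using Cons.prems q by auto
  from subgroup_set_diff[OF subgroup_set_kbounds X[OF this(1)] X[OF this(2)]]
  have "(\<Sum>p | p permutes {..c}. X (pre @ [(i, j)]) p - X (pre @ [(j, i)]) p)
      \<in> kbounds n c (c + t) (int c * (int c + 1) + d + (int c - 1))"
    by (simp only: sum_subtractf)
  also have "(\<Sum>p | p permutes {..c}. X (pre @ [(i, j)]) p - X (pre @ [(j, i)]) p) =
      (\<Sum>p | p permutes {..c}. smul (of_int (sign p)) (smul (mono_poly (\<beta> (p 0)))
      (sprod (\<beta> \<circ> p) 1 pre (lprod (\<beta> \<circ> p) (1 + length pre) (q # ps) z))))"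
    unfolding X_def q
    by (intro sum.cong refl)
       (simp only: lprod.simps lsyz.simps sprod_snoc sprod_diff smul_diff fst_conv snd_conv length_append list.size
         add_0_right add_Suc_right One_nat_def add_Suc add_0_left)
  finally show ?case .
qed

theorem mlprod_kbounds:
  fixes z :: "(nat \<Rightarrow>\<^sub>0 nat) list \<Rightarrow> (nat, 'k::field) mpoly"
  assumes \<beta>: "\<And>i. \<beta> i \<in> monomials n (c - 1)" and ps: "set ps \<subseteq> {1..n} \<times> {1..n}" "length ps = c"
    and z: "z \<in> kcycles n c t d" and fact: "(of_nat (fact (c + 1)) :: 'k) \<noteq> 0"
  shows "mlprod \<beta> ps z \<in> kbounds n c (c + t) (int c * (int c + 1) + d + (int c - 1))"
proof -
  define B where "B = (kbounds n c (c + t) (int c * (int c + 1) + d + (int c - 1)) ::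
    ((nat \<Rightarrow>\<^sub>0 nat) list \<Rightarrow> (nat, 'k) mpoly) set)"
  have B: "subgroup_set B" unfolding B_def by (rule subgroup_set_kbounds)
  let ?S = "{p. p permutes {..c}}"
  \<comment> \<open>As c >= 1, the factorial is even, so its being non-zero in the field makes 2
    non-zero as well.\<close>
  have "2 dvd (fact (c + 1) :: nat)" using c by (intro dvd_fact) auto
  then obtain m where "(fact (c + 1) :: nat) = 2 * m" ..
  then have "(of_nat (fact (c + 1)) :: 'k) = 2 * of_nat m" by (simp only: of_nat_mult of_nat_numeral)
  then have two: "(2 :: 'k) \<noteq> 0" using fact by auto
  have sgn_homog: "(of_int (sign p) :: (nat, 'k) mpoly) \<in> homog {1..n} 0" for p :: "nat \<Rightarrow> nat"
    by (cases p rule: sign_cases) (simp_all add: homog_uminus)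
  have scale: "smul q x \<in> B" if "q \<in> homog {1..n} 0" "x \<in> B" for q x
    using smul_kbounds[OF that(1) that(2)[unfolded B_def]] by (simp add: B_def)
  have "(\<Sum>p\<in>?S. smul (of_int (sign p)) (mlprod (\<beta> \<circ> p) ps z)) \<in> B"
    using antisymmetrised_expansion_kbounds[where \<beta> = \<beta> and pre = "[]", OF \<beta> z two _ ps(1)] ps(2)
    by (simp add: B_def mlprod_def)
  \<comment> \<open>Multiplied by its sign, the relation for each permutation contributes exactly
    one copy of the unpermuted product, since signs square to 1. Subtracting this from the
    antisymmetrisation leaves (c + 1)! copies.\<close>
  moreover have "(\<Sum>p\<in>?S. smul (of_int (sign p)) (mlprod (\<beta> \<circ> p) ps z - smul (of_int (sign p)) (mlprod \<beta> ps z))) \<in> B"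
  proof (intro subgroup_set_sum[OF B] scale sgn_homog)
    fix p assume "p \<in> ?S"
    then show "mlprod (\<beta> \<circ> p) ps z - smul (of_int (sign p)) (mlprod \<beta> ps z) \<in> B"
      using mlprod_permute[where \<beta> = \<beta>, OF c ps(1) z \<beta>, of p] by (simp add: ps(2) B_def)
  qed
  ultimately have "(\<Sum>p\<in>?S. smul (of_int (sign p)) (mlprod (\<beta> \<circ> p) ps z))
      - (\<Sum>p\<in>?S. smul (of_int (sign p)) (mlprod (\<beta> \<circ> p) ps z - smul (of_int (sign p)) (mlprod \<beta> ps z))) \<in> B"
    by (rule subgroup_set_diff[OF B])
  also have "(\<Sum>p\<in>?S. smul (of_int (sign p)) (mlprod (\<beta> \<circ> p) ps z))
      - (\<Sum>p\<in>?S. smul (of_int (sign p)) (mlprod (\<beta> \<circ> p) ps z - smul (of_int (sign p)) (mlprod \<beta> ps z)))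
      = (\<Sum>p\<in>?S. mlprod \<beta> ps z)"
    unfolding sum_subtractf[symmetric]
  proof (rule sum.cong[OF refl], rule ext)
    fix p :: "nat \<Rightarrow> nat" and x
    have "(of_int (sign p) * of_int (sign p) :: (nat, 'k) mpoly) = 1"
      by (simp flip: of_int_mult)
    then show "(smul (of_int (sign p)) (mlprod (\<beta> \<circ> p) ps z) - smul (of_int (sign p))
        (mlprod (\<beta> \<circ> p) ps z - smul (of_int (sign p)) (mlprod \<beta> ps z))) x = mlprod \<beta> ps z x"
      by (simp add: right_diff_distrib mult.assoc[symmetric])
  qed
  also have "(\<Sum>p\<in>?S. mlprod \<beta> ps z) = smul (of_nat (fact (c + 1))) (mlprod \<beta> ps z)"
    by (rule ext) (simp add: sum_fun_apply card_permutations[OF refl])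
  finally have *: "smul (of_nat (fact (c + 1))) (mlprod \<beta> ps z) \<in> B" .
  have "smul (Poly_Mapping.single 0 (inverse (of_nat (fact (c + 1))))) (smul (of_nat (fact (c + 1))) (mlprod \<beta> ps z)) \<in> B"
    by (intro scale const_homog *)
  moreover have "Poly_Mapping.single 0 (inverse (of_nat (fact (c + 1)))) * of_nat (fact (c + 1)) = (1 :: (nat, 'k) mpoly)"
    unfolding single_of_nat[symmetric] Poly_Mapping.mult_single left_inverse[OF fact] by simp
  ultimately show ?thesis by (simp only: smul_smul smul_one B_def)
qed

text \<open>Only the lowest degree is new. There every cycle is a sum of \<open>u z\<close> with
  \<open>u\<close> of degree c - 1 and \<open>z\<close> of degree \<open>t * (c + 1)\<close>. If
  \<open>z\<close> is a product of c syzygies and a cycle, \<open>u\<close> serves as the monomial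
  with index 0; if \<open>z\<close> is a variable times a cycle, that variable completes
  \<open>u\<close> to a monomial of degree c.\<close>

theorem kcycles_subset_kbounds_char:
  assumes "(of_nat (fact (c + 1)) :: 'k::field) \<noteq> 0" and "t \<ge> c" and "d \<ge> int t * (int c + 1) + (int c - 1)"
  shows "kcycles n c t d \<subseteq> (kbounds n c t d :: ((nat \<Rightarrow>\<^sub>0 nat) list \<Rightarrow> (nat, 'k) mpoly) set)"
proof (cases "d = int t * (int c + 1) + (int c - 1)")
  case False
  then show ?thesis using assms(3) by (intro kregular_vanishing[OF kregular_kcycles]) simp
next
  case True
  show ?thesis
  proof (rule kregular_generated[OF kregular_kcycles subgroup_set_kbounds])
    show "d \<ge> int t * (int c + 1) + int (c - 1)" using True c by simp
    fix u and z :: "(nat \<Rightarrow>\<^sub>0 nat) list \<Rightarrow> (nat, 'k) mpoly"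
    assume u: "u \<in> monomials n (c - 1)" and z: "z \<in> kcycles n c t (d - int (c - 1))"
    \<comment> \<open>Exactly c syzygies are split off; the remaining homological degree
      \<open>r\<close> is carried by an arbitrary cycle.\<close>
    define r where "r = t - c"
    have t: "t = c + r" using assms(2) by (simp add: r_def)
    define D where "D = {z :: (nat \<Rightarrow>\<^sub>0 nat) list \<Rightarrow> (nat, 'k) mpoly. smul (mono_poly u) z \<in> kbounds n c t d}"
    have "kcycles n c (c + r) (int (c + r) * (int c + 1)) \<subseteq> D"
    proof (rule kcycles_top_degree[OF c])
      show "subgroup_set D"
        unfolding D_def
        using subgroup_set_zero[OF subgroup_set_kbounds] subgroup_set_diff[OF subgroup_set_kbounds]
        by (intro subgroup_setI) (simp_all only: mem_Collect_eq smul_zero smul_diff)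
    next
      fix \<beta> ps and z :: "(nat \<Rightarrow>\<^sub>0 nat) list \<Rightarrow> (nat, 'k) mpoly"
      assume \<beta>: "\<And>i. 1 \<le> i \<Longrightarrow> i \<le> c \<Longrightarrow> \<beta> i \<in> monomials n (c - 1)"
        and ps: "set ps \<subseteq> {1..n} \<times> {1..n}" "length ps = c" and z: "z \<in> kcycles n c r (int r * (int c + 1))"
      \<comment> \<open>The default \<open>u\<close> puts the scalar monomial at index 0 and makes
        every value of the family a monomial of degree c - 1.\<close>
      define \<gamma> where "\<gamma> i = (if 1 \<le> i \<and> i \<le> c then \<beta> i else u)" for i
      have "\<gamma> i \<in> monomials n (c - 1)" for i unfolding \<gamma>_def using \<beta> u by auto
      from mlprod_kbounds[OF this ps z assms(1)]
      have "mlprod \<gamma> ps z \<in> kbounds n c (c + r) (int c * (int c + 1) + int r * (int c + 1) + (int c - 1))" .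
      also have "int c * (int c + 1) + int r * (int c + 1) + (int c - 1) = d"
        unfolding True t by (simp add: algebra_simps)
      also have "mlprod \<gamma> ps z = smul (mono_poly u) (lprod \<beta> 1 ps z)"
      proof -
        have "lprod \<gamma> 1 ps z = lprod \<beta> 1 ps z" by (rule lprod_cong) (auto simp: \<gamma>_def ps)
        then show ?thesis by (simp add: mlprod_def \<gamma>_def)
      qed
      finally show "lprod \<beta> 1 ps z \<in> D" by (simp only: D_def t mem_Collect_eq)
    next
      fix i and z :: "(nat \<Rightarrow>\<^sub>0 nat) list \<Rightarrow> (nat, 'k) mpoly"
      assume i: "i \<in> {1..n}" and z: "z \<in> kcycles n c (c + r) (int (c + r) * (int c + 1) - 1)"
      from mono_smul_kbounds[OF monomials_pred_add[OF c u i] z]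
      have "smul (mono_poly (u + Poly_Mapping.single i 1)) z \<in> kbounds n c t (int c + (int (c + r) * (int c + 1) - 1))"
        by (simp only: t)
      also have "int c + (int (c + r) * (int c + 1) - 1) = d" unfolding True t by simp
      finally show "smul (var i) z \<in> D"
        by (simp only: D_def mem_Collect_eq smul_smul var_eq_mono_poly mono_poly_add)
    qed
    moreover have "d - int (c - 1) = int (c + r) * (int c + 1)" using c by (simp add: True t)
    ultimately show "smul (mono_poly u) z \<in> kbounds n c t d" using z by (auto simp: D_def t)
  qed
qed

end

section \<open>Betti numbers of the Veronese modules\<close>

lemma veronese_map_var: "veronese_map (var u) = mono_poly u"
  by (simp add: veronese_map_def var_def poly_subst_single)

text \<open>For k < c the truncation at negative degrees is automatic, because the corresponding
  degree in S is negative.\<close>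

lemma veronese_eq_homog:
  assumes "k < c"
  shows "veronese n c k = (\<lambda>i. homog {1..n} (int k + i * int c))"
proof
  fix i :: int
  show "veronese n c k i = homog {1..n} (int k + i * int c)"
  proof (cases "i < 0")
    case True
    then have "i * int c \<le> (- 1) * int c" by (intro mult_right_mono) auto
    then have "int k + i * int c < 0" using assms by simp
    then show ?thesis using True by (simp add: veronese_def homog_neg)
  qed (simp add: veronese_def)
qed

text \<open>Regrading: the generators of T have degree 1 in T and degree c in S. So the Koszul
  complex of the Veronese module in T-degree \<open>j\<close> is that of S in degree
  \<open>k + j c\<close>.\<close>

lemma betti_veronese_eq_0:
  assumes "c \<ge> 1" "k < c"
    and van: "kcycles n c i (int k + j * int c) \<subseteq> (kbounds n c i (int k + j * int c) ::
      ((nat \<Rightarrow>\<^sub>0 nat) list \<Rightarrow> (nat, 'k::field) mpoly) set)"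
  shows "betti (monomials n c) veronese_act (veronese n c k :: int \<Rightarrow> (nat, 'k) mpoly set) i j = 0"
proof -
  interpret graded_module "monomials n c" veronese_act "veronese n c k :: int \<Rightarrow> (nat, 'k) mpoly set"
    by (rule graded_module_veronese[OF assms(1)])
  have act: "kdiff (monomials n c) (\<lambda>v. veronese_act (var v)) = (bd n c :: _ \<Rightarrow> _ \<Rightarrow> (nat, 'k) mpoly)"
    unfolding bd_def veronese_act_def[abs_def] veronese_map_var ..
  have deg: "veronese n c k (j - int t) = homog {1..n} (int k + j * int c - int t * int c)" for t
    by (simp add: veronese_eq_homog[OF assms(2)] algebra_simps)
  show ?thesis
  proof (rule betti_eq_0[OF finite_monomials])
    fix \<omega> :: "(nat \<Rightarrow>\<^sub>0 nat) list \<Rightarrow> (nat, 'k) mpoly"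
    assume "\<omega> \<in> kos (monomials n c) i (veronese n c k (j - int i))"
      and "kdiff (monomials n c) (\<lambda>v. veronese_act (var v)) \<omega> = 0"
    then have "\<omega> \<in> kcycles n c i (int k + j * int c)"
      unfolding act by (simp add: kcycles_def kchains_def deg)
    then obtain \<eta> where "\<eta> \<in> kchains n c (Suc i) (int k + j * int c)" "\<omega> = bd n c \<eta>"
      using van unfolding kbounds_def by blast
    moreover have "j - int i - 1 = j - int (Suc i)" by simp
    ultimately show "\<exists>\<eta>\<in>kos (monomials n c) (Suc i) (veronese n c k (j - int i - 1)).
        kdiff (monomials n c) (\<lambda>v. veronese_act (var v)) \<eta> = \<omega>"
      unfolding act kchains_def by (simp only: deg) blast
  qed
qed

text \<open>A strict bound for each degree could become weak in the supremum. Integrality gives the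
  bound with \<open>N - 1\<close> for each degree, which survives the supremum and is strictly
  smaller.\<close>

lemma t_inv_less:
  assumes "c \<ge> 1" and van: "\<And>j. int k + j * int c \<ge> N \<Longrightarrow> betti V act M i j = 0"
  shows "t_inv V act M i < ereal ((real_of_int N - real k) / real c)"
proof -
  have "t_inv V act M i \<le> ereal ((real_of_int N - 1 - real k) / real c)"
    unfolding t_inv_def
  proof (rule Sup_least)
    fix x assume "x \<in> {ereal (of_int j) | j. betti V act M i j \<noteq> 0}"
    then obtain j where j: "x = ereal (of_int j)" "betti V act M i j \<noteq> 0" by blast
    then have "int k + j * int c \<le> N - 1" using van[of j] by linarith
    then have "real_of_int (int k + j * int c) \<le> real_of_int (N - 1)" by (simp only: of_int_le_iff)
    then have "real_of_int j * real c \<le> real_of_int N - 1 - real k" by simp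
    then show "x \<le> ereal ((real_of_int N - 1 - real k) / real c)"
      using assms(1) by (simp add: j(1) pos_le_divide_eq)
  qed
  also have "\<dots> < ereal ((real_of_int N - real k) / real c)"
    using assms(1) by (simp add: divide_strict_right_mono)
  finally show ?thesis .
qed

lemma of_nat_fact_nonzero:
  assumes "CHAR('k::field) = 0 \<or> CHAR('k) > m"
  shows "(of_nat (fact m) :: 'k) \<noteq> 0"
proof -
  have "(of_nat i :: 'k) \<noteq> 0" if "i \<in> {1..m}" for i
    using that assms dvd_imp_le[of "CHAR('k)" i] by (auto simp: of_nat_eq_0_iff_char_dvd)
  then show ?thesis by (simp add: fact_prod of_nat_prod)
qed

theorem corollary4p2:
  fixes n c k i :: nat
  assumes "c \<ge> 1" and "k \<le> c - 1"
  shows "t_inv (monomials n c) veronese_act (veronese n c k :: int \<Rightarrow> (nat, 'k::field) mpoly set) i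
           < ereal (1 + real i + (real i - real k) / real c) \<and>
         ((CHAR('k) = 0 \<or> CHAR('k) > c + 1) \<and> i \<ge> c \<longrightarrow>
         t_inv (monomials n c) veronese_act (veronese n c k :: int \<Rightarrow> (nat, 'k) mpoly set) i
           < ereal (1 + real i + (real i - real k - 1) / real c))"
proof (intro conjI impI)
  have k: "k < c" using assms by simp
  \<comment> \<open>The value of N is the regularity bound \<open>i * (c + 1)\<close> plus c;
    subtracting k and dividing by c gives the stated bound.\<close>
  have "t_inv (monomials n c) veronese_act (veronese n c k :: int \<Rightarrow> (nat, 'k) mpoly set) i
      < ereal ((real_of_int (int i * (int c + 1) + int c) - real k) / real c)"
    by (intro t_inv_less betti_veronese_eq_0 kregular_vanishing[OF kregular_kcycles] assms(1) k)
  also have "(real_of_int (int i * (int c + 1) + int c) - real k) / real c = 1 + real i + (real i - real k) / real c"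
    using assms(1) by (simp add: field_simps)
  finally show "t_inv (monomials n c) veronese_act (veronese n c k :: int \<Rightarrow> (nat, 'k) mpoly set) i
      < ereal (1 + real i + (real i - real k) / real c)" .
next
  assume *: "(CHAR('k) = 0 \<or> CHAR('k) > c + 1) \<and> i \<ge> c"
  have k: "k < c" using assms by simp
  have "t_inv (monomials n c) veronese_act (veronese n c k :: int \<Rightarrow> (nat, 'k) mpoly set) i
      < ereal ((real_of_int (int i * (int c + 1) + (int c - 1)) - real k) / real c)"
    using * by (intro t_inv_less betti_veronese_eq_0 kcycles_subset_kbounds_char of_nat_fact_nonzero assms(1) k) auto
  also have "(real_of_int (int i * (int c + 1) + (int c - 1)) - real k) / real c
      = 1 + real i + (real i - real k - 1) / real c"
    using assms(1) by (simp add: field_simps)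
  finally show "t_inv (monomials n c) veronese_act (veronese n c k :: int \<Rightarrow> (nat, 'k) mpoly set) i
      < ereal (1 + real i + (real i - real k - 1) / real c)" .
qed

end
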